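(* Let $W$ be a trimmed weighted automaton (with set semantics) on a finite alphabet $A$ over an infinitary finitely generated group $\mathbb{G}$, and let $k$ be a positive integer. The following assertions are equivalent: (i) the relation $[\![W]\!]\subseteq A^*\times\mathbb{G}$ satisfies the Lipschitz property of order $k$; (ii) $W$ satisfies the branching twinning property of order $k$; (iii) $[\![W]\!]$ is computed by a $k$-sequential weighted automaton over $\mathbb{G}$. In addition, when these hold, the equivalent $k$-sequential weighted automaton of (iii) can be effectively computed (from $W$).
   Context: Weighted automata. A weighted automaton on a finite alphabet $A$ over a monoid $\mathbb{M}$ is a tuple $W=(Q,t_{init},t_{final},T)$ with $Q$ a finite set of states, $t_{init},t_{final}\subseteq Q\times\mathbb{M}$ finite, and $T\subseteq Q\times A\times\mathbb{M}\times Q$ a finite set of transitions. A state $q$ is initial (resp. final) if $(q,\alpha)\in t_{init}$ (resp. $t_{final}$) for some $\alpha$. A run from $p$ to $q$ on a word $w$ is a sequence of consecutive transitions reading $w$; its output $\alpha$ is the product, in order, of the weights of its transitions ($\mathbf{1}$ for the empty run); notation $p\xrightarrow{w|\alpha}q$. It is accepting if $p$ is initial and $q$ is final. The relation computed by $W$ is $[\![W]\!]=\{(w,\alpha\beta\gamma) : \exists p,q\in Q,\ (p,\alpha)\in t_{init},\ p\xrightarrow{w|\beta}q,\ (q,\gamma)\in t_{final}\}\subseteq A^*\times\mathbb{M}$. $W$ is trimmed if every state appears in some accepting run. Sequentiality. $W$ is sequential if $|t_{init}|=1$ and for all $p\in Q,a\in A$ there is at most one transition of the form $(p,a,\alpha,q)$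 in $T$. It is $k$-sequential if it is a (disjoint) union of $k$ sequential weighted automata (union taken componentwise after renaming states apart). Groups. $\mathbb{G}$ is infinitary if for all $\alpha,\beta,\gamma\in\mathbb{G}$ with $\alpha\beta\gamma\neq\beta$, the set $\{\alpha^n\beta\gamma^n : n\in\mathbb{N}\}$ is infinite. Fix a finite generating set $\Gamma$ of $\mathbb{G}$; the Cayley distance $d(\alpha,\beta)$ is the length of a shortest path from $\alpha$ to $\beta$ in the undirected right Cayley graph (edges between $\alpha$ and $\alpha g$, $g\in\Gamma$). The delay is $delay(\alpha,\beta)=\alpha^{-1}\beta$. For words $u,v$, $dist(u,v)=|u|+|v|-2|lcp(u,v)|$, where $lcp$ is the longest common prefix. Lipschitz property of order $k$. $R\subseteq A^*\times\mathbb{G}$ satisfies it if there is a natural number $L$ such that for all pairs $(w_0,\alpha_0),\dots,(w_k,\alpha_k)\in R$ there are indices $0\le i<j\le k$ with $d(\alpha_i,\alpha_j)\le L\,(dist(w_i,w_j)+1)$. Branching twinning property of order $k$. A weighted automaton over $\mathbb{G}$ satisfies it if: for all states $q_{i,j}$ ($0\le i,j\le k$) with every $q_{0,j}$ initial, all $\gamma_j$ with $(q_{0,j},\gamma_j)\in t_{init}$ ($0\le j\le k$), and all words $u_{i,j},v_{i,j}$ ($1\le i\le k$, $0\le j\le k$) for which there are runs $q_{i-1,j}\xrightarrow{u_{i,j}|\alpha_{i,j}}q_{i,j}$ and $q_{i,j}\xrightarrow{v_{i,j}|\beta_{i,j}}q_{i,j}$ for all $1\le i\le k$, $0\le j\le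 k$, there are $j\ne j'$ such that for all $i\in\{1,\dots,k\}$: if $u_{i',j}=u_{i',j'}$ and $v_{i',j}=v_{i',j'}$ for every $1\le i'\le i$, then $delay(\gamma_j\alpha_{1,j}\cdots\alpha_{i,j},\ \gamma_{j'}\alpha_{1,j'}\cdots\alpha_{i,j'})=delay(\gamma_j\alpha_{1,j}\cdots\alpha_{i,j}\beta_{i,j},\ \gamma_{j'}\alpha_{1,j'}\cdots\alpha_{i,j'}\beta_{i,j'})$. *)

theory Defs
  imports
    "HOL-Algebra.Generated_Groups"
    "HOL-Library.Sublist"
    "HOL-Library.Disjoint_Sets"
    "HOL-Library.Nat_Bijection"
begin

section \<open>Weighted automata\<close>

record ('q, 'a, 'm) automaton =
  states :: "'q set"
  t_init :: "('q \<times> 'm) set"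
  t_final :: "('q \<times> 'm) set"
  transitions :: "('q \<times> 'a \<times> 'm \<times> 'q) set"

definition weighted_automaton ::
    "'a set \<Rightarrow> ('m, 'b) monoid_scheme \<Rightarrow> ('q, 'a, 'm) automaton \<Rightarrow> bool" where
  "weighted_automaton A M W \<longleftrightarrow>
     finite (states W) \<and>
     finite (t_init W) \<and> t_init W \<subseteq> states W \<times> carrier M \<and>
     finite (t_final W) \<and> t_final W \<subseteq> states W \<times> carrier M \<and>
     finite (transitions W) \<and> transitions W \<subseteq> states W \<times> A \<times> carrier M \<times> states W"

definition initial :: "('q, 'a, 'm) automaton \<Rightarrow> 'q \<Rightarrow> bool" where
  "initial W q \<longleftrightarrow> (\<exists>\<alpha>. (q, \<alpha>) \<in> t_init W)"

definition final :: "('q, 'a, 'm) automaton \<Rightarrow> 'q \<Rightarrow> bool" where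
  "final W q \<longleftrightarrow> (\<exists>\<alpha>. (q, \<alpha>) \<in> t_final W)"

fun path ::
    "('q, 'a, 'm) automaton \<Rightarrow> 'q \<Rightarrow> ('q \<times> 'a \<times> 'm \<times> 'q) list \<Rightarrow> 'q \<Rightarrow> bool" where
  "path W p [] q \<longleftrightarrow> p \<in> states W \<and> p = q"
| "path W p ((p', a, \<alpha>, r) # ts) q \<longleftrightarrow> p' = p \<and> (p, a, \<alpha>, r) \<in> transitions W \<and> path W r ts q"

definition path_states :: "'q \<Rightarrow> ('q \<times> 'a \<times> 'm \<times> 'q) list \<Rightarrow> 'q set" where
  "path_states p ts = insert p ((\<lambda>(_, _, _, r). r) ` set ts)"

definition path_word :: "('q \<times> 'a \<times> 'm \<times> 'q) list \<Rightarrow> 'a list" where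
  "path_word ts = map (\<lambda>(_, a, _, _). a) ts"

definition path_output :: "('m, 'b) monoid_scheme \<Rightarrow> ('q \<times> 'a \<times> 'm \<times> 'q) list \<Rightarrow> 'm" where
  "path_output M ts = foldr (\<lambda>(_, _, \<alpha>, _) \<beta>. \<alpha> \<otimes>\<^bsub>M\<^esub> \<beta>) ts \<one>\<^bsub>M\<^esub>"

definition run ::
    "('m, 'b) monoid_scheme \<Rightarrow> ('q, 'a, 'm) automaton \<Rightarrow> 'q \<Rightarrow> 'a list \<Rightarrow> 'm \<Rightarrow> 'q \<Rightarrow> bool" where
  "run M W p w \<alpha> q \<longleftrightarrow> (\<exists>ts. path W p ts q \<and> path_word ts = w \<and> path_output M ts = \<alpha>)"

definition computed_relation ::
    "('m, 'b) monoid_scheme \<Rightarrow> ('q, 'a, 'm) automaton \<Rightarrow> ('a list \<times> 'm) set" where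
  "computed_relation M W =
     {(w, \<alpha> \<otimes>\<^bsub>M\<^esub> \<beta> \<otimes>\<^bsub>M\<^esub> \<gamma>) | w \<alpha> \<beta> \<gamma>.
        \<exists>p q. (p, \<alpha>) \<in> t_init W \<and> run M W p w \<beta> q \<and> (q, \<gamma>) \<in> t_final W}"

definition trimmed :: "('q, 'a, 'm) automaton \<Rightarrow> bool" where
  "trimmed W \<longleftrightarrow>
     (\<forall>s\<in>states W. \<exists>p ts q. initial W p \<and> path W p ts q \<and> final W q \<and> s \<in> path_states p ts)"

definition sequential :: "('q, 'a, 'm) automaton \<Rightarrow> bool" where
  "sequential W \<longleftrightarrow>
     card (t_init W) = 1 \<and>
     (\<forall>p a \<alpha> q \<beta> r. (p, a, \<alpha>, q) \<in> transitions W \<and> (p, a, \<beta>, r) \<in> transitions W \<longrightarrow> \<alpha> = \<beta> \<and> q = r)"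

definition k_sequential ::
    "'a set \<Rightarrow> ('m, 'b) monoid_scheme \<Rightarrow> nat \<Rightarrow> ('q, 'a, 'm) automaton \<Rightarrow> bool" where
  "k_sequential A M k W \<longleftrightarrow>
     (\<exists>V. (\<forall>i<k. weighted_automaton A M (V i) \<and> sequential (V i)) \<and>
          disjoint_family_on (\<lambda>i. states (V i)) {..<k} \<and>
          states W = (\<Union>i<k. states (V i)) \<and>
          t_init W = (\<Union>i<k. t_init (V i)) \<and>
          t_final W = (\<Union>i<k. t_final (V i)) \<and>
          transitions W = (\<Union>i<k. transitions (V i)))"


section \<open>Infinitary groups, distances and delays\<close>

definition infinitary :: "('g, 'b) monoid_scheme \<Rightarrow> bool" where
  "infinitary G \<longleftrightarrow>
     (\<forall>\<alpha>\<in>carrier G. \<forall>\<beta>\<in>carrier G. \<forall>\<gamma>\<in>carrier G. \<alpha> \<otimes>\<^bsub>G\<^esub> \<beta> \<otimes>\<^bsub>G\<^esub> \<gamma> \<noteq> \<beta> \<longrightarrow>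
        infinite {\<alpha> [^]\<^bsub>G\<^esub> n \<otimes>\<^bsub>G\<^esub> \<beta> \<otimes>\<^bsub>G\<^esub> \<gamma> [^]\<^bsub>G\<^esub> n | n :: nat. True})"

definition cayley_edges :: "('g, 'b) monoid_scheme \<Rightarrow> 'g set \<Rightarrow> ('g \<times> 'g) set" where
  "cayley_edges G \<Gamma> =
     {(\<alpha>, \<beta>). \<alpha> \<in> carrier G \<and> \<beta> \<in> carrier G \<and>
        (\<exists>g\<in>\<Gamma>. \<beta> = \<alpha> \<otimes>\<^bsub>G\<^esub> g \<or> \<alpha> = \<beta> \<otimes>\<^bsub>G\<^esub> g)}"

text \<open>Meaningful only when \<open>\<Gamma>\<close> generates \<open>G\<close>, so that the Cayley graph is connected.\<close>

definition cayley_dist :: "('g, 'b) monoid_scheme \<Rightarrow> 'g set \<Rightarrow> 'g \<Rightarrow> 'g \<Rightarrow> nat" where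
  "cayley_dist G \<Gamma> \<alpha> \<beta> = (LEAST n. (\<alpha>, \<beta>) \<in> cayley_edges G \<Gamma> ^^ n)"

definition delay :: "('g, 'b) monoid_scheme \<Rightarrow> 'g \<Rightarrow> 'g \<Rightarrow> 'g" where
  "delay G \<alpha> \<beta> = inv\<^bsub>G\<^esub> \<alpha> \<otimes>\<^bsub>G\<^esub> \<beta>"

definition word_dist :: "'a list \<Rightarrow> 'a list \<Rightarrow> nat" where
  "word_dist u v = length u + length v - 2 * length (longest_common_prefix u v)"


section \<open>Lipschitz and branching twinning properties\<close>

definition lipschitz_property ::
    "('g, 'b) monoid_scheme \<Rightarrow> 'g set \<Rightarrow> nat \<Rightarrow> ('a list \<times> 'g) set \<Rightarrow> bool" where
  "lipschitz_property G \<Gamma> k R \<longleftrightarrow>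
     (\<exists>L :: nat. \<forall>w \<alpha>. (\<forall>i\<le>k. (w i, \<alpha> i) \<in> R) \<longrightarrow>
        (\<exists>i j. i < j \<and> j \<le> k \<and>
           cayley_dist G \<Gamma> (\<alpha> i) (\<alpha> j) \<le> L * (word_dist (w i) (w j) + 1)))"

text \<open>\<open>prefix_product G \<gamma> \<alpha> i\<close> is \<open>\<gamma> \<alpha>\<^sub>1 \<dots> \<alpha>\<^sub>i\<close>.\<close>

primrec prefix_product :: "('g, 'b) monoid_scheme \<Rightarrow> 'g \<Rightarrow> (nat \<Rightarrow> 'g) \<Rightarrow> nat \<Rightarrow> 'g" where
  "prefix_product G \<gamma> \<alpha> 0 = \<gamma>"
| "prefix_product G \<gamma> \<alpha> (Suc i) = prefix_product G \<gamma> \<alpha> i \<otimes>\<^bsub>G\<^esub> \<alpha> (Suc i)"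

definition branching_twinning_property ::
    "('g, 'b) monoid_scheme \<Rightarrow> nat \<Rightarrow> ('q, 'a, 'g) automaton \<Rightarrow> bool" where
  "branching_twinning_property G k W \<longleftrightarrow>
     (\<forall>q \<gamma> u v \<alpha> \<beta>.
        (\<forall>j\<le>k. (q 0 j, \<gamma> j) \<in> t_init W) \<and>
        (\<forall>i\<in>{1..k}. \<forall>j\<le>k.
           run G W (q (i - 1) j) (u i j) (\<alpha> i j) (q i j) \<and>
           run G W (q i j) (v i j) (\<beta> i j) (q i j)) \<longrightarrow>
        (\<exists>j\<le>k. \<exists>j'\<le>k. j \<noteq> j' \<and>
           (\<forall>i\<in>{1..k}.
              (\<forall>i'\<in>{1..i}. u i' j = u i' j' \<and> v i' j = v i' j') \<longrightarrow>
              (let x = prefix_product G (\<gamma> j) (\<lambda>l. \<alpha> l j) i;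
                   y = prefix_product G (\<gamma> j') (\<lambda>l. \<alpha> l j') i
               in delay G x y = delay G (x \<otimes>\<^bsub>G\<^esub> \<beta> i j) (y \<otimes>\<^bsub>G\<^esub> \<beta> i j')))))"


section \<open>Effectivity\<close>

text \<open>
  Partial recursive functions relative to an oracle. They are unary; tuples are coded by
  \<^const>\<open>prod_encode\<close>, so that the pairing, projection, composition, primitive recursion and
  minimisation schemes generate the partial recursive functions of every arity.
\<close>

definition mu_search :: "(nat \<rightharpoonup> nat) \<rightharpoonup> nat" where
  "mu_search g =
     (if \<exists>n. g n = Some 0 \<and> (\<forall>m<n. \<exists>y. g m = Some (Suc y))
      then Some (THE n. g n = Some 0 \<and> (\<forall>m<n. \<exists>y. g m = Some (Suc y)))
      else None)"

primrec prim_rec :: "(nat \<rightharpoonup> nat) \<Rightarrow> (nat \<rightharpoonup> nat) \<Rightarrow> nat \<Rightarrow> nat \<Rightarrow> nat option" where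
  "prim_rec f g a 0 = f a"
| "prim_rec f g a (Suc n) =
     Option.bind (prim_rec f g a n) (\<lambda>r. g (prod_encode (a, prod_encode (n, r))))"

inductive recursive_in :: "(nat \<Rightarrow> nat) \<Rightarrow> (nat \<rightharpoonup> nat) \<Rightarrow> bool" for orc where
  zero: "recursive_in orc (\<lambda>_. Some 0)"
| succ: "recursive_in orc (\<lambda>n. Some (Suc n))"
| left: "recursive_in orc (\<lambda>n. Some (fst (prod_decode n)))"
| right: "recursive_in orc (\<lambda>n. Some (snd (prod_decode n)))"
| oracle_call: "recursive_in orc (\<lambda>n. Some (orc n))"
| pair: "recursive_in orc f \<Longrightarrow> recursive_in orc g \<Longrightarrow>
    recursive_in orc
      (\<lambda>n. Option.bind (f n) (\<lambda>x. Option.bind (g n) (\<lambda>y. Some (prod_encode (x, y)))))"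
| comp: "recursive_in orc f \<Longrightarrow> recursive_in orc g \<Longrightarrow>
    recursive_in orc (\<lambda>n. Option.bind (g n) f)"
| prec: "recursive_in orc f \<Longrightarrow> recursive_in orc g \<Longrightarrow>
    recursive_in orc (\<lambda>n. prim_rec f g (fst (prod_decode n)) (snd (prod_decode n)))"
| mu: "recursive_in orc f \<Longrightarrow>
    recursive_in orc (\<lambda>n. mu_search (\<lambda>m. f (prod_encode (n, m))))"

abbreviation partial_recursive :: "(nat \<rightharpoonup> nat) \<Rightarrow> bool" where
  "partial_recursive \<equiv> recursive_in (\<lambda>_. 0)"

lemma partial_recursive_if_oracle_recursive:
  assumes "recursive_in orc f" and "partial_recursive (\<lambda>n. Some (orc n))"
  shows "partial_recursive f"
  using assms(1) by induction (use assms(2) in \<open>auto intro: recursive_in.intros\<close>)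

text \<open>
  Group elements are handled as words over the generators \<open>gs\<close> and their inverses: the letter
  \<open>2 * i\<close> denotes \<open>gs ! i\<close> and the letter \<open>2 * i + 1\<close> its inverse.
\<close>

definition group_words :: "'g list \<Rightarrow> nat list set" where
  "group_words gs = {u. set u \<subseteq> {..<2 * length gs}}"

definition group_letter :: "('g, 'b) monoid_scheme \<Rightarrow> 'g list \<Rightarrow> nat \<Rightarrow> 'g" where
  "group_letter G gs x = (if even x then gs ! (x div 2) else inv\<^bsub>G\<^esub> (gs ! (x div 2)))"

definition group_eval :: "('g, 'b) monoid_scheme \<Rightarrow> 'g list \<Rightarrow> nat list \<Rightarrow> 'g" where
  "group_eval G gs u = foldr (\<lambda>x \<beta>. group_letter G gs x \<otimes>\<^bsub>G\<^esub> \<beta>) u \<one>\<^bsub>G\<^esub>"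

text \<open>
  Products and inverses of words are computable outright, whereas equality of the represented
  elements is the word problem of \<open>G\<close>, about which nothing is assumed; hence it serves as an oracle.
  For a decidable word problem, \<open>partial_recursive_if_oracle_recursive\<close> eliminates the oracle.
\<close>

definition word_problem :: "('g, 'b) monoid_scheme \<Rightarrow> 'g list \<Rightarrow> nat \<Rightarrow> nat" where
  "word_problem G gs n =
     (if list_decode n \<in> group_words gs \<and> group_eval G gs (list_decode n) = \<one>\<^bsub>G\<^esub> then 1 else 0)"

text \<open>
  \<open>automaton_code G al gs n W\<close>: after numbering its states by \<open>\<nu>\<close>, the automaton \<open>W\<close> is given by
  the four lists coded by \<open>n\<close>. The list \<open>al\<close> enumerates the alphabet; a letter is coded by its
  position, a weight by a word representing it.
\<close>

definition automaton_code ::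
    "('g, 'b) monoid_scheme \<Rightarrow> 'a list \<Rightarrow> 'g list \<Rightarrow> nat \<Rightarrow> ('q, 'a, 'g) automaton \<Rightarrow> bool" where
  "automaton_code G al gs n W \<longleftrightarrow>
     (\<exists>\<nu> Qs Is Fs Ts.
        n = prod_encode (list_encode Qs,
              prod_encode (list_encode (map (\<lambda>(p, x). prod_encode (p, list_encode x)) Is),
              prod_encode (list_encode (map (\<lambda>(p, x). prod_encode (p, list_encode x)) Fs),
                list_encode (map (\<lambda>(p, a, x, q).
                  prod_encode (p, prod_encode (a, prod_encode (list_encode x, q)))) Ts)))) \<and>
        (\<forall>(p, x)\<in>set Is. x \<in> group_words gs) \<and>
        (\<forall>(p, x)\<in>set Fs. x \<in> group_words gs) \<and>
        (\<forall>(p, a, x, q)\<in>set Ts. a < length al \<and> x \<in> group_words gs) \<and>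
        inj_on \<nu> (states W) \<and>
        set Qs = \<nu> ` states W \<and>
        (\<lambda>(p, x). (p, group_eval G gs x)) ` set Is = (\<lambda>(p, \<alpha>). (\<nu> p, \<alpha>)) ` t_init W \<and>
        (\<lambda>(p, x). (p, group_eval G gs x)) ` set Fs = (\<lambda>(p, \<alpha>). (\<nu> p, \<alpha>)) ` t_final W \<and>
        (\<lambda>(p, a, x, q). (p, al ! a, group_eval G gs x, q)) ` set Ts =
          (\<lambda>(p, a, \<alpha>, q). (\<nu> p, a, \<alpha>, \<nu> q)) ` transitions W)"

end

theory Submission
  imports Defs
begin

text \<open>
  Recording the accumulated output in the state, the group acts on runs from the left. Two loops
  reading the same word preserve the delay iff they multiply the outputs by the same left factor.

  If branching twinning fails, iterating the loops of a counterexample sufficiently often moves its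
  outputs arbitrarily far apart, because the group is infinitary, while the words stay close; so
  the Lipschitz property fails. Conversely, the Lipschitz property for \<open>k\<close> sequential automata
  is the pigeonhole principle.

  For the construction, branching twinning bounds by \<open>k\<close> the number of runs that are pairwise
  separated by loops. A pumping argument then covers the configurations reached on any word by \<open>k\<close>
  balls of bounded radius, and if their diameter is large nevertheless, they fall into two parts
  between which the bound \<open>k\<close> can be divided. Hence a subset construction with delays, which distributes
  \<open>k\<close> heads over the parts at each split, needs only finitely many sets of configurations up to translation. The
  correctness of such a finite system is a local condition, decidable with the word problem. The
  algorithm therefore just searches for one; branching twinning is needed only for termination.
\<close>

section \<open>Computable functions\<close>

text \<open>The main obstacle is that bounds on diameters must not deteriorate as words grow:
  estimating each set of configurations from its predecessor would add \<open>2 * max_weight\<close>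
  per letter. A block therefore remembers a set \<open>S\<close> of bounded diameter from which some
  word \<open>w\<close> leads to it, and one bound must serve all \<open>w\<close>. It comes from
  cutting loops: for a family of \<open>m\<close> runs on one word, either every loop can be cut,
  and a word of length at most \<open>card (states W) ^ m\<close> remains, or some loop acts
  differently on two runs and the family splits. The Cayley metric is left-invariant with finite
  balls, which turns bounded diameter into finitely many sets up to translation. The order
  \<open>k\<close> of branching twinning occurs twice, as number of levels and (plus one) as number
  of runs. The two fit because a binary tree of splits with \<open>k + 1\<close> leaves has depth at
  most \<open>k\<close>. In the converse direction all runs of a tower iterate the loops of one
  level equally often; only so do words that agree up to that level keep a long common prefix while
  the outputs separate.\<close>

class coded =
  fixes code :: "'a \<Rightarrow> nat"
  assumes inj_code: "inj code"
    and zero_code: "\<exists>x. code x = 0"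

instantiation nat :: coded
begin
definition "code (n :: nat) = n"
instance by standard (auto simp: code_nat_def inj_on_def)
end

instantiation bool :: coded
begin
definition "code (b :: bool) = (of_bool b :: nat)"
instance by standard (auto simp: code_bool_def inj_on_def)
end

instantiation prod :: (coded, coded) coded
begin
definition "code z = prod_encode (code (fst z), code (snd z))"
instance
proof
  show "inj (code :: 'a \<times> 'b \<Rightarrow> nat)"
    by (auto simp: code_prod_def inj_on_def prod_encode_eq dest: injD[OF inj_code])
  obtain x :: 'a and y :: 'b where "code x = 0" "code y = 0"
    using zero_code by metis
  then have "code (x, y) = 0"
    by (simp add: code_prod_def prod_encode_def triangle_def)
  then show "\<exists>z :: 'a \<times> 'b. code z = 0" ..
qed
end

instantiation list :: (coded) coded
begin
definition "code xs = list_encode (map code xs)"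
instance
proof
  show "inj (code :: 'a list \<Rightarrow> nat)"
    by (auto simp: code_list_def inj_on_def list_encode_eq inj_map_eq_map[OF inj_code])
  show "\<exists>xs :: 'a list. code xs = 0"
    by (rule exI[of _ "[]"]) (simp add: code_list_def)
qed
end

lemma code_eq_iff [simp]: "code x = code y \<longleftrightarrow> x = y"
  using inj_code by (auto dest: injD)

lemma code_Pair: "code (x, y) = prod_encode (code x, code y)"
  by (simp add: code_prod_def)

lemma code_Nil: "code [] = 0"
  and code_Cons: "code (x # xs) = Suc (prod_encode (code x, code xs))"
  by (simp_all add: code_list_def)

text \<open>Only the behaviour of \<open>g\<close> on codes is prescribed; on other numbers it may
  be undefined. Functions of several variables take one tuple, an environment \<open>e\<close>, as
  argument.\<close>

definition computable :: "(nat \<Rightarrow> nat) \<Rightarrow> ('a :: coded \<Rightarrow> 'b :: coded) \<Rightarrow> bool" where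
  "computable orc f \<longleftrightarrow> (\<exists>g. recursive_in orc g \<and> (\<forall>x. g (code x) = Some (code (f x))))"

lemma computableI:
  assumes "recursive_in orc g" and "\<And>x. g (code x) = Some (code (f x))"
  shows "computable orc f"
  using assms unfolding computable_def by blast

lemma computable_comp:
  assumes "computable orc f" and "computable orc g"
  shows "computable orc (\<lambda>x. f (g x))"
proof -
  obtain f' g' where "recursive_in orc f'" "\<And>x. f' (code x) = Some (code (f x))"
    and "recursive_in orc g'" "\<And>x. g' (code x) = Some (code (g x))"
    using assms unfolding computable_def by blast
  then show ?thesis
    by (intro computableI[of _ "\<lambda>n. Option.bind (g' n) f'"] recursive_in.comp) auto
qed

lemma recursive_const: "recursive_in orc (\<lambda>_. Some c)"
proof (induction c)
  case (Suc c)
  from recursive_in.comp[OF recursive_in.succ this] show ?case by simp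
qed (rule recursive_in.zero)

lemma recursive_id: "recursive_in orc Some"
proof -
  have "recursive_in orc (\<lambda>n. Option.bind (Some (fst (prod_decode n)))
      (\<lambda>x. Option.bind (Some (snd (prod_decode n))) (\<lambda>y. Some (prod_encode (x, y)))))"
    by (intro recursive_in.intros)
  then show ?thesis by simp
qed

lemma computable_const: "computable orc (\<lambda>_. c)"
  by (rule computableI[OF recursive_const[of _ "code c"]]) simp

lemma computable_id: "computable orc (\<lambda>e. e)"
  by (rule computableI[OF recursive_id]) simp

lemma computable_fst: "computable orc f \<Longrightarrow> computable orc (\<lambda>e. fst (f e))"
  by (rule computable_comp[OF computableI[OF recursive_in.left]]) (simp add: code_prod_def)

lemma computable_snd: "computable orc f \<Longrightarrow> computable orc (\<lambda>e. snd (f e))"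
  by (rule computable_comp[OF computableI[OF recursive_in.right]]) (simp add: code_prod_def)

lemma computable_Pair:
  assumes "computable orc f" and "computable orc g"
  shows "computable orc (\<lambda>e. (f e, g e))"
proof -
  obtain f' g' where "recursive_in orc f'" "\<And>x. f' (code x) = Some (code (f x))"
    and "recursive_in orc g'" "\<And>x. g' (code x) = Some (code (g x))"
    using assms unfolding computable_def by blast
  then show ?thesis
    by (intro computableI[OF recursive_in.pair[of _ f' g']]) (auto simp: code_Pair)
qed

lemma computable_Suc: "computable orc f \<Longrightarrow> computable orc (\<lambda>e. Suc (f e))"
  by (rule computable_comp[OF computableI[OF recursive_in.succ]]) (simp add: code_nat_def)

text \<open>Numbers are their own codes, so the same \<open>g\<close> computes \<open>f\<close> and
  its code; only the type changes.\<close>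

lemma computable_code: "computable orc f \<Longrightarrow> computable orc (\<lambda>e. code (f e))"
  unfolding computable_def by (simp add: code_nat_def)

text \<open>The scheme \<open>prec\<close> carries the environment as its fixed parameter, so base
  value and step may both depend on it.\<close>

lemma computable_rec_nat:
  assumes "computable orc n" and "computable orc a"
    and "computable orc (\<lambda>p. s (fst p) (fst (snd p)) (snd (snd p)))"
  shows "computable orc (\<lambda>e. rec_nat (a e) (s e) (n e))"
proof -
  obtain a' s' where a': "recursive_in orc a'" "\<And>x. a' (code x) = Some (code (a x))"
    and s': "recursive_in orc s'"
      "\<And>p. s' (code p) = Some (code (s (fst p) (fst (snd p)) (snd (snd p))))"
    using assms unfolding computable_def by blast
  have "prim_rec a' s' (code e) m = Some (code (rec_nat (a e) (s e) m))" for e m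
  proof (induction m)
    case (Suc m)
    then show ?case
      using s'(2)[of "(e, m, rec_nat (a e) (s e) m)"] by (simp add: code_Pair code_nat_def)
  qed (simp add: a')
  then have "computable orc (\<lambda>p. rec_nat (a (fst p)) (s (fst p)) (snd p))"
    using a' s'
    by (intro computableI[OF recursive_in.prec[of _ a' s']]) (auto simp: code_prod_def code_nat_def)
  from computable_comp[OF this computable_Pair[OF computable_id assms(1)]] show ?thesis by simp
qed

text \<open>A truth value is coded by 0 or 1, so a case distinction is a recursion of at most one
  step.\<close>

lemma computable_if:
  assumes "computable orc b" and "computable orc f" and "computable orc g"
  shows "computable orc (\<lambda>e. if b e then f e else g e)"
proof -
  have "computable orc (\<lambda>e. code (b e))"
    by (rule computable_code[OF assms(1)])
  then have "computable orc (\<lambda>e. rec_nat (g e) (\<lambda>_ _. f e) (code (b e)))"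
    by (rule computable_rec_nat)
       (intro assms computable_fst computable_id computable_comp[OF assms(2)])+
  moreover have "rec_nat (g e) (\<lambda>_ _. f e) (code (b e)) = (if b e then f e else g e)" for e
    by (simp add: code_bool_def)
  ultimately show ?thesis by simp
qed

section \<open>Connectives, arithmetic and comparison\<close>

lemma computable_not:
  assumes "computable orc f"
  shows "computable orc (\<lambda>e. \<not> f e)"
proof -
  have "computable orc (\<lambda>e. if f e then False else True)"
    by (intro computable_if assms computable_const)
  moreover have "(\<lambda>e. if f e then False else True) = (\<lambda>e. \<not> f e)" by auto
  ultimately show ?thesis by simp
qed

lemma computable_conj:
  assumes "computable orc f" and "computable orc g"
  shows "computable orc (\<lambda>e. f e \<and> g e)"
proof -
  have "computable orc (\<lambda>e. if f e then g e else False)"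
    by (intro computable_if assms computable_const)
  moreover have "(\<lambda>e. if f e then g e else False) = (\<lambda>e. f e \<and> g e)" by auto
  ultimately show ?thesis by simp
qed

lemma computable_disj:
  assumes "computable orc f" and "computable orc g"
  shows "computable orc (\<lambda>e. f e \<or> g e)"
proof -
  have "computable orc (\<lambda>e. if f e then True else g e)"
    by (intro computable_if assms computable_const)
  moreover have "(\<lambda>e. if f e then True else g e) = (\<lambda>e. f e \<or> g e)" by auto
  ultimately show ?thesis by simp
qed

lemma computable_imp:
  "computable orc f \<Longrightarrow> computable orc g \<Longrightarrow> computable orc (\<lambda>e. f e \<longrightarrow> g e)"
  unfolding imp_conv_disj by (intro computable_disj computable_not)

lemma computable_pred: 
  assumes "computable orc n"
  shows "computable orc (\<lambda>e. n e - Suc 0)"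
proof -
  have "computable orc (\<lambda>e. rec_nat 0 (\<lambda>m _. m) (n e))"
    by (intro computable_rec_nat assms computable_const computable_fst computable_snd computable_id)
  moreover have "rec_nat 0 (\<lambda>m _. m) x = x - Suc 0" for x :: nat
    by (cases x) auto
  ultimately show ?thesis by simp
qed

lemma computable_minus:
  fixes m n :: "'a :: coded \<Rightarrow> nat"
  assumes "computable orc m" and "computable orc n"
  shows "computable orc (\<lambda>e. m e - n e)"
proof -
  have "computable orc (\<lambda>e. rec_nat (m e) (\<lambda>_ r. r - Suc 0) (n e))"
    by (intro computable_rec_nat assms computable_pred computable_snd computable_id)
  moreover have "rec_nat x (\<lambda>_ r. r - Suc 0) y = x - y" for x y :: nat
    by (induction y) auto
  ultimately show ?thesis by simp
qed

lemma computable_plus: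
  fixes m n :: "'a :: coded \<Rightarrow> nat"
  assumes "computable orc m" and "computable orc n"
  shows "computable orc (\<lambda>e. m e + n e)"
proof -
  have "computable orc (\<lambda>e. rec_nat (m e) (\<lambda>_ r. Suc r) (n e))"
    by (intro computable_rec_nat assms computable_Suc computable_snd computable_id)
  moreover have "rec_nat x (\<lambda>_ r. Suc r) y = x + y" for x y :: nat
    by (induction y) auto
  ultimately show ?thesis by simp
qed

lemma computable_is_zero:
  fixes n :: "'a :: coded \<Rightarrow> nat"
  assumes "computable orc n"
  shows "computable orc (\<lambda>e. n e = 0)"
proof -
  have "computable orc (\<lambda>e. rec_nat True (\<lambda>_ _. False) (n e))"
    by (intro computable_rec_nat assms computable_const)
  moreover have "rec_nat True (\<lambda>_ _. False) x \<longleftrightarrow> x = 0" for x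
    by (cases x) auto
  ultimately show ?thesis by simp
qed

lemma computable_even:
  fixes n :: "'a :: coded \<Rightarrow> nat"
  assumes "computable orc n"
  shows "computable orc (\<lambda>e. even (n e))"
proof -
  have "computable orc (\<lambda>e. rec_nat True (\<lambda>_ b. \<not> b) (n e))"
    by (intro computable_rec_nat assms computable_const computable_not computable_snd computable_id)
  moreover have "rec_nat True (\<lambda>_ b. \<not> b) x \<longleftrightarrow> even x" for x
    by (induction x) auto
  ultimately show ?thesis by simp
qed

lemma computable_le:
  fixes m n :: "'a :: coded \<Rightarrow> nat"
  assumes "computable orc m" and "computable orc n"
  shows "computable orc (\<lambda>e. m e \<le> n e)"
  using computable_is_zero[OF computable_minus[OF assms]] by simp

lemma computable_less:
  fixes m n :: "'a :: coded \<Rightarrow> nat"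
  assumes "computable orc m" and "computable orc n"
  shows "computable orc (\<lambda>e. m e < n e)"
  using computable_le[OF computable_Suc[OF assms(1)] assms(2)] by (simp add: Suc_le_eq)

lemma computable_eq:
  assumes "computable orc f" and "computable orc g"
  shows "computable orc (\<lambda>e. f e = g e)"
proof -
  have "computable orc (\<lambda>e. code (f e) \<le> code (g e) \<and> code (g e) \<le> code (f e))"
    by (intro computable_conj computable_le computable_code assms)
  moreover have "code (f e) \<le> code (g e) \<and> code (g e) \<le> code (f e) \<longleftrightarrow> f e = g e" for e
    using code_eq_iff[of "f e" "g e"] by linarith
  ultimately show ?thesis by simp
qed

section \<open>Computable operations on lists\<close>

definition hd0 :: "'a :: coded list \<Rightarrow> 'a" where
  "hd0 xs = (case xs of [] \<Rightarrow> SOME x. code x = 0 | x # _ \<Rightarrow> x)"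

lemma hd0_simps: "code (hd0 ([] :: 'a :: coded list)) = 0" "hd0 (x # xs) = x"
  unfolding hd0_def using someI_ex[OF zero_code[where 'a = 'a]] by simp_all

lemma computable_pred': "computable orc (\<lambda>n. n - Suc 0)"
  by (intro computable_pred computable_id)

text \<open>The code of a nonempty list is the successor of a pair, so predecessor and projection
  find its parts. On the code 0 of the empty list they return 0; hence the default of
  \<open>hd0\<close> must have code 0, and the class \<open>coded\<close> asks for such an
  element.\<close>

lemma computable_list_parts:
  shows "computable orc (hd0 :: 'a :: coded list \<Rightarrow> 'a)"
    and "computable orc (tl :: 'a :: coded list \<Rightarrow> 'a list)"
proof -
  obtain p where p: "recursive_in orc p" "\<And>n :: nat. p n = Some (n - Suc 0)"
    using computable_pred'[of orc] unfolding computable_def by (auto simp: code_nat_def)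
  have zero: "prod_decode 0 = (0, 0)"
    using prod_encode_inverse[of "(0, 0)"] by (simp add: prod_encode_def)
  have "recursive_in orc (\<lambda>n. Option.bind (p n) (\<lambda>n. Some (fst (prod_decode n))))"
    using p(1) by (rule recursive_in.comp[OF recursive_in.left])
  then show "computable orc (hd0 :: 'a list \<Rightarrow> 'a)"
  proof (rule computableI)
    fix xs :: "'a list"
    show "Option.bind (p (code xs)) (\<lambda>n. Some (fst (prod_decode n))) = Some (code (hd0 xs))"
      by (cases xs) (auto simp: p hd0_simps code_Nil code_Cons zero)
  qed
  have "recursive_in orc (\<lambda>n. Option.bind (p n) (\<lambda>n. Some (snd (prod_decode n))))"
    using p(1) by (rule recursive_in.comp[OF recursive_in.right])
  then show "computable orc (tl :: 'a list \<Rightarrow> 'a list)"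
  proof (rule computableI)
    fix xs :: "'a list"
    show "Option.bind (p (code xs)) (\<lambda>n. Some (snd (prod_decode n))) = Some (code (tl xs))"
      by (cases xs) (auto simp: p code_Nil code_Cons zero)
  qed
qed

lemma computable_Cons:
  assumes "computable orc f" and "computable orc g"
  shows "computable orc (\<lambda>e. f e # g e)"
proof -
  have "computable orc (\<lambda>e. Suc (code (f e, g e)))"
    by (intro computable_Suc computable_code computable_Pair assms)
  then show ?thesis
    unfolding computable_def by (simp add: code_nat_def code_Cons code_Pair)
qed

lemma computable_case_list:
  assumes "computable orc xs" and "computable orc f"
    and "computable orc (\<lambda>p. g (fst p) (fst (snd p)) (snd (snd p)))"
  shows "computable orc (\<lambda>e. case xs e of [] \<Rightarrow> f e | y # ys \<Rightarrow> g e y ys)"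
proof -
  have g: "computable orc (\<lambda>e. g e (hd0 (xs e)) (tl (xs e)))"
    using computable_comp[OF assms(3) computable_Pair[OF computable_id
          computable_Pair[OF computable_comp[OF computable_list_parts(1) assms(1)]
            computable_comp[OF computable_list_parts(2) assms(1)]]]]
    by simp
  have "computable orc (\<lambda>e. if xs e = [] then f e else g e (hd0 (xs e)) (tl (xs e)))"
    by (intro computable_if computable_eq computable_const assms g)
  moreover have "(if xs e = [] then f e else g e (hd0 (xs e)) (tl (xs e))) =
      (case xs e of [] \<Rightarrow> f e | y # ys \<Rightarrow> g e y ys)" for e
    by (cases "xs e") (auto simp: hd0_simps)
  ultimately show ?thesis by simp
qed

text \<open>Supplies the number of rounds in \<open>computable_fold\<close>: a computable bound on
  the length.\<close>

lemma length_le_code: "length xs \<le> code xs"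
proof (induction xs)
  case (Cons x xs)
  then show ?case
    using le_prod_encode_2[of "code xs" "code x"] by (simp add: code_Cons)
qed (simp add: code_Nil)

text \<open>Recursion on lists is simulated by recursion on numbers: a step consuming one element is
  iterated \<open>code (xs e)\<close> times. It is the identity once the list is exhausted, so the
  surplus rounds are harmless.\<close>

lemma computable_fold:
  assumes "computable orc xs" and "computable orc a"
    and g: "computable orc (\<lambda>p. g (fst p) (fst (snd p)) (snd (snd p)))"
  shows "computable orc (\<lambda>e. fold (g e) (xs e) (a e))"
proof -
  define step where "step e p =
    (case fst p of [] \<Rightarrow> p | y # ys \<Rightarrow> (ys, g e y (snd p)))" for e p
  have step_Cons: "step e (y # ys, b) = (ys, g e y b)" for e y ys b
    by (simp add: step_def)
  have g': "computable orc (\<lambda>p. g (fst (fst p)) (fst (snd p)) (snd (snd (fst p))))"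
    using computable_comp[OF g, of "\<lambda>p. (fst (fst p), fst (snd p), snd (snd (fst p)))"]
    by (simp add: computable_fst computable_snd computable_id computable_Pair)
  have "computable orc (\<lambda>p. step (fst p) (snd p))"
    unfolding step_def
    by (intro computable_case_list g' computable_Pair computable_fst computable_snd computable_id)
  from computable_comp[OF this, of "\<lambda>p. (fst p, snd (snd p))"]
  have step: "computable orc (\<lambda>p. step (fst p) (snd (snd p)))"
    by (simp add: computable_fst computable_snd computable_id computable_Pair)
  have "computable orc (\<lambda>e. rec_nat (xs e, a e) (\<lambda>_ r. step e r) (code (xs e)))"
    by (intro computable_rec_nat step computable_code computable_Pair assms)
  then have comp: "computable orc (\<lambda>e. snd (rec_nat (xs e, a e) (\<lambda>_ r. step e r) (code (xs e))))"
    by (rule computable_snd)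
  \<comment> \<open>\<open>rec_nat\<close> unfolds at its last round, whereas induction on the list
    needs the first one.\<close>
  have shift: "rec_nat p (\<lambda>_. step e) (Suc n) = rec_nat (step e p) (\<lambda>_. step e) n" for e n p
    by (induction n) auto
  have "length ys \<le> n \<Longrightarrow> rec_nat (ys, b) (\<lambda>_ r. step e r) n = ([], fold (g e) ys b)" for e n ys b
  proof (induction ys arbitrary: n b)
    case Nil
    show ?case by (induction n) (auto simp: step_def)
  next
    case (Cons y ys)
    then obtain n' where n: "n = Suc n'" by (cases n) auto
    show ?case
      unfolding n shift using Cons n by (simp add: step_Cons)
  qed
  with comp show ?thesis by (simp add: length_le_code)
qed

lemma computable_rev:
  assumes "computable orc xs"
  shows "computable orc (\<lambda>e. rev (xs e))"
proof -
  have "computable orc (\<lambda>e. fold (\<lambda>x acc. x # acc) (xs e) [])"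
    by (intro computable_fold computable_Cons computable_const assms computable_fst computable_snd
        computable_id)
  then show ?thesis by (simp add: fold_Cons_rev)
qed

lemma computable_append:
  assumes "computable orc xs" and "computable orc ys"
  shows "computable orc (\<lambda>e. xs e @ ys e)"
proof -
  have "computable orc (\<lambda>e. fold (\<lambda>x acc. x # acc) (rev (xs e)) (ys e))"
    by (intro computable_fold computable_rev computable_Cons computable_const assms computable_fst
        computable_snd computable_id)
  then show ?thesis by (simp add: fold_Cons_rev)
qed

lemma computable_concat_map:
  assumes "computable orc xs" and g: "computable orc (\<lambda>p. g (fst p) (snd p))"
  shows "computable orc (\<lambda>e. concat (map (g e) (xs e)))"
proof -
  have g': "computable orc (\<lambda>p. g (fst p) (fst (snd p)))"
    using computable_comp[OF g, of "\<lambda>p. (fst p, fst (snd p))"]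
    by (simp add: computable_fst computable_snd computable_id computable_Pair)
  have "computable orc (\<lambda>e. fold (\<lambda>x acc. acc @ g e x) (xs e) [])"
    by (intro computable_fold computable_append g' computable_const assms computable_snd
        computable_id)
  moreover have "fold (\<lambda>x acc. acc @ h x) ys b = b @ concat (map h ys)" for h :: "'b \<Rightarrow> 'c list" and ys b
    by (induction ys arbitrary: b) auto
  ultimately show ?thesis by simp
qed

lemma computable_map:
  assumes "computable orc xs" and g: "computable orc (\<lambda>p. g (fst p) (snd p))"
  shows "computable orc (\<lambda>e. map (g e) (xs e))"
proof -
  have "computable orc (\<lambda>e. concat (map (\<lambda>x. [g e x]) (xs e)))"
    by (intro computable_concat_map assms computable_Cons computable_const)
  then show ?thesis by simp
qed

lemma computable_Ball:
  assumes "computable orc xs" and P: "computable orc (\<lambda>p. P (fst p) (snd p))"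
  shows "computable orc (\<lambda>e. \<forall>x\<in>set (xs e). P e x)"
proof -
  have P': "computable orc (\<lambda>p. P (fst p) (fst (snd p)))"
    using computable_comp[OF P, of "\<lambda>p. (fst p, fst (snd p))"]
    by (simp add: computable_fst computable_snd computable_id computable_Pair)
  have "computable orc (\<lambda>e. fold (\<lambda>x acc. acc \<and> P e x) (xs e) True)"
    by (intro computable_fold computable_conj P' computable_const assms computable_snd computable_id)
  moreover have "fold (\<lambda>x acc. acc \<and> Q x) ys b \<longleftrightarrow> b \<and> (\<forall>x\<in>set ys. Q x)" for Q :: "'b \<Rightarrow> bool" and ys b
    by (induction ys arbitrary: b) auto
  ultimately show ?thesis by simp
qed

lemma computable_Bex:
  assumes "computable orc xs" and "computable orc (\<lambda>p. P (fst p) (snd p))"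
  shows "computable orc (\<lambda>e. \<exists>x\<in>set (xs e). P e x)"
proof -
  have "computable orc (\<lambda>e. \<not> (\<forall>x\<in>set (xs e). \<not> P e x))"
    by (intro computable_not computable_Ball assms)
  then show ?thesis by simp
qed

lemma computable_upt:
  assumes "computable orc n"
  shows "computable orc (\<lambda>e. [0..<n e])"
proof -
  have "computable orc (\<lambda>e. rec_nat [] (\<lambda>m r. r @ [m]) (n e))"
    by (intro computable_rec_nat assms computable_const computable_append computable_Cons
        computable_fst computable_snd computable_id)
  moreover have "rec_nat [] (\<lambda>m r. r @ [m]) x = [0..<x]" for x
    by (induction x) auto
  ultimately show ?thesis by simp
qed

lemmas computable_intros =
  computable_const computable_id computable_fst computable_snd computable_Pair computable_Suc
  computable_if computable_not computable_conj computable_disj computable_imp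
  computable_plus computable_minus computable_even computable_le computable_less computable_eq
  computable_Cons computable_append computable_rev computable_concat_map computable_map
  computable_Ball computable_Bex computable_upt computable_code

text \<open>Minimisation tries all numbers. Surjectivity of \<open>code\<close> makes every number a
  candidate, and since \<open>P\<close> is decided by a total function, no candidate blocks the
  search. The same \<open>f\<close> serves all inputs \<open>x\<close>.\<close>

lemma recursive_search:
  fixes P :: "'a :: coded \<Rightarrow> 'b :: coded \<Rightarrow> bool" and out :: "'a \<Rightarrow> 'b \<Rightarrow> 'c :: coded"
  assumes surj: "surj (code :: 'b \<Rightarrow> nat)"
    and P: "computable orc (\<lambda>p. P (fst p) (snd p))"
    and out: "computable orc (\<lambda>p. out (fst p) (snd p))"
  shows "\<exists>f. recursive_in orc f \<and>
    (\<forall>x. (\<exists>c. P x c) \<longrightarrow> (\<exists>c. P x c \<and> f (code x) = Some (code (out x c))))"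
proof -
  \<comment> \<open>\<open>mu\<close> stops at the first 0, so success becomes 0 here, opposite to
    the coding of \<open>bool\<close>.\<close>
  have "computable orc (\<lambda>p. if P (fst p) (snd p) then 0 else Suc 0)"
    by (intro computable_if P computable_const)
  then obtain g where g: "recursive_in orc g"
    "\<And>x c. g (prod_encode (code x, code c)) = Some (if P x c then 0 else Suc 0)"
    unfolding computable_def by (auto simp: code_Pair code_nat_def)
  obtain h where h: "recursive_in orc h"
    "\<And>x c. h (prod_encode (code x, code c)) = Some (code (out x c))"
    using out unfolding computable_def by (auto simp: code_Pair)
  define s where "s n = mu_search (\<lambda>m. g (prod_encode (n, m)))" for n
  have s: "recursive_in orc s"
    unfolding s_def by (rule recursive_in.mu[OF g(1)])
  define f where "f n = Option.bind (Option.bind (Some n) (\<lambda>x. Option.bind (s n)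
    (\<lambda>y. Some (prod_encode (x, y))))) h" for n
  have "recursive_in orc f"
    unfolding f_def by (intro recursive_in.comp[OF h(1)] recursive_in.pair recursive_id s)
  moreover have "\<exists>c. P x c \<and> f (code x) = Some (code (out x c))" if "P x c" for x c
  proof -
    define Q where "Q n \<longleftrightarrow> P x (inv_into UNIV code n)" for n
    have gQ: "g (prod_encode (code x, n)) = Some (if Q n then 0 else Suc 0)" for n
      using g(2)[of x "inv_into UNIV code n"] surj_f_inv_f[OF surj] by (simp add: Q_def)
    have "Q (code c)"
      using that by (simp add: Q_def inv_f_f[OF inj_code])
    then have n: "Q (LEAST n. Q n)" "\<forall>m < (LEAST n. Q n). \<not> Q m"
      by (rule LeastI) (use not_less_Least in blast)
    have uniq: "n = (LEAST n. Q n)" if "Q n" "\<forall>m<n. \<not> Q m" for n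
      using n that by (meson linorder_neqE_nat)
    have pred: "g (prod_encode (code x, n)) = Some 0 \<and>
        (\<forall>m<n. \<exists>y. g (prod_encode (code x, m)) = Some (Suc y)) \<longleftrightarrow> Q n \<and> (\<forall>m<n. \<not> Q m)" for n
      by (auto simp: gQ split: if_splits)
    have "(THE n. Q n \<and> (\<forall>m<n. \<not> Q m)) = (LEAST n. Q n)"
      by (rule the_equality) (use n uniq in blast)+
    moreover have "\<exists>n. Q n \<and> (\<forall>m<n. \<not> Q m)" using n by blast
    ultimately have "s (code x) = Some (LEAST n. Q n)"
      unfolding s_def mu_search_def pred by simp
    moreover have "(LEAST n. Q n) = code (inv_into UNIV code (LEAST n. Q n) :: 'b)"
      using surj_f_inv_f[OF surj] by simp
    ultimately have "f (code x) = Some (code (out x (inv_into UNIV code (LEAST n. Q n))))"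
      unfolding f_def using h(2) by (metis bind.bind_lunit)
    with n(1) show ?thesis unfolding Q_def by blast
  qed
  ultimately show ?thesis by blast
qed

lemma surj_code_nat: "surj (code :: nat \<Rightarrow> nat)"
  by (auto simp: code_nat_def surj_def)

lemma surj_code_prod:
  assumes "surj (code :: 'a :: coded \<Rightarrow> nat)" and "surj (code :: 'b :: coded \<Rightarrow> nat)"
  shows "surj (code :: 'a \<times> 'b \<Rightarrow> nat)"
  unfolding surj_def
proof
  fix n
  obtain a b where ab: "prod_decode n = (a, b)" by fastforce
  obtain x :: 'a where x: "code x = a" using surjD[OF assms(1), of a] by auto
  obtain y :: 'b where y: "code y = b" using surjD[OF assms(2), of b] by auto
  have "n = code (x, y)"
    unfolding code_Pair x y using ab prod_decode_inverse[of n] by simp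
  then show "\<exists>z :: 'a \<times> 'b. n = code z" ..
qed

lemma surj_code_list:
  assumes "surj (code :: 'a :: coded \<Rightarrow> nat)"
  shows "surj (code :: 'a list \<Rightarrow> nat)"
  unfolding surj_def
proof
  fix n
  have "map code (map (inv_into UNIV (code :: 'a \<Rightarrow> nat)) (list_decode n)) = list_decode n"
    by (simp add: o_def surj_f_inv_f[OF assms])
  then have "n = code (map (inv_into UNIV (code :: 'a \<Rightarrow> nat)) (list_decode n))"
    by (simp add: code_list_def o_def surj_f_inv_f[OF assms])
  then show "\<exists>xs :: 'a list. n = code xs" ..
qed

section \<open>Word metrics\<close>

locale generated_group = group G for G (structure) +
  fixes \<Gamma> :: "'a set"
  assumes fin_gens: "finite \<Gamma>" and gens_carrier: "\<Gamma> \<subseteq> carrier G"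
    and generate_gens: "generate G \<Gamma> = carrier G"
begin

abbreviation "cdist \<equiv> cayley_dist G \<Gamma>"

lemma inv_cancel [simp]:
  assumes "g \<in> carrier G" and "x \<in> carrier G"
  shows "inv g \<otimes> (g \<otimes> x) = x" and "g \<otimes> (inv g \<otimes> x) = x"
  using assms by (simp_all add: m_assoc[symmetric])

text \<open>Edges multiply by generators on the right, so left translations are automorphisms of the
  Cayley graph.\<close>

lemma cayley_path_left:
  assumes "(x, y) \<in> cayley_edges G \<Gamma> ^^ n" and "g \<in> carrier G"
  shows "(g \<otimes> x, g \<otimes> y) \<in> cayley_edges G \<Gamma> ^^ n"
  using assms(1)
proof (induction n arbitrary: y)
  case (Suc n)
  then obtain z where z: "(x, z) \<in> cayley_edges G \<Gamma> ^^ n" "(z, y) \<in> cayley_edges G \<Gamma>" by auto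
  from z(2) have "(g \<otimes> z, g \<otimes> y) \<in> cayley_edges G \<Gamma>"
    using assms(2) gens_carrier unfolding cayley_edges_def by (auto simp: m_assoc subset_eq)
  with Suc.IH[OF z(1)] show ?case by auto
qed simp

lemma cayley_path_sym:
  "(x, y) \<in> cayley_edges G \<Gamma> ^^ n \<Longrightarrow> (y, x) \<in> cayley_edges G \<Gamma> ^^ n"
proof (induction n arbitrary: y)
  case (Suc n)
  then obtain z where z: "(x, z) \<in> cayley_edges G \<Gamma> ^^ n" "(z, y) \<in> cayley_edges G \<Gamma>" by auto
  from z(2) have "(y, z) \<in> cayley_edges G \<Gamma>" unfolding cayley_edges_def by auto
  with Suc.IH[OF z(1)] show ?case by (meson relpow_Suc_I2)
qed simp

lemma cayley_path_from_one:
  assumes "g \<in> carrier G"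
  shows "\<exists>n. (\<one>, g) \<in> cayley_edges G \<Gamma> ^^ n"
proof -
  from assms have "g \<in> generate G \<Gamma>" by (simp add: generate_gens)
  then show ?thesis
  proof induction
    case one
    show ?case by (rule exI[of _ 0]) simp
  next
    case (incl h)
    with gens_carrier have "h \<in> carrier G" by blast
    with incl have "(\<one>, h) \<in> cayley_edges G \<Gamma>" unfolding cayley_edges_def by force
    then show ?case by (intro exI[of _ 1]) simp
  next
    case (inv h)
    with gens_carrier have "h \<in> carrier G" by blast
    with inv have "(\<one>, inv h) \<in> cayley_edges G \<Gamma>" unfolding cayley_edges_def by force
    then show ?case by (intro exI[of _ 1]) simp
  next
    case (eng h1 h2)
    then have c: "h1 \<in> carrier G" "h2 \<in> carrier G" by (simp_all add: generate_gens)
    from eng.IH obtain m n where mn: "(\<one>, h1) \<in> cayley_edges G \<Gamma> ^^ m"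
      "(\<one>, h2) \<in> cayley_edges G \<Gamma> ^^ n" by blast
    from cayley_path_left[OF mn(2) c(1)] c have "(h1, h1 \<otimes> h2) \<in> cayley_edges G \<Gamma> ^^ n" by simp
    with mn(1) show ?case by (metis relpow_add relcompI)
  qed
qed

text \<open>As \<open>\<Gamma>\<close> generates \<open>G\<close>, the graph is connected and the
  \<open>LEAST\<close> in \<open>cayley_dist\<close> is attained.\<close>

lemma cayley_path:
  assumes "x \<in> carrier G" and "y \<in> carrier G"
  shows "(x, y) \<in> cayley_edges G \<Gamma> ^^ cdist x y"
proof -
  obtain n where "(\<one>, inv x \<otimes> y) \<in> cayley_edges G \<Gamma> ^^ n"
    using cayley_path_from_one assms by (meson inv_closed m_closed)
  from cayley_path_left[OF this assms(1)] assms have "(x, y) \<in> cayley_edges G \<Gamma> ^^ n"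
    by (simp add: m_assoc[symmetric])
  then show ?thesis unfolding cayley_dist_def by (rule LeastI)
qed

lemma cdist_le: "(x, y) \<in> cayley_edges G \<Gamma> ^^ n \<Longrightarrow> cdist x y \<le> n"
  unfolding cayley_dist_def by (rule Least_le)

lemma cdist_refl [simp]: "cdist x x = 0"
  using cdist_le[of x x 0] by simp

lemma cdist_commute: "x \<in> carrier G \<Longrightarrow> y \<in> carrier G \<Longrightarrow> cdist x y = cdist y x"
  by (meson cayley_path cayley_path_sym cdist_le le_antisym)

lemma cdist_triangle:
  "x \<in> carrier G \<Longrightarrow> y \<in> carrier G \<Longrightarrow> z \<in> carrier G \<Longrightarrow> cdist x z \<le> cdist x y + cdist y z"
  using relcompI[OF cayley_path[of x y] cayley_path[of y z]] cdist_le[of x z]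
  by (simp add: relpow_add[symmetric])

lemma cdist_left [simp]:
  assumes "g \<in> carrier G" and "x \<in> carrier G" and "y \<in> carrier G"
  shows "cdist (g \<otimes> x) (g \<otimes> y) = cdist x y"
proof (rule le_antisym)
  show "cdist (g \<otimes> x) (g \<otimes> y) \<le> cdist x y"
    by (intro cdist_le cayley_path_left cayley_path assms)
  have "cdist (inv g \<otimes> (g \<otimes> x)) (inv g \<otimes> (g \<otimes> y)) \<le> cdist (g \<otimes> x) (g \<otimes> y)"
    by (intro cdist_le cayley_path_left cayley_path assms inv_closed m_closed)
  then show "cdist x y \<le> cdist (g \<otimes> x) (g \<otimes> y)"
    using assms by (simp add: m_assoc[symmetric])
qed

text \<open>Every vertex has at most two neighbours per generator.\<close>

lemma finite_cayley_sphere: "x \<in> carrier G \<Longrightarrow> finite {y. (x, y) \<in> cayley_edges G \<Gamma> ^^ n}"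
proof (induction n)
  case (Suc n)
  have "finite (cayley_edges G \<Gamma> `` {y})" for y
  proof (rule finite_subset)
    show "cayley_edges G \<Gamma> `` {y} \<subseteq> (\<lambda>g. y \<otimes> g) ` \<Gamma> \<union> (\<lambda>g. y \<otimes> inv g) ` \<Gamma>"
      using gens_carrier unfolding cayley_edges_def by (force simp: m_assoc)
  qed (simp add: fin_gens)
  moreover have "{y. (x, y) \<in> cayley_edges G \<Gamma> ^^ Suc n} =
      (\<Union>y\<in>{y. (x, y) \<in> cayley_edges G \<Gamma> ^^ n}. cayley_edges G \<Gamma> `` {y})"
    by auto
  ultimately show ?case using Suc by simp
qed simp

lemma finite_cball:
  assumes "x \<in> carrier G"
  shows "finite {y \<in> carrier G. cdist x y \<le> n}"
proof (rule finite_subset)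
  show "{y \<in> carrier G. cdist x y \<le> n} \<subseteq> (\<Union>m\<le>n. {y. (x, y) \<in> cayley_edges G \<Gamma> ^^ m})"
    using cayley_path[OF assms] by auto
qed (use finite_cayley_sphere[OF assms] in simp)

end

section \<open>Configurations\<close>

locale group_automaton = generated_group G \<Gamma> for G :: "('g, 'b) monoid_scheme" (structure) and \<Gamma> +
  fixes A :: "'a set" and W :: "('q, 'a, 'g) automaton"
  assumes wa: "weighted_automaton A G W"
begin

abbreviation "confs \<equiv> states W \<times> carrier G"

definition act :: "'g \<Rightarrow> 'q \<times> 'g \<Rightarrow> 'q \<times> 'g" where
  "act g c = (fst c, g \<otimes> snd c)"

text \<open>
  A configuration \<open>(q, \<eta>)\<close> records the output accumulated so far, so that \<open>G\<close> acts on
  configurations and runs from the left.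
\<close>

fun crun :: "'a list \<Rightarrow> 'q \<times> 'g \<Rightarrow> 'q \<times> 'g \<Rightarrow> bool" where
  "crun [] c c' \<longleftrightarrow> c \<in> confs \<and> c = c'"
| "crun (a # w) c c' \<longleftrightarrow> c \<in> confs \<and>
     (\<exists>\<alpha> q. (fst c, a, \<alpha>, q) \<in> transitions W \<and> crun w (q, snd c \<otimes> \<alpha>) c')"

lemma finite_states: "finite (states W)"
  and finite_transitions: "finite (transitions W)"
  and finite_t_init: "finite (t_init W)"
  and finite_t_final: "finite (t_final W)"
  and t_init_confs: "t_init W \<subseteq> confs"
  and t_final_confs: "t_final W \<subseteq> confs"
  and transitions_subset: "transitions W \<subseteq> states W \<times> A \<times> carrier G \<times> states W"
  using wa unfolding weighted_automaton_def by auto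

lemma act_simps [simp]: "fst (act g c) = fst c" "snd (act g c) = g \<otimes> snd c"
  by (simp_all add: act_def)

lemma act_confs [simp]: "g \<in> carrier G \<Longrightarrow> c \<in> confs \<Longrightarrow> act g c \<in> confs"
  by (auto simp: act_def)

lemma act_act: "g \<in> carrier G \<Longrightarrow> h \<in> carrier G \<Longrightarrow> c \<in> confs \<Longrightarrow> act g (act h c) = act (g \<otimes> h) c"
  by (auto simp: act_def m_assoc)

lemma act_one [simp]: "c \<in> confs \<Longrightarrow> act \<one> c = c"
  by (auto simp: act_def)

lemma act_inv [simp]:
  assumes "g \<in> carrier G" and "c \<in> confs"
  shows "act (inv g) (act g c) = c" and "act g (act (inv g) c) = c"
  using assms by (simp_all add: act_act)

lemma crun_confs: "crun w c c' \<Longrightarrow> c \<in> confs \<and> c' \<in> confs"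
  by (induction w arbitrary: c) auto

lemma crun_conf1: "crun w c c' \<Longrightarrow> c \<in> confs"
  and crun_conf2: "crun w c c' \<Longrightarrow> c' \<in> confs"
  using crun_confs by blast+

lemma crun_append: "crun (u @ v) c c' \<longleftrightarrow> (\<exists>d. crun u c d \<and> crun v d c')"
proof (induction u arbitrary: c)
  case Nil
  show ?case using crun_confs[of v c c'] by (cases c) auto
next
  case (Cons a u)
  show ?case unfolding append_Cons crun.simps Cons by blast
qed

lemma crun_appendI: "crun u c d \<Longrightarrow> crun v d c' \<Longrightarrow> crun (u @ v) c c'"
  unfolding crun_append by blast

text \<open>Outputs accumulate by right multiplication, which commutes with the left action.\<close>

lemma crun_act: "g \<in> carrier G \<Longrightarrow> crun w c c' \<Longrightarrow> crun w (act g c) (act g c')"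
proof (induction w arbitrary: c)
  case (Cons a w)
  then obtain \<alpha> q where t: "(fst c, a, \<alpha>, q) \<in> transitions W" "crun w (q, snd c \<otimes> \<alpha>) c'" "c \<in> confs"
    by auto
  have "\<alpha> \<in> carrier G" using t(1) transitions_subset by auto
  then have "act g (q, snd c \<otimes> \<alpha>) = (q, snd (act g c) \<otimes> \<alpha>)"
    using Cons.prems(1) t(3) by (auto simp: act_def m_assoc)
  with Cons.IH[OF Cons.prems(1) t(2)] t(1,3) Cons.prems(1) show ?case
    by (auto simp: act_def)
qed auto

lemma path_output_closed: "path W p ts q \<Longrightarrow> path_output G ts \<in> carrier G"
proof (induction ts arbitrary: p)
  case (Cons t ts)
  obtain p' a \<alpha> r where t: "t = (p', a, \<alpha>, r)" by (cases t)
  with Cons have "\<alpha> \<in> carrier G" "path_output G ts \<in> carrier G"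
    using transitions_subset by auto
  with t show ?case by (simp add: path_output_def)
qed (simp add: path_output_def)

lemma path_ends: "path W p ts q \<Longrightarrow> p \<in> states W \<and> q \<in> states W"
proof (induction ts arbitrary: p)
  case (Cons t ts)
  obtain p' a \<alpha> r where t: "t = (p', a, \<alpha>, r)" by (cases t)
  with Cons.prems have "(p, a, \<alpha>, r) \<in> transitions W" "path W r ts q" by auto
  with Cons.IH[of r] transitions_subset show ?case by blast
qed simp

text \<open>Bridge to \<open>run\<close>, whose output is folded from the right while
  \<open>crun\<close> accumulates from the left; associativity reconciles the two.\<close>

lemma crun_iff_run:
  "crun w c c' \<longleftrightarrow> c \<in> confs \<and> (\<exists>\<alpha>\<in>carrier G. run G W (fst c) w \<alpha> (fst c') \<and> snd c' = snd c \<otimes> \<alpha>)"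
proof (induction w arbitrary: c)
  case Nil
  have "run G W p [] \<alpha> q \<longleftrightarrow> p \<in> states W \<and> p = q \<and> \<alpha> = \<one>" for p q \<alpha>
    by (auto simp: run_def path_word_def path_output_def)
  then show ?case by (auto simp: prod_eq_iff)
next
  case (Cons a w)
  have run: "run G W p (a # w) \<alpha> q \<longleftrightarrow>
      (\<exists>\<beta> r \<gamma>. (p, a, \<beta>, r) \<in> transitions W \<and> run G W r w \<gamma> q \<and> \<alpha> = \<beta> \<otimes> \<gamma>)" for p \<alpha> q
  proof
    assume "run G W p (a # w) \<alpha> q"
    then obtain ts where ts: "path W p ts q" "path_word ts = a # w" "path_output G ts = \<alpha>"
      unfolding run_def by blast
    then obtain p' \<beta> r ts' where "ts = (p', a, \<beta>, r) # ts'" "path_word ts' = w"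
      unfolding path_word_def by (cases ts) auto
    with ts show "\<exists>\<beta> r \<gamma>. (p, a, \<beta>, r) \<in> transitions W \<and> run G W r w \<gamma> q \<and> \<alpha> = \<beta> \<otimes> \<gamma>"
      unfolding run_def by (auto simp: path_output_def)
  next
    assume "\<exists>\<beta> r \<gamma>. (p, a, \<beta>, r) \<in> transitions W \<and> run G W r w \<gamma> q \<and> \<alpha> = \<beta> \<otimes> \<gamma>"
    then obtain \<beta> r ts where "(p, a, \<beta>, r) \<in> transitions W" "path W r ts q" "path_word ts = w"
      "\<alpha> = \<beta> \<otimes> path_output G ts" unfolding run_def by blast
    then show "run G W p (a # w) \<alpha> q"
      unfolding run_def by (intro exI[of _ "(p, a, \<beta>, r) # ts"]) (auto simp: path_word_def path_output_def)
  qed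
  have carrier: "(p, b, \<beta>, r) \<in> transitions W \<Longrightarrow> p \<in> states W \<and> \<beta> \<in> carrier G \<and> r \<in> states W"
    for p b \<beta> r using transitions_subset by auto
  show ?case (is "?l \<longleftrightarrow> ?r")
  proof
    assume ?l
    then obtain \<beta> r \<gamma> where c: "c \<in> confs" "(fst c, a, \<beta>, r) \<in> transitions W"
      "\<gamma> \<in> carrier G" "run G W r w \<gamma> (fst c')" "snd c' = snd c \<otimes> \<beta> \<otimes> \<gamma>"
      by (auto simp: Cons)
    then have "\<beta> \<otimes> \<gamma> \<in> carrier G" "run G W (fst c) (a # w) (\<beta> \<otimes> \<gamma>) (fst c')"
        "snd c' = snd c \<otimes> (\<beta> \<otimes> \<gamma>)"
      using carrier[OF c(2)] by (auto simp: run m_assoc)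
    with c(1) show ?r by blast
  next
    assume ?r
    then obtain \<beta> r \<gamma> where c: "c \<in> confs" "(fst c, a, \<beta>, r) \<in> transitions W"
      "run G W r w \<gamma> (fst c')" "snd c' = snd c \<otimes> (\<beta> \<otimes> \<gamma>)"
      by (auto simp: run)
    from c(3) have "\<gamma> \<in> carrier G" unfolding run_def using path_output_closed by blast
    with c carrier[OF c(2)] have "crun w (r, snd c \<otimes> \<beta>) c'"
      unfolding Cons by (auto simp: m_assoc intro!: bexI[of _ \<gamma>])
    with c show ?l by auto
  qed
qed

text \<open>Fixes one configuration per position, so that several runs on one word can be compared
  and cut at the same positions.\<close>

lemma crun_trace:
  assumes "crun w c c'"
  obtains \<tau> where "\<tau> 0 = c" and "\<tau> (length w) = c'"
    and "\<And>s t. s \<le> t \<Longrightarrow> t \<le> length w \<Longrightarrow> crun (take (t - s) (drop s w)) (\<tau> s) (\<tau> t)"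
proof -
  from assms have "\<exists>\<tau>. \<tau> 0 = c \<and> \<tau> (length w) = c' \<and>
    (\<forall>s t. s \<le> t \<longrightarrow> t \<le> length w \<longrightarrow> crun (take (t - s) (drop s w)) (\<tau> s) (\<tau> t))"
  proof (induction w arbitrary: c)
    case Nil
    then show ?case by (intro exI[of _ "\<lambda>_. c"]) auto
  next
    case (Cons a w)
    then obtain \<alpha> q where t: "c \<in> confs" "(fst c, a, \<alpha>, q) \<in> transitions W" "crun w (q, snd c \<otimes> \<alpha>) c'"
      by auto
    from Cons.IH[OF t(3)] obtain \<tau> where \<tau>: "\<tau> 0 = (q, snd c \<otimes> \<alpha>)" "\<tau> (length w) = c'"
      "\<And>s t. s \<le> t \<Longrightarrow> t \<le> length w \<Longrightarrow> crun (take (t - s) (drop s w)) (\<tau> s) (\<tau> t)" by blast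
    have "crun (take (t' - s') (drop s' (a # w))) (case_nat c \<tau> s') (case_nat c \<tau> t')"
      if "s' \<le> t'" "t' \<le> length (a # w)" for s' t'
    proof (cases s')
      case 0
      show ?thesis
      proof (cases t')
        case (Suc t'')
        with that \<tau>(3)[of 0 t''] \<tau>(1) t 0 show ?thesis by auto
      qed (use 0 t(1) in auto)
    next
      case (Suc s'')
      with that \<tau>(3)[of s'' "t' - 1"] show ?thesis by (cases t') auto
    qed
    with \<tau> show ?case by (intro exI[of _ "case_nat c \<tau>"]) auto
  qed
  with that show ?thesis by blast
qed

section \<open>Growth of outputs along runs\<close>

definition max_weight :: nat where
  \<comment> \<open>Inserting 0 keeps the maximum meaningful when there is no weight at all.\<close>
  "max_weight = Max (insert 0 ((\<lambda>(p, a, \<alpha>, q). cdist \<one> \<alpha>) ` transitions W \<union>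
     (\<lambda>(q, \<alpha>). cdist \<one> \<alpha>) ` t_final W))"

lemma max_weight_transition: "(p, a, \<alpha>, q) \<in> transitions W \<Longrightarrow> cdist \<one> \<alpha> \<le> max_weight"
  unfolding max_weight_def using finite_transitions finite_t_final by (intro Max_ge) force+

lemma max_weight_final: "(q, \<alpha>) \<in> t_final W \<Longrightarrow> cdist \<one> \<alpha> \<le> max_weight"
  unfolding max_weight_def using finite_transitions finite_t_final by (intro Max_ge) force+

lemma cdist_mult_right: "x \<in> carrier G \<Longrightarrow> y \<in> carrier G \<Longrightarrow> cdist x (x \<otimes> y) = cdist \<one> y"
  using cdist_left[of x \<one> y] by simp

lemma crun_cdist: "crun w c c' \<Longrightarrow> cdist (snd c) (snd c') \<le> max_weight * length w"
proof (induction w arbitrary: c)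
  case (Cons a w)
  then obtain \<alpha> q where t: "c \<in> confs" "(fst c, a, \<alpha>, q) \<in> transitions W" "crun w (q, snd c \<otimes> \<alpha>) c'"
    by auto
  have "\<alpha> \<in> carrier G" using t(2) transitions_subset by auto
  with t have c: "snd c \<in> carrier G" "\<alpha> \<in> carrier G" "snd c' \<in> carrier G"
    using crun_confs[OF t(3)] by auto
  have "cdist (snd c) (snd c') \<le> cdist (snd c) (snd c \<otimes> \<alpha>) + cdist (snd c \<otimes> \<alpha>) (snd c')"
    by (intro cdist_triangle) (use c in auto)
  also have "\<dots> \<le> max_weight + max_weight * length w"
    using Cons.IH[OF t(3)] max_weight_transition[OF t(2)] c by (simp add: cdist_mult_right add_mono)
  finally show ?case by simp
qed auto

text \<open>Each of the two outputs moves by at most \<open>max_weight\<close> per letter, hence the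
  factor 2.\<close>

lemma crun_pair_cdist:
  assumes "crun w c c'" and "crun w d d'"
  shows "cdist (snd c') (snd d') \<le> cdist (snd c) (snd d) + 2 * max_weight * length w"
proof -
  have cc: "snd c \<in> carrier G" "snd c' \<in> carrier G" "snd d \<in> carrier G" "snd d' \<in> carrier G"
    using crun_confs[OF assms(1)] crun_confs[OF assms(2)] by auto
  have "cdist (snd c') (snd d') \<le> cdist (snd c') (snd c) + cdist (snd c) (snd d')"
    "cdist (snd c) (snd d') \<le> cdist (snd c) (snd d) + cdist (snd d) (snd d')"
    by (intro cdist_triangle cc)+
  with crun_cdist[OF assms(1)] crun_cdist[OF assms(2)] cdist_commute[OF cc(1,2)] show ?thesis
    by simp
qed

section \<open>Sets of reachable configurations\<close>

definition post :: "'a list \<Rightarrow> ('q \<times> 'g) set \<Rightarrow> ('q \<times> 'g) set" where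
  "post w S = {c'. \<exists>c\<in>S. crun w c c'}"

lemma post_confs: "post w S \<subseteq> confs"
  unfolding post_def using crun_confs by blast

lemma post_append: "post (u @ v) S = post v (post u S)"
  unfolding post_def crun_append by blast

lemma post_Nil: "S \<subseteq> confs \<Longrightarrow> post [] S = S"
  unfolding post_def by auto

lemma post_mono: "S \<subseteq> T \<Longrightarrow> post w S \<subseteq> post w T"
  unfolding post_def by blast

lemma act_image_inv:
  assumes "g \<in> carrier G" and "S \<subseteq> confs"
  shows "act g ` act (inv g) ` S = S" and "act (inv g) ` act g ` S = S"
proof -
  have "act g (act (inv g) c) = c \<and> act (inv g) (act g c) = c" if "c \<in> S" for c
    using act_inv[of g c] assms that by blast
  then show "act g ` act (inv g) ` S = S" "act (inv g) ` act g ` S = S" by (force simp: image_image)+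
qed

lemma act_image_confs: "g \<in> carrier G \<Longrightarrow> S \<subseteq> confs \<Longrightarrow> act g ` S \<subseteq> confs"
  using act_confs by blast

text \<open>Translating runs gives one inclusion for every group element; the other is this
  inclusion for \<open>inv g\<close>.\<close>

lemma post_act:
  assumes "g \<in> carrier G" and "S \<subseteq> confs"
  shows "post w (act g ` S) = act g ` post w S"
proof
  have sub: "act h ` post w T \<subseteq> post w (act h ` T)" if "h \<in> carrier G" for h T
    using crun_act[OF that] unfolding post_def by blast
  show "act g ` post w S \<subseteq> post w (act g ` S)" by (rule sub[OF assms(1)])
  have "act (inv g) ` post w (act g ` S) \<subseteq> post w S"
    using sub[of "inv g" "act g ` S"] assms by (simp add: act_image_inv)
  then have "act g ` act (inv g) ` post w (act g ` S) \<subseteq> act g ` post w S" by blast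
  then show "post w (act g ` S) \<subseteq> act g ` post w S"
    using act_image_inv(1)[OF assms(1) post_confs] by simp
qed

end

section \<open>Towers of loops and separation\<close>

context group_automaton
begin

text \<open>The premise of branching twinning on configurations, with \<open>l\<close> levels and
  runs indexed by \<open>J\<close>. A loop is recorded by its left factor \<open>c i j\<close>
  instead of its weight, because equality of left factors across runs is what the delays
  test.\<close>

definition tower ::
    "nat \<Rightarrow> nat set \<Rightarrow> (nat \<Rightarrow> nat \<Rightarrow> 'q \<times> 'g) \<Rightarrow> (nat \<Rightarrow> nat \<Rightarrow> 'a list) \<Rightarrow> (nat \<Rightarrow> nat \<Rightarrow> 'a list) \<Rightarrow>
     (nat \<Rightarrow> nat \<Rightarrow> 'g) \<Rightarrow> bool" where
  "tower l J y u v c \<longleftrightarrow> (\<forall>j\<in>J. y 0 j \<in> confs) \<and>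
     (\<forall>i<l. \<forall>j\<in>J. c i j \<in> carrier G \<and> crun (u i j) (y i j) (y (Suc i) j) \<and>
        crun (v i j) (y (Suc i) j) (act (c i j) (y (Suc i) j)))"

text \<open>The failure of the conclusion of branching twinning for one pair of runs. Levels count
  from 0 here, from 1 in \<open>branching_twinning_property\<close>.\<close>

definition separated ::
    "nat \<Rightarrow> (nat \<Rightarrow> nat \<Rightarrow> 'a list) \<Rightarrow> (nat \<Rightarrow> nat \<Rightarrow> 'a list) \<Rightarrow> (nat \<Rightarrow> nat \<Rightarrow> 'g) \<Rightarrow> nat \<Rightarrow> nat \<Rightarrow> bool" where
  "separated l u v c j j' \<longleftrightarrow>
     (\<exists>i<l. (\<forall>i'\<le>i. u i' j = u i' j' \<and> v i' j = v i' j') \<and> c i j \<noteq> c i j')"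

text \<open>Peels off the first level; inductions on towers proceed this way.\<close>

lemma separated_Suc:
  "separated (Suc l) u v c j j' \<longleftrightarrow> u 0 j = u 0 j' \<and> v 0 j = v 0 j' \<and>
     (c 0 j \<noteq> c 0 j' \<or> separated l (\<lambda>i. u (Suc i)) (\<lambda>i. v (Suc i)) (\<lambda>i. c (Suc i)) j j')"
proof -
  have le: "(\<forall>i'\<le>Suc i. P i') \<longleftrightarrow> P 0 \<and> (\<forall>i'\<le>i. P (Suc i'))" for i and P :: "nat \<Rightarrow> bool"
    by (metis Suc_le_mono le0 not0_implies_Suc)
  show ?thesis
    unfolding separated_def Ex_less_Suc2 le by auto
qed

lemma tower_confs:
  assumes "tower l J y u v c" and "i \<le> l" and "j \<in> J"
  shows "y i j \<in> confs"
proof (cases i)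
  case (Suc n)
  with assms have "crun (u n j) (y n j) (y i j)" unfolding tower_def by simp
  then show ?thesis by (rule crun_conf2)
qed (use assms in \<open>simp add: tower_def\<close>)

text \<open>
  The loop with output \<open>\<beta>\<close> at a configuration with value \<open>x\<close> multiplies that value from the left by
  \<open>x \<beta> x\<^sup>-\<^sup>1\<close>. Two loops preserve the delay iff these left factors agree, hence
  preservation is an equivalence relation on runs.
\<close>

lemma delay_eq_iff:
  assumes "x \<in> carrier G" and "y \<in> carrier G" and "c \<in> carrier G" and "d \<in> carrier G"
  shows "delay G x y = delay G (c \<otimes> x) (d \<otimes> y) \<longleftrightarrow> c = d"
proof
  assume "delay G x y = delay G (c \<otimes> x) (d \<otimes> y)"
  then have "inv x \<otimes> y = inv x \<otimes> (inv c \<otimes> (d \<otimes> y))"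
    using assms by (simp add: delay_def inv_mult_group m_assoc)
  then have "y = inv c \<otimes> (d \<otimes> y)" using assms by simp
  then have "c \<otimes> y = d \<otimes> y" using assms by (metis inv_closed inv_solve_left m_closed)
  then show "c = d" using assms by simp
next
  assume "c = d"
  with assms show "delay G x y = delay G (c \<otimes> x) (d \<otimes> y)"
    by (simp add: delay_def inv_mult_group m_assoc)
qed

text \<open>Prefix products become the values of configurations, and \<open>delay_eq_iff\<close>
  turns each delay condition into an equation between left factors.\<close>

lemma branching_twinning_property_iff:
  "branching_twinning_property G k W \<longleftrightarrow>
     \<not> (\<exists>y u v c. tower k {..k} y u v c \<and> (\<forall>j\<le>k. y 0 j \<in> t_init W) \<and>
          (\<forall>j\<le>k. \<forall>j'\<le>k. j \<noteq> j' \<longrightarrow> separated k u v c j j'))"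
proof
  assume btp: "branching_twinning_property G k W"
  show "\<not> (\<exists>y u v c. tower k {..k} y u v c \<and> (\<forall>j\<le>k. y 0 j \<in> t_init W) \<and>
          (\<forall>j\<le>k. \<forall>j'\<le>k. j \<noteq> j' \<longrightarrow> separated k u v c j j'))"
  proof safe
    fix y u v c
    assume tw: "tower k {..k} y u v c" and init: "\<forall>j\<le>k. y 0 j \<in> t_init W"
      and sep: "\<forall>j\<le>k. \<forall>j'\<le>k. j \<noteq> j' \<longrightarrow> separated k u v c j j'"
    define q where "q i j = fst (y i j)" for i j
    define \<gamma> where "\<gamma> j = snd (y 0 j)" for j
    \<comment> \<open>Weights are quotients of successive values. Subtracting 1 translates the
      levels 1 to \<open>k\<close> of the definition into levels of the tower.\<close>
    define \<alpha> where "\<alpha> i j = inv (snd (y (i - 1) j)) \<otimes> snd (y i j)" for i j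
    define \<beta> where "\<beta> i j = inv (snd (y i j)) \<otimes> (c (i - 1) j \<otimes> snd (y i j))" for i j
    have carr: "snd (y i j) \<in> carrier G" if "i \<le> k" "j \<le> k" for i j
      using tower_confs[OF tw that(1), of j] that by (auto simp: mem_Times_iff)
    have run_of: "run G W (fst d) w (inv (snd d) \<otimes> snd d') (fst d')" if dd': "crun w d d'" for w d d'
    proof -
      obtain a where "a \<in> carrier G" "run G W (fst d) w a (fst d')" "snd d' = snd d \<otimes> a"
        using dd' unfolding crun_iff_run by auto
      moreover have "snd d \<in> carrier G" using crun_confs[OF dd'] by auto
      ultimately show ?thesis by (simp add: m_assoc[symmetric])
    qed
    have "\<forall>i\<in>{1..k}. \<forall>j\<le>k. run G W (q (i - 1) j) (u (i - 1) j) (\<alpha> i j) (q i j) \<and>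
           run G W (q i j) (v (i - 1) j) (\<beta> i j) (q i j)"
    proof (intro ballI allI impI)
      fix i j assume i: "i \<in> {1..k}" and j: "j \<le> k"
      then have "crun (u (i - 1) j) (y (i - 1) j) (y i j)"
        "crun (v (i - 1) j) (y i j) (act (c (i - 1) j) (y i j))"
        using tw unfolding tower_def by (auto dest!: spec[of _ "i - 1"])
      from this[THEN run_of] show "run G W (q (i - 1) j) (u (i - 1) j) (\<alpha> i j) (q i j) \<and>
           run G W (q i j) (v (i - 1) j) (\<beta> i j) (q i j)"
        unfolding q_def \<alpha>_def \<beta>_def by simp
    qed
    moreover have "\<forall>j\<le>k. (q 0 j, \<gamma> j) \<in> t_init W"
      using init unfolding q_def \<gamma>_def by simp
    ultimately obtain j j' where j: "j \<le> k" "j' \<le> k" "j \<noteq> j'" and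
      del: "\<And>i. i \<in> {1..k} \<Longrightarrow>
        (\<forall>i'\<in>{1..i}. u (i' - 1) j = u (i' - 1) j' \<and> v (i' - 1) j = v (i' - 1) j') \<Longrightarrow>
        delay G (prefix_product G (\<gamma> j) (\<lambda>l. \<alpha> l j) i) (prefix_product G (\<gamma> j') (\<lambda>l. \<alpha> l j') i) =
        delay G (prefix_product G (\<gamma> j) (\<lambda>l. \<alpha> l j) i \<otimes> \<beta> i j)
          (prefix_product G (\<gamma> j') (\<lambda>l. \<alpha> l j') i \<otimes> \<beta> i j')"
      using btp[unfolded branching_twinning_property_def Let_def, THEN spec[of _ q],
          THEN spec[of _ \<gamma>], THEN spec[of _ "\<lambda>i. u (i - 1)"], THEN spec[of _ "\<lambda>i. v (i - 1)"],
          THEN spec[of _ \<alpha>], THEN spec[of _ \<beta>]] by blast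
    have pp: "prefix_product G (\<gamma> m) (\<lambda>l. \<alpha> l m) i = snd (y i m)" if "i \<le> k" "m \<le> k" for i m
      using that(1)
    proof (induction i)
      case (Suc i)
      with that(2) carr[of i m] carr[of "Suc i" m] show ?case
        by (simp add: \<alpha>_def m_assoc[symmetric])
    qed (simp add: \<gamma>_def)
    from sep j obtain i where i: "i < k" "\<forall>i'\<le>i. u i' j = u i' j' \<and> v i' j = v i' j'" "c i j \<noteq> c i j'"
      unfolding separated_def by blast
    have cc: "c i j \<in> carrier G" "c i j' \<in> carrier G"
      using tw i(1) j unfolding tower_def by auto
    have y\<beta>: "snd (y (Suc i) m) \<otimes> \<beta> (Suc i) m = c i m \<otimes> snd (y (Suc i) m)"
      if "m \<le> k" "c i m \<in> carrier G" for m
      using carr[of "Suc i" m] i(1) that by (simp add: \<beta>_def m_assoc[symmetric])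
    have "Suc i \<in> {1..k}" "\<forall>i'\<in>{1..Suc i}. u (i' - 1) j = u (i' - 1) j' \<and> v (i' - 1) j = v (i' - 1) j'"
      using i by auto
    from del[OF this] i(1) have "delay G (snd (y (Suc i) j)) (snd (y (Suc i) j')) =
      delay G (c i j \<otimes> snd (y (Suc i) j)) (c i j' \<otimes> snd (y (Suc i) j'))"
      using j cc by (simp add: pp y\<beta> del: prefix_product.simps)
    then show False using i cc carr[of "Suc i"] j by (subst (asm) delay_eq_iff) auto
  qed
next
  assume no: "\<not> (\<exists>y u v c. tower k {..k} y u v c \<and> (\<forall>j\<le>k. y 0 j \<in> t_init W) \<and>
          (\<forall>j\<le>k. \<forall>j'\<le>k. j \<noteq> j' \<longrightarrow> separated k u v c j j'))"
  show "branching_twinning_property G k W"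
    unfolding branching_twinning_property_def Let_def
  proof (intro allI impI, rule ccontr)
    fix q \<gamma> u v \<alpha> \<beta>
    assume asm: "(\<forall>j\<le>k. (q 0 j, \<gamma> j) \<in> t_init W) \<and>
        (\<forall>i\<in>{1..k}. \<forall>j\<le>k. run G W (q (i - 1) j) (u i j) (\<alpha> i j) (q i j) \<and>
           run G W (q i j) (v i j) (\<beta> i j) (q i j))"
    define x where "x i j = prefix_product G (\<gamma> j) (\<lambda>l. \<alpha> l j) i" for i j
    assume neg: "\<not> (\<exists>j\<le>k. \<exists>j'\<le>k. j \<noteq> j' \<and>
           (\<forall>i\<in>{1..k}. (\<forall>i'\<in>{1..i}. u i' j = u i' j' \<and> v i' j = v i' j') \<longrightarrow>
             delay G (prefix_product G (\<gamma> j) (\<lambda>l. \<alpha> l j) i) (prefix_product G (\<gamma> j') (\<lambda>l. \<alpha> l j') i) =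
             delay G (prefix_product G (\<gamma> j) (\<lambda>l. \<alpha> l j) i \<otimes> \<beta> i j)
               (prefix_product G (\<gamma> j') (\<lambda>l. \<alpha> l j') i \<otimes> \<beta> i j')))"
    have neg': "\<exists>i\<in>{1..k}. (\<forall>i'\<in>{1..i}. u i' j = u i' j' \<and> v i' j = v i' j') \<and>
        delay G (x i j) (x i j') \<noteq> delay G (x i j \<otimes> \<beta> i j) (x i j' \<otimes> \<beta> i j')"
      if "j \<le> k" "j' \<le> k" "j \<noteq> j'" for j j'
      using neg that unfolding x_def by blast
    have runs: "run G W (q i j) (u (Suc i) j) (\<alpha> (Suc i) j) (q (Suc i) j)"
      "run G W (q (Suc i) j) (v (Suc i) j) (\<beta> (Suc i) j) (q (Suc i) j)" if "i < k" "j \<le> k" for i j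
      using asm that by (auto dest!: bspec[of _ _ "Suc i"])
    have run_closed: "a \<in> carrier G" if "run G W p w a r" for p w a r
      using that path_output_closed unfolding run_def by blast
    define y where "y i j = (q i j, x i j)" for i j
    \<comment> \<open>Conjugation by the value turns right multiplication by the loop weight into
      left multiplication.\<close>
    define c where "c i j = x (Suc i) j \<otimes> \<beta> (Suc i) j \<otimes> inv (x (Suc i) j)" for i j
    have init: "y 0 j \<in> t_init W" if "j \<le> k" for j
      using asm that unfolding y_def x_def by simp
    have xc: "x i j \<in> carrier G" if "i \<le> k" "j \<le> k" for i j
      using that(1)
    proof (induction i)
      case 0
      show ?case using init[OF that(2)] t_init_confs unfolding y_def by auto
    next
      case (Suc i)
      then show ?case using run_closed[OF runs(1)[of i j]] that(2) unfolding x_def by simp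
    qed
    have yconf: "y i j \<in> confs" if "i \<le> k" "j \<le> k" for i j
      using that(1)
    proof (cases i)
      case 0
      then show ?thesis using init[OF that(2)] t_init_confs by auto
    next
      case (Suc i')
      with runs(2)[of i' j] that have "q i j \<in> states W"
        unfolding run_def using path_ends by auto
      with xc[OF that] show ?thesis unfolding y_def by simp
    qed
    have "tower k {..k} y (\<lambda>i. u (Suc i)) (\<lambda>i. v (Suc i)) c"
      unfolding tower_def
    proof (intro conjI ballI allI impI)
      fix i j assume i: "i < k" and j: "j \<in> {..k}"
      have \<beta>: "\<beta> (Suc i) j \<in> carrier G" "\<alpha> (Suc i) j \<in> carrier G"
        using run_closed runs[of i j] i j by auto
      show "c i j \<in> carrier G" using xc[of "Suc i" j] i j \<beta> unfolding c_def by simp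
      show "crun (u (Suc i) j) (y i j) (y (Suc i) j)"
        unfolding crun_iff_run using runs(1)[of i j] i j yconf[of i j] \<beta>(2)
        by (intro conjI bexI[of _ "\<alpha> (Suc i) j"]) (simp_all add: y_def x_def)
      have "c i j \<otimes> x (Suc i) j = x (Suc i) j \<otimes> \<beta> (Suc i) j"
        using xc[of "Suc i" j] i j \<beta> unfolding c_def by (simp add: m_assoc)
      then show "crun (v (Suc i) j) (y (Suc i) j) (act (c i j) (y (Suc i) j))"
        unfolding crun_iff_run using runs(2)[of i j] i j yconf[of "Suc i" j] \<beta>(1)
        by (intro conjI bexI[of _ "\<beta> (Suc i) j"]) (simp_all add: y_def)
    qed (use yconf in auto)
    moreover have "separated k (\<lambda>i. u (Suc i)) (\<lambda>i. v (Suc i)) c j j'"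
      if jj: "j \<le> k" "j' \<le> k" "j \<noteq> j'" for j j'
    proof -
      obtain i where i: "i \<in> {1..k}" "\<forall>i'\<in>{1..i}. u i' j = u i' j' \<and> v i' j = v i' j'"
        "delay G (x i j) (x i j') \<noteq> delay G (x i j \<otimes> \<beta> i j) (x i j' \<otimes> \<beta> i j')"
        using neg'[OF jj] by blast
      then obtain i0 where i0: "i = Suc i0" "i0 < k" by (cases i) auto
      have \<beta>: "\<beta> i j \<in> carrier G" "\<beta> i j' \<in> carrier G"
        unfolding i0(1) using run_closed runs(2)[OF i0(2)] jj by blast+
      have xx: "x i j \<in> carrier G" "x i j' \<in> carrier G" using xc i jj by auto
      have cx: "x i m \<otimes> \<beta> i m = c i0 m \<otimes> x i m \<and> c i0 m \<in> carrier G"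
        if "x i m \<in> carrier G" "\<beta> i m \<in> carrier G" for m
        using that unfolding c_def i0(1)[symmetric] by (simp add: m_assoc)
      have "c i0 j \<noteq> c i0 j'"
      proof
        assume "c i0 j = c i0 j'"
        with delay_eq_iff[OF xx, of "c i0 j" "c i0 j'"] cx[OF xx(1) \<beta>(1)] cx[OF xx(2) \<beta>(2)] i(3)
        show False by simp
      qed
      with i(2) i0 show ?thesis unfolding separated_def by (intro exI[of _ i0]) auto
    qed
    ultimately have "tower k {..k} y (\<lambda>i. u (Suc i)) (\<lambda>i. v (Suc i)) c \<and> (\<forall>j\<le>k. y 0 j \<in> t_init W) \<and>
        (\<forall>j\<le>k. \<forall>j'\<le>k. j \<noteq> j' \<longrightarrow> separated k (\<lambda>i. u (Suc i)) (\<lambda>i. v (Suc i)) c j j')"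
      using init by simp
    then have "\<exists>y u v c. tower k {..k} y u v c \<and> (\<forall>j\<le>k. y 0 j \<in> t_init W) \<and>
        (\<forall>j\<le>k. \<forall>j'\<le>k. j \<noteq> j' \<longrightarrow> separated k u v c j j')"
      by - (rule exI[of _ y], rule exI[of _ "\<lambda>i. u (Suc i)"], rule exI[of _ "\<lambda>i. v (Suc i)"],
        rule exI[of _ c])
    with no show False by (rule notE)
  qed
qed

text \<open>
  \<open>sep S m\<close>: from \<open>S\<close> there are \<open>m\<close> runs any two of which are separated by a loop on a common word.
  Branching twinning of order \<open>k\<close> bounds \<open>m\<close> by \<open>k\<close> (\<open>branching_twinning_not_sep\<close>); in contrast to the
  property itself, this bound can be divided among the parts when \<open>S\<close> is split.
\<close>

inductive sep :: "('q \<times> 'g) set \<Rightarrow> nat \<Rightarrow> bool" where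
  single: "c \<in> S \<Longrightarrow> c \<in> confs \<Longrightarrow> sep S 1"
| split: "sep S1 m1 \<Longrightarrow> sep S2 m2 \<Longrightarrow> S1 \<subseteq> post u S \<Longrightarrow> S2 \<subseteq> post u S \<Longrightarrow>
    \<forall>d\<in>S1. \<exists>g\<in>C1. crun v d (act g d) \<Longrightarrow> \<forall>d\<in>S2. \<exists>g\<in>C2. crun v d (act g d) \<Longrightarrow>
    C1 \<subseteq> carrier G \<Longrightarrow> C2 \<subseteq> carrier G \<Longrightarrow> C1 \<inter> C2 = {} \<Longrightarrow> sep S (m1 + m2)"

section \<open>Closure properties of separation\<close>

lemma sep_pos: "sep S m \<Longrightarrow> 0 < m"
  by (induction rule: sep.induct) auto

text \<open>The word \<open>w\<close> is prefixed to the first word of the derivation; everything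
  after it stays.\<close>

lemma sep_post:
  assumes "sep T m" and "T \<subseteq> post w S"
  shows "sep S m"
  using assms(1)
proof cases
  case (single c)
  with assms(2) obtain d where "d \<in> S" "crun w d c" unfolding post_def by blast
  with single show ?thesis using crun_confs sep.single by blast
next
  case (split S1 m1 S2 m2 u C1 v C2)
  have "post u T \<subseteq> post (w @ u) S"
    unfolding post_append by (rule post_mono[OF assms(2)])
  with split sep.split[of S1 m1 S2 m2 "w @ u" S C1 v C2] show ?thesis by auto
qed

lemma sep_mono: "sep S m \<Longrightarrow> S \<subseteq> T \<Longrightarrow> sep T m"
proof (induction rule: sep.induct)
  case (split S1 m1 S2 m2 u S C1 v C2)
  with post_mono[OF split.prems, of u] show ?case by (intro sep.split[of S1 m1 S2 m2 u T C1 v C2]) auto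
qed (use sep.single in auto)

text \<open>Runs are dropped from the second part only, or the second part is dropped altogether and
  the first one reduced.\<close>

lemma sep_le: "sep S m \<Longrightarrow> 0 < m' \<Longrightarrow> m' \<le> m \<Longrightarrow> sep S m'"
proof (induction arbitrary: m' rule: sep.induct)
  case (single c S)
  then show ?case using sep.single by (metis One_nat_def Suc_leI le_antisym)
next
  case (split S1 m1 S2 m2 u S C1 v C2)
  show ?case
  proof (cases "m' \<le> m1")
    case True
    with split show ?thesis using sep_post by blast
  next
    case False
    with split have "sep S2 (m' - m1)" by simp
    with split False sep.split[of S1 m1 S2 "m' - m1" u S C1 v C2] show ?thesis by auto
  qed
qed

text \<open>Translation by \<open>g\<close> conjugates all loop factors by \<open>g\<close>.
  Conjugation is injective, so the disjointness of \<open>C1\<close> and \<open>C2\<close>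
  survives.\<close>

lemma sep_act: "sep S m \<Longrightarrow> g \<in> carrier G \<Longrightarrow> sep (act g ` S) m"
proof (induction rule: sep.induct)
  case (single c S)
  then show ?case by (intro sep.single[of "act g c"] imageI act_confs)
next
  case (split S1 m1 S2 m2 u S C1 v C2)
  define cj where "cj h = g \<otimes> h \<otimes> inv g" for h
  have sub: "act g ` post u S \<subseteq> post u (act g ` S)"
    using crun_act[OF split.prems] unfolding post_def by blast
  have loop: "crun v (act g d) (act (cj h) (act g d))" if "crun v d (act h d)" "h \<in> carrier G" for d h
  proof -
    have "d \<in> confs" using crun_confs that(1) by blast
    then have "act (cj h) (act g d) = act g (act h d)"
      using that split.prems unfolding cj_def by (auto simp: act_def m_assoc)
    with crun_act[OF split.prems that(1)] show ?thesis by simp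
  qed
  have lp: "\<forall>d\<in>act g ` T. \<exists>h\<in>cj ` C. crun v d (act h d)"
    if "\<forall>d\<in>T. \<exists>h\<in>C. crun v d (act h d)" "C \<subseteq> carrier G" for T C
    using that loop by blast
  have "cj h \<noteq> cj h'" if "h \<in> carrier G" "h' \<in> carrier G" "h \<noteq> h'" for h h'
    using that split.prems unfolding cj_def by simp
  then have "inj_on cj (carrier G)" by (meson inj_onI)
  from inj_on_image_Int[OF this split.hyps(7,8)] have "cj ` C1 \<inter> cj ` C2 = {}"
    using split.hyps(9) by simp
  moreover have "cj ` C1 \<subseteq> carrier G" "cj ` C2 \<subseteq> carrier G"
    using split.hyps(7,8) split.prems unfolding cj_def by auto
  moreover have "act g ` S1 \<subseteq> post u (act g ` S)" "act g ` S2 \<subseteq> post u (act g ` S)"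
    using image_mono[OF split.hyps(3)] image_mono[OF split.hyps(4)] sub by (meson subset_trans)+
  ultimately show ?case
    using split.prems split.IH lp[OF split.hyps(5,7)] lp[OF split.hyps(6,8)]
    by (intro sep.split[of "act g ` S1" m1 "act g ` S2" m2 u _ "cj ` C1" v "cj ` C2"])
qed

lemma sep_act_iff:
  assumes "g \<in> carrier G" and "S \<subseteq> confs"
  shows "sep (act g ` S) m \<longleftrightarrow> sep S m"
proof
  assume "sep (act g ` S) m"
  from sep_act[OF this, of "inv g"] show "sep S m"
    using act_image_inv(2)[OF assms] assms(1) by simp
qed (rule sep_act[OF _ assms(1)])

text \<open>A derivation of \<open>sep S m\<close> is a binary tree with \<open>m\<close> leaves, so
  its depth is at most \<open>m - 1\<close>. The towers of both parts are put side by side above a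
  common first level.\<close>

lemma sep_imp_tower:
  assumes "sep S m" and "m \<le> Suc l"
  shows "\<exists>y u v c. tower l {..<m} y u v c \<and> (\<forall>j<m. y 0 j \<in> S) \<and>
    (\<forall>j<m. \<forall>j'<m. j \<noteq> j' \<longrightarrow> separated l u v c j j')"
  using assms
proof (induction arbitrary: l rule: sep.induct)
  case (single c S)
  \<comment> \<open>Padding up to height \<open>l\<close>: the empty word is both a run and a loop
    with factor \<open>\<one>\<close>.\<close>
  have "tower l {..<1} (\<lambda>_ _. c) (\<lambda>_ _. []) (\<lambda>_ _. []) (\<lambda>_ _. \<one>)"
    unfolding tower_def using single by simp
  with single show ?case
    by (intro exI[of _ "\<lambda>_ _. c"] exI[of _ "\<lambda>_ _. []"] exI[of _ "\<lambda>_ _. \<one>"]) auto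
next
  case (split S1 m1 S2 m2 w S C1 v C2)
  have pos: "0 < m1" "0 < m2" using split.hyps sep_pos by blast+
  then obtain l' where l: "l = Suc l'" using split.prems by (cases l) auto
  have le: "m1 \<le> Suc l'" "m2 \<le> Suc l'" using split.prems pos l by auto
  obtain y1 u1 v1 c1 where t1: "tower l' {..<m1} y1 u1 v1 c1" "\<forall>j<m1. y1 0 j \<in> S1"
      "\<forall>j<m1. \<forall>j'<m1. j \<noteq> j' \<longrightarrow> separated l' u1 v1 c1 j j'"
    using split.IH(1)[OF le(1)] by (elim exE conjE)
  obtain y2 u2 v2 c2 where t2: "tower l' {..<m2} y2 u2 v2 c2" "\<forall>j<m2. y2 0 j \<in> S2"
      "\<forall>j<m2. \<forall>j'<m2. j \<noteq> j' \<longrightarrow> separated l' u2 v2 c2 j j'"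
    using split.IH(2)[OF le(2)] by (elim exE conjE)
  \<comment> \<open>The runs of the second part are numbered from \<open>m1\<close> on.\<close>
  define y0 where "y0 j = (if j < m1 then y1 0 j else y2 0 (j - m1))" for j
  have "\<exists>s g. s \<in> S \<and> crun w s (y0 j) \<and> g \<in> (if j < m1 then C1 else C2) \<and>
    crun v (y0 j) (act g (y0 j))" if "j < m1 + m2" for j
  proof (cases "j < m1")
    case True
    then have "y0 j \<in> S1" using t1(2) by (simp add: y0_def)
    with split.hyps(3,5) True show ?thesis unfolding post_def if_P[OF True] by blast
  next
    case False
    then have "y0 j \<in> S2" using t2(2) that by (simp add: y0_def)
    with split.hyps(4,6) False show ?thesis unfolding post_def if_not_P[OF False] by blast
  qed
  then obtain s g where sg: "s j \<in> S" "crun w (s j) (y0 j)" "g j \<in> (if j < m1 then C1 else C2)"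
    "crun v (y0 j) (act (g j) (y0 j))" if "j < m1 + m2" for j by metis
  define y where "y i j = (case i of 0 \<Rightarrow> s j | Suc i \<Rightarrow> if j < m1 then y1 i j else y2 i (j - m1))" for i j
  define u' where "u' i j = (case i of 0 \<Rightarrow> w | Suc i \<Rightarrow> if j < m1 then u1 i j else u2 i (j - m1))" for i j
  define v' where "v' i j = (case i of 0 \<Rightarrow> v | Suc i \<Rightarrow> if j < m1 then v1 i j else v2 i (j - m1))" for i j
  define c' where "c' i j = (case i of 0 \<Rightarrow> g j | Suc i \<Rightarrow> if j < m1 then c1 i j else c2 i (j - m1))" for i j
  have y_simps: "y 0 j = s j" "y (Suc 0) j = y0 j" for j by (simp_all add: y_def y0_def)
  have "tower l {..<m1 + m2} y u' v' c'"
    unfolding tower_def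
  proof (intro conjI ballI allI impI)
    fix j assume "j \<in> {..<m1 + m2}"
    then show "y 0 j \<in> confs" using crun_conf1[OF sg(2)[of j]] by (simp add: y_simps)
  next
    fix i j assume i: "i < l" and "j \<in> {..<m1 + m2}"
    then have j: "j < m1 + m2" by simp
    have "c' i j \<in> carrier G \<and> crun (u' i j) (y i j) (y (Suc i) j) \<and>
      crun (v' i j) (y (Suc i) j) (act (c' i j) (y (Suc i) j))"
    proof (cases i)
      case 0
      have "g j \<in> carrier G" using sg(3)[OF j] split.hyps by (auto split: if_splits)
      with 0 sg[OF j] show ?thesis by (simp add: y_simps u'_def v'_def c'_def)
    next
      case (Suc i')
      with i l have i': "i' < l'" by simp
      show ?thesis
      proof (cases "j < m1")
        case True
        with t1(1) i' show ?thesis unfolding tower_def Suc y_def u'_def v'_def c'_def by simp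
      next
        case False
        with t2(1) i' j show ?thesis unfolding tower_def Suc y_def u'_def v'_def c'_def by simp
      qed
    qed
    then show "c' i j \<in> carrier G" "crun (u' i j) (y i j) (y (Suc i) j)"
      "crun (v' i j) (y (Suc i) j) (act (c' i j) (y (Suc i) j))" by auto
  qed
  moreover have "\<forall>j<m1 + m2. y 0 j \<in> S" using sg(1) by (simp add: y_simps)
  \<comment> \<open>All runs read \<open>w\<close> and \<open>v\<close> on the first level. Runs of
    different parts differ there in their factors, as \<open>C1\<close> and \<open>C2\<close> are
    disjoint; runs of one part are separated higher up.\<close>
  moreover have "separated l u' v' c' j j'" if "j < m1 + m2" "j' < m1 + m2" "j \<noteq> j'" for j j'
  proof (cases "(j < m1) = (j' < m1)")
    case True
    have "separated l' (\<lambda>i. u' (Suc i)) (\<lambda>i. v' (Suc i)) (\<lambda>i. c' (Suc i)) j j'"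
    proof (cases "j < m1")
      case j: True
      with True t1(3) that show ?thesis
        unfolding separated_def u'_def v'_def c'_def by simp
    next
      case False
      with True that have "j - m1 < m2" "j' - m1 < m2" "j - m1 \<noteq> j' - m1" by auto
      with t2(3) have "separated l' u2 v2 c2 (j - m1) (j' - m1)" by blast
      with False True show ?thesis
        unfolding separated_def u'_def v'_def c'_def by simp
    qed
    then show ?thesis unfolding l separated_Suc by (simp add: u'_def v'_def)
  next
    case False
    then have "g j \<noteq> g j'"
      using sg(3)[OF that(1)] sg(3)[OF that(2)] split.hyps(9) by (auto split: if_splits)
    then show ?thesis unfolding l separated_Suc by (simp add: u'_def v'_def c'_def)
  qed
  ultimately show ?case by (intro exI conjI) auto
qed

lemma branching_twinning_not_sep:
  assumes "branching_twinning_property G k W"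
  shows "\<not> sep (t_init W) (Suc k)"
proof
  assume "sep (t_init W) (Suc k)"
  from sep_imp_tower[OF this order.refl] have "\<exists>y u v c. tower k {..k} y u v c \<and>
      (\<forall>j\<le>k. y 0 j \<in> t_init W) \<and> (\<forall>j\<le>k. \<forall>j'\<le>k. j \<noteq> j' \<longrightarrow> separated k u v c j j')"
    by (simp only: lessThan_Suc_atMost less_Suc_eq_le)
  with assms show False unfolding branching_twinning_property_iff by (rule notE)
qed

end

section \<open>From the Lipschitz property to branching twinning\<close>

lemma longest_common_prefix_append:
  "longest_common_prefix (p @ u) (p @ v) = p @ longest_common_prefix u v"
  by (induction p) auto

lemma word_dist_append [simp]: "word_dist (p @ u) (p @ v) = word_dist u v"
  by (simp add: word_dist_def longest_common_prefix_append)

lemma path_suffix: "path W p ts q \<Longrightarrow> s \<in> path_states p ts \<Longrightarrow> \<exists>ts'. path W s ts' q"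
proof (induction ts arbitrary: p)
  case Nil
  then show ?case by (auto simp: path_states_def intro: exI[of _ "[]"])
next
  case (Cons t ts)
  obtain p' a \<alpha> r where t: "t = (p', a, \<alpha>, r)" by (cases t)
  with Cons.prems(2) have "s = p \<or> s \<in> path_states r ts" by (auto simp: path_states_def)
  moreover have "path W r ts q" using Cons.prems(1) t by simp
  ultimately show ?case using Cons.IH[of r] Cons.prems(1) by blast
qed

context generated_group
begin

text \<open>If two values agreed, the sequence would be periodic and its range finite, against
  infinitariness applied to \<open>inv c\<close>, \<open>\<one>\<close> and
  \<open>d\<close>.\<close>

lemma infinitary_inj:
  assumes "infinitary G" and "c \<in> carrier G" and "d \<in> carrier G" and "c \<noteq> d"
  shows "inj (\<lambda>n :: nat. inv c [^] n \<otimes> d [^] n)"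
proof -
  define f where "f n = inv c [^] n \<otimes> d [^] n" for n :: nat
  have "f m \<noteq> f (m + p)" if "p > 0" for m p
  proof
    assume eq: "f m = f (m + p)"
    \<comment> \<open>New powers can be added on the outer sides, so \<open>f m = f (m + p)\<close>
      cancels to \<open>f p = \<one>\<close>, and conversely \<open>f p = \<one>\<close> makes
      \<open>p\<close> a period.\<close>
    have "f (m + i) = inv c [^] m \<otimes> f i \<otimes> d [^] m" for m i
      using assms nat_pow_mult[of "inv c" m i] nat_pow_mult[of d i m]
      by (simp add: f_def m_assoc[symmetric] add.commute[of m i])
        (simp add: m_assoc add.commute)
    note shift = this
    have "inv c [^] m \<otimes> (f p \<otimes> d [^] m) = inv c [^] m \<otimes> d [^] m"
      using eq shift[of m p] assms by (simp add: f_def m_assoc)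
    then have "f p \<otimes> d [^] m = \<one> \<otimes> d [^] m" using assms by (simp add: f_def)
    then have "f p = \<one>" using assms right_cancel[of "d [^] m" "f p" \<one>] by (simp add: f_def)
    then have period: "f (i + p) = f i" for i using shift[of i p] assms by (simp add: f_def)
    have "f (i + n * p) = f i" for i n
    proof (induction n)
      case (Suc n)
      then show ?case using period[of "i + n * p"] by (simp add: ac_simps)
    qed simp
    from this[of "i mod p" "i div p" for i] have "f i = f (i mod p)" for i by simp
    then have "range f \<subseteq> f ` {..<p}" using that by (metis image_subsetI imageI lessThan_iff mod_less_divisor)
    then have "finite (range f)" by (rule finite_surj[rotated]) simp
    moreover have range: "{inv c [^] n \<otimes> \<one> \<otimes> d [^] n | n :: nat. True} = range f"
      using assms by (auto simp: f_def)
    moreover have "inv c \<otimes> \<one> \<otimes> d \<noteq> \<one>"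
      using assms by (metis inv_closed inv_equality inv_inv r_one)
    then have "infinite {inv c [^] n \<otimes> \<one> \<otimes> d [^] n | n :: nat. True}"
      using assms(1)[unfolded infinitary_def, rule_format, of "inv c" \<one> d] assms(2,3) by simp
    ultimately show False unfolding range by simp
  qed
  then have "f m \<noteq> f n" if "m < n" for m n
    using less_imp_add_positive[OF that] by blast
  then have "inj f" by (intro linorder_injI) simp
  then show ?thesis unfolding f_def .
qed

text \<open>By left invariance the distance is the length of \<open>g n\<close>. The values
  \<open>g n\<close> are pairwise distinct, and a ball contains only finitely many of them.\<close>

lemma infinitary_finite_close:
  assumes "infinitary G" and "c \<in> carrier G" and "d \<in> carrier G" and "c \<noteq> d"
    and "x \<in> carrier G" and "y \<in> carrier G"
  shows "finite {n :: nat. cdist (c [^] n \<otimes> x) (d [^] n \<otimes> y) \<le> B}"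
proof -
  define f where "f n = inv c [^] n \<otimes> d [^] n" for n :: nat
  define g where "g n = inv x \<otimes> f n \<otimes> y" for n
  have "inj f" unfolding f_def by (rule infinitary_inj[OF assms(1-4)])
  have f: "f n \<in> carrier G" for n using assms by (simp add: f_def)
  have "inj g"
  proof (rule injI)
    fix m n assume "g m = g n"
    then have "f m = f n" using f assms by (simp add: g_def m_assoc)
    with \<open>inj f\<close> show "m = n" by (rule injD)
  qed
  have "cdist (c [^] n \<otimes> x) (d [^] n \<otimes> y) = cdist \<one> (g n)" for n
  proof -
    have "cdist (c [^] n \<otimes> x) (d [^] n \<otimes> y) =
      cdist ((c [^] n \<otimes> x) \<otimes> \<one>) ((c [^] n \<otimes> x) \<otimes> (inv (c [^] n \<otimes> x) \<otimes> (d [^] n \<otimes> y)))"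
      using assms by simp
    also have "\<dots> = cdist \<one> (inv (c [^] n \<otimes> x) \<otimes> (d [^] n \<otimes> y))"
      using assms by (intro cdist_left) auto
    also have "inv (c [^] n \<otimes> x) \<otimes> (d [^] n \<otimes> y) = g n"
      using assms by (simp add: g_def f_def inv_mult_group m_assoc nat_pow_inv)
    finally show ?thesis .
  qed
  then have "{n. cdist (c [^] n \<otimes> x) (d [^] n \<otimes> y) \<le> B} \<subseteq> g -` {h \<in> carrier G. cdist \<one> h \<le> B}"
    using f assms by (auto simp: g_def)
  then show ?thesis
    by (rule finite_subset) (intro finite_vimageI finite_cball one_closed \<open>inj g\<close>)
qed

end

context group_automaton
begin

section \<open>Outputs accepted from a configuration\<close>

definition accepts :: "'q \<times> 'g \<Rightarrow> 'a list \<Rightarrow> 'g \<Rightarrow> bool" where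
  "accepts c w z \<longleftrightarrow> (\<exists>d \<phi>. crun w c d \<and> (fst d, \<phi>) \<in> t_final W \<and> z = snd d \<otimes> \<phi>)"

lemma accepts_closed: "accepts c w z \<Longrightarrow> z \<in> carrier G"
  unfolding accepts_def using t_final_confs by (auto dest!: crun_conf2)

lemma accepts_act:
  assumes "g \<in> carrier G" and "accepts c w z"
  shows "accepts (act g c) w (g \<otimes> z)"
proof -
  obtain d \<phi> where d: "crun w c d" "(fst d, \<phi>) \<in> t_final W" "z = snd d \<otimes> \<phi>"
    using assms(2) unfolding accepts_def by blast
  have "\<phi> \<in> carrier G" "snd d \<in> carrier G"
    using d(2) t_final_confs crun_conf2[OF d(1)] by auto
  then have "g \<otimes> z = snd (act g d) \<otimes> \<phi>" using d(3) assms(1) by (simp add: m_assoc)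
  with crun_act[OF assms(1) d(1)] d(2) show ?thesis
    unfolding accepts_def by (intro exI[of _ "act g d"] exI[of _ \<phi>]) simp
qed

lemma accepts_append: "crun u c d \<Longrightarrow> accepts d w z \<Longrightarrow> accepts c (u @ w) z"
  unfolding accepts_def crun_append by blast

lemma accepts_append_iff: "accepts c (u @ w) z \<longleftrightarrow> (\<exists>d. crun u c d \<and> accepts d w z)"
  unfolding accepts_def crun_append by blast

lemma computed_relation_iff:
  "(w, z) \<in> computed_relation G W \<longleftrightarrow> (\<exists>c\<in>t_init W. accepts c w z)"
proof
  assume "(w, z) \<in> computed_relation G W"
  then obtain \<alpha> \<beta> \<gamma> p q where r: "z = \<alpha> \<otimes> \<beta> \<otimes> \<gamma>" "(p, \<alpha>) \<in> t_init W" "run G W p w \<beta> q"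
    "(q, \<gamma>) \<in> t_final W" unfolding computed_relation_def by auto
  moreover have "\<beta> \<in> carrier G" using r(3) path_output_closed unfolding run_def by blast
  ultimately have "crun w (p, \<alpha>) (q, \<alpha> \<otimes> \<beta>)"
    unfolding crun_iff_run using t_init_confs by auto
  with r show "\<exists>c\<in>t_init W. accepts c w z" unfolding accepts_def by force
next
  assume "\<exists>c\<in>t_init W. accepts c w z"
  then obtain c d \<phi> where c: "c \<in> t_init W" "crun w c d" "(fst d, \<phi>) \<in> t_final W" "z = snd d \<otimes> \<phi>"
    unfolding accepts_def by blast
  then obtain \<beta> where "run G W (fst c) w \<beta> (fst d)" "snd d = snd c \<otimes> \<beta>"
    unfolding crun_iff_run by blast
  with c show "(w, z) \<in> computed_relation G W"
    unfolding computed_relation_def mem_Collect_eq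
    by - (rule exI[of _ w], rule exI[of _ "snd c"], rule exI[of _ \<beta>], rule exI[of _ \<phi>],
      rule conjI, simp, rule exI[of _ "fst c"], rule exI[of _ "fst d"], simp)
qed

text \<open>An accepting run through the state \<open>fst c\<close> has a remainder starting there;
  it is replayed from the value of \<open>c\<close>.\<close>

lemma trimmed_accepts:
  assumes "trimmed W" and "c \<in> confs"
  shows "\<exists>w z. accepts c w z"
proof -
  have "fst c \<in> states W" using assms(2) by auto
  with assms(1) obtain p ts q where ts: "path W p ts q" "final W q" "fst c \<in> path_states p ts"
    unfolding trimmed_def by blast
  from path_suffix[OF ts(1,3)] obtain ts' where ts': "path W (fst c) ts' q" by blast
  from ts(2) obtain \<phi> where "(q, \<phi>) \<in> t_final W" unfolding final_def by blast
  moreover have "crun (path_word ts') c (q, snd c \<otimes> path_output G ts')"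
    unfolding crun_iff_run run_def using assms(2) ts' path_output_closed[OF ts'] by auto
  ultimately show ?thesis unfolding accepts_def by force
qed

text \<open>The later rounds are the translate by \<open>g\<close> of the run made of one round
  less.\<close>

lemma crun_loop:
  assumes "crun v d (act g d)" and "g \<in> carrier G"
  shows "crun (concat (replicate n v)) d (act (g [^] n) d)"
proof (induction n)
  case 0
  show ?case using crun_conf1[OF assms(1)] by simp
next
  case (Suc n)
  have "act g (act (g [^] n) d) = act (g [^] Suc n) d"
    using act_act[OF assms(2) _ crun_conf1[OF assms(1)], of "g [^] n"] assms(2)
    by (simp add: nat_pow_Suc2[symmetric] del: nat_pow_Suc)
  with crun_act[OF assms(2) Suc] have "crun (concat (replicate n v)) (act g d) (act (g [^] Suc n) d)"
    by simp
  from crun_appendI[OF assms(1) this] show ?case by simp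
qed

text \<open>Exponents are chosen from the last level backwards, one exponent \<open>n\<close> for
  all runs of a level. Runs with equal words on the level keep their \<open>word_dist\<close> for
  every \<open>n\<close>, so the bound to beat is known before \<open>n\<close> is chosen. If their
  factors differ, only finitely many \<open>n\<close> fail to beat it; if the factors agree, the
  distance already achieved on the later levels is preserved.\<close>

lemma tower_imp_far_outputs:
  assumes "infinitary G" and "trimmed W" and "finite J" and "tower l J y u v c"
  shows "\<exists>w z. (\<forall>j\<in>J. accepts (y 0 j) (w j) (z j)) \<and>
    (\<forall>j\<in>J. \<forall>j'\<in>J. separated l u v c j j' \<longrightarrow> L * (word_dist (w j) (w j') + 1) < cdist (z j) (z j'))"
  using assms(4)
proof (induction l arbitrary: y u v c)
  case 0
  then have "\<exists>w z. accepts (y 0 j) w z" if "j \<in> J" for j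
    using that trimmed_accepts[OF assms(2)] unfolding tower_def by blast
  then obtain w z where "accepts (y 0 j) (w j) (z j)" if "j \<in> J" for j by metis
  then show ?case unfolding separated_def by auto
next
  case (Suc l)
  have "tower l J (\<lambda>i. y (Suc i)) (\<lambda>i. u (Suc i)) (\<lambda>i. v (Suc i)) (\<lambda>i. c (Suc i))"
    using Suc.prems tower_confs[OF Suc.prems, of "Suc 0"] unfolding tower_def by auto
  from Suc.IH[OF this] obtain w z where w: "\<And>j. j \<in> J \<Longrightarrow> accepts (y (Suc 0) j) (w j) (z j)" and
    far: "\<And>j j'. j \<in> J \<Longrightarrow> j' \<in> J \<Longrightarrow>
      separated l (\<lambda>i. u (Suc i)) (\<lambda>i. v (Suc i)) (\<lambda>i. c (Suc i)) j j' \<Longrightarrow>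
      L * (word_dist (w j) (w j') + 1) < cdist (z j) (z j')" by blast
  have base: "c 0 j \<in> carrier G" "crun (u 0 j) (y 0 j) (y (Suc 0) j)"
    "crun (v 0 j) (y (Suc 0) j) (act (c 0 j) (y (Suc 0) j))" if "j \<in> J" for j
    using Suc.prems that unfolding tower_def by auto
  have z: "z j \<in> carrier G" if "j \<in> J" for j using accepts_closed[OF w[OF that]] .
  define bad where "bad j j' = {n :: nat. cdist (c 0 j [^] n \<otimes> z j) (c 0 j' [^] n \<otimes> z j') \<le>
    L * (word_dist (w j) (w j') + 1)}" for j j'
  have "finite (bad j j')" if "j \<in> J" "j' \<in> J" "c 0 j \<noteq> c 0 j'" for j j'
    unfolding bad_def by (intro infinitary_finite_close assms(1) base z that)
  then have "finite (\<Union>(j, j') \<in> {(j, j'). j \<in> J \<and> j' \<in> J \<and> c 0 j \<noteq> c 0 j'}. bad j j')"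
    by (intro finite_UN_I finite_subset[of "{(j, j'). j \<in> J \<and> j' \<in> J \<and> c 0 j \<noteq> c 0 j'}" "J \<times> J"])
      (auto simp: assms(3))
  then obtain n where "n \<notin> (\<Union>(j, j') \<in> {(j, j'). j \<in> J \<and> j' \<in> J \<and> c 0 j \<noteq> c 0 j'}. bad j j')"
    using ex_new_if_finite infinite_UNIV_nat by blast
  then have n: "n \<notin> bad j j'" if "j \<in> J" "j' \<in> J" "c 0 j \<noteq> c 0 j'" for j j'
    using that by blast
  define w' where "w' j = u 0 j @ concat (replicate n (v 0 j)) @ w j" for j
  define z' where "z' j = c 0 j [^] n \<otimes> z j" for j
  have "accepts (y 0 j) (w' j) (z' j)" if "j \<in> J" for j
  proof -
    note b = base[OF that]
    have "accepts (act (c 0 j [^] n) (y (Suc 0) j)) (w j) (z' j)"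
      unfolding z'_def by (rule accepts_act[OF _ w[OF that]]) (use b in simp)
    with accepts_append[OF crun_loop[OF b(3,1)]] have
      "accepts (y (Suc 0) j) (concat (replicate n (v 0 j)) @ w j) (z' j)" by blast
    from accepts_append[OF b(2) this] show ?thesis by (simp add: w'_def)
  qed
  moreover have "L * (word_dist (w' j) (w' j') + 1) < cdist (z' j) (z' j')"
    if j: "j \<in> J" "j' \<in> J" and s: "separated (Suc l) u v c j j'" for j j'
  proof -
    have wd: "word_dist (w' j) (w' j') = word_dist (w j) (w j')"
      using s unfolding separated_Suc w'_def by simp
    show ?thesis
    proof (cases "c 0 j = c 0 j'")
      case True
      then have "L * (word_dist (w j) (w j') + 1) < cdist (z j) (z j')"
        using s far[OF j] unfolding separated_Suc by blast
      with True base j z wd show ?thesis by (simp add: z'_def)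
    next
      case False
      from n[OF j this] show ?thesis unfolding bad_def wd z'_def by simp
    qed
  qed
  ultimately show ?case by blast
qed

lemma lipschitz_imp_branching_twinning:
  assumes "infinitary G" and "trimmed W" and lip: "lipschitz_property G \<Gamma> k (computed_relation G W)"
  shows "branching_twinning_property G k W"
  unfolding branching_twinning_property_iff
proof safe
  fix y u v c
  assume tw: "tower k {..k} y u v c" and init: "\<forall>j\<le>k. y 0 j \<in> t_init W"
    and s: "\<forall>j\<le>k. \<forall>j'\<le>k. j \<noteq> j' \<longrightarrow> separated k u v c j j'"
  obtain L where L: "\<And>w \<alpha>. (\<forall>i\<le>k. (w i, \<alpha> i) \<in> computed_relation G W) \<Longrightarrow>
        (\<exists>i j. i < j \<and> j \<le> k \<and> cdist (\<alpha> i) (\<alpha> j) \<le> L * (word_dist (w i) (w j) + 1))"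
    using lip unfolding lipschitz_property_def by blast
  obtain w z where wz: "\<forall>j\<in>{..k}. accepts (y 0 j) (w j) (z j)"
    "\<forall>j\<in>{..k}. \<forall>j'\<in>{..k}. separated k u v c j j' \<longrightarrow>
      L * (word_dist (w j) (w j') + 1) < cdist (z j) (z j')"
    using tower_imp_far_outputs[OF assms(1,2) _ tw] by blast
  have "\<forall>i\<le>k. (w i, z i) \<in> computed_relation G W"
    unfolding computed_relation_iff using wz(1) init by auto
  from L[OF this] obtain i j where ij: "i < j" "j \<le> k"
    "cdist (z i) (z j) \<le> L * (word_dist (w i) (w j) + 1)" by blast
  then have "separated k u v c i j" using s by simp
  with wz(2) ij show False by (auto simp: not_less[symmetric])
qed

end

section \<open>Splitting sets of large diameter\<close>

context group_automaton
begin

definition diam_le :: "nat \<Rightarrow> ('q \<times> 'g) set \<Rightarrow> bool" where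
  "diam_le D S \<longleftrightarrow> (\<forall>c\<in>S. \<forall>d\<in>S. cdist (snd c) (snd d) \<le> D)"

lemma diam_le_mono: "diam_le D S \<Longrightarrow> D \<le> D' \<Longrightarrow> diam_le D' S"
  unfolding diam_le_def by (meson le_trans)

lemma diam_le_subset: "diam_le D S \<Longrightarrow> T \<subseteq> S \<Longrightarrow> diam_le D T"
  unfolding diam_le_def by blast

lemma diam_le_act:
  assumes "diam_le D S" and "S \<subseteq> confs" and "g \<in> carrier G"
  shows "diam_le D (act g ` S)"
proof -
  have "cdist (snd (act g c)) (snd (act g d)) \<le> D" if "c \<in> S" "d \<in> S" for c d
  proof -
    have "snd c \<in> carrier G" "snd d \<in> carrier G" using assms(2) that by auto
    with assms that show ?thesis unfolding diam_le_def by simp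
  qed
  then show ?thesis unfolding diam_le_def by blast
qed

lemma diam_le_finite: "finite S \<Longrightarrow> \<exists>D. diam_le D S"
proof -
  assume "finite S"
  then have "finite ((\<lambda>(c, d). cdist (snd c) (snd d)) ` (S \<times> S))" by simp
  then have "diam_le (Max ((\<lambda>(c, d). cdist (snd c) (snd d)) ` (S \<times> S))) S"
    unfolding diam_le_def by (intro ballI Max_ge) force+
  then show ?thesis ..
qed

text \<open>
  Loops acting by the same left factor on all runs of a family can be cut out, which only translates
  the family.
\<close>

lemma cut_loops:
  fixes x z :: "'i \<Rightarrow> 'q \<times> 'g"
  assumes "finite I" and "\<forall>i\<in>I. crun w (x i) (z i)"
  shows "(\<exists>g\<in>carrier G. \<exists>w'. length w' \<le> card (states W) ^ card I \<and>
      (\<forall>i\<in>I. crun w' (x i) (act g (z i)))) \<or>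
    (\<exists>g\<in>carrier G. \<exists>u v s r c. (\<forall>i\<in>I. c i \<in> carrier G \<and> crun u (x i) (r i) \<and>
      crun v (r i) (act (c i) (r i)) \<and> crun s (act (c i) (r i)) (act g (z i))) \<and>
      (\<exists>i\<in>I. \<exists>j\<in>I. c i \<noteq> c j))"
  using assms(2)
proof (induction "length w" arbitrary: w z rule: less_induct)
  case less
  have zc: "z i \<in> confs" if "i \<in> I" for i using crun_conf2[OF bspec[OF less.prems that]] .
  show ?case
  proof (cases "length w \<le> card (states W) ^ card I")
    case True
    then have "\<exists>w'. length w' \<le> card (states W) ^ card I \<and> (\<forall>i\<in>I. crun w' (x i) (act \<one> (z i)))"
      using less.prems zc by (intro exI[of _ w]) simp
    then show ?thesis by blast
  next
    case False
    have "\<exists>\<tau>. \<tau> 0 = x i \<and> \<tau> (length w) = z i \<and>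
        (\<forall>s t. s \<le> t \<longrightarrow> t \<le> length w \<longrightarrow> crun (take (t - s) (drop s w)) (\<tau> s) (\<tau> t))" if "i \<in> I" for i
      using crun_trace[OF bspec[OF less.prems that]] by metis
    then obtain \<tau> where \<tau>: "\<And>i. i \<in> I \<Longrightarrow> \<tau> i 0 = x i" "\<And>i. i \<in> I \<Longrightarrow> \<tau> i (length w) = z i"
      "\<And>i s t. i \<in> I \<Longrightarrow> s \<le> t \<Longrightarrow> t \<le> length w \<Longrightarrow> crun (take (t - s) (drop s w)) (\<tau> i s) (\<tau> i t)"
      by metis
    have \<tau>c: "\<tau> i t \<in> confs" if "i \<in> I" "t \<le> length w" for i t
      using crun_conf2[OF \<tau>(3)[OF that(1) order.refl that(2)]] .
    \<comment> \<open>The tuple of all current states. Among more than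
      \<open>card (states W) ^ card I\<close> positions two tuples coincide, and between them every
      run of the family loops.\<close>
    define f where "f t = (\<lambda>i\<in>I. fst (\<tau> i t))" for t
    have "f ` {..length w} \<subseteq> I \<rightarrow>\<^sub>E states W"
      using \<tau>c unfolding f_def by fastforce
    then have "card (f ` {..length w}) \<le> card (I \<rightarrow>\<^sub>E states W)"
      by (intro card_mono finite_PiE assms(1) finite_states)
    also have "\<dots> = card (states W) ^ card I"
      using assms(1) by (simp add: card_PiE)
    finally have "\<not> inj_on f {..length w}"
      using False by (intro pigeonhole) simp
    then obtain s t where st: "s < t" "t \<le> length w" "f s = f t"
      unfolding inj_on_def by (metis atMost_iff linorder_neqE_nat)
    define c where "c i = snd (\<tau> i t) \<otimes> inv (snd (\<tau> i s))" for i
    have c: "c i \<in> carrier G" "act (c i) (\<tau> i s) = \<tau> i t" if "i \<in> I" for i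
    proof -
      have "fst (\<tau> i s) = fst (\<tau> i t)" using st(3) that unfolding f_def by (metis restrict_apply')
      moreover have "snd (\<tau> i s) \<in> carrier G" "snd (\<tau> i t) \<in> carrier G"
        using \<tau>c[OF that, of s] \<tau>c[OF that, of t] st by auto
      ultimately show "c i \<in> carrier G" "act (c i) (\<tau> i s) = \<tau> i t"
        by (auto simp: c_def act_def m_assoc prod_eq_iff)
    qed
    have runs: "crun (take s w) (x i) (\<tau> i s)" "crun (take (t - s) (drop s w)) (\<tau> i s) (\<tau> i t)"
      "crun (drop t w) (\<tau> i t) (z i)" if "i \<in> I" for i
      using \<tau>(3)[OF that, of 0 s] \<tau>(3)[OF that, of s t] \<tau>(3)[OF that, of t "length w"]
        \<tau>(1,2)[OF that] st by simp_all
    show ?thesis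
    proof (cases "\<exists>i\<in>I. \<exists>j\<in>I. c i \<noteq> c j")
      case True
      have "\<forall>i\<in>I. c i \<in> carrier G \<and> crun (take s w) (x i) (\<tau> i s) \<and>
        crun (take (t - s) (drop s w)) (\<tau> i s) (act (c i) (\<tau> i s)) \<and>
        crun (drop t w) (act (c i) (\<tau> i s)) (act \<one> (z i))"
        using c runs zc by simp
      with True show ?thesis by (intro disjI2 bexI[of _ \<one>] exI conjI) auto
    next
      case False
      \<comment> \<open>The common factor of the loop; the empty family takes \<open>\<one>\<close>
        by default.\<close>
      obtain g where g: "g \<in> carrier G" "\<And>i. i \<in> I \<Longrightarrow> c i = g"
      proof (cases "I = {}")
        case False
        then obtain i where "i \<in> I" by blast
        then show ?thesis using that[of "c i"] c \<open>\<not> (\<exists>i\<in>I. \<exists>j\<in>I. c i \<noteq> c j)\<close> by blast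
      qed (use that[of \<one>] in simp)
      \<comment> \<open>Once the loop is cut, the rest of each run is its old rest translated back
        by the common factor.\<close>
      have "crun (take s w @ drop t w) (x i) (act (inv g) (z i))" if "i \<in> I" for i
      proof -
        have "act (inv g) (\<tau> i t) = \<tau> i s"
          using c(2)[OF that] g \<tau>c[OF that, of s] st that by (metis act_inv(1) less_imp_le le_trans)
        with crun_act[OF _ runs(3)[OF that], of "inv g"] g(1)
        have "crun (drop t w) (\<tau> i s) (act (inv g) (z i))" by simp
        with runs(1)[OF that] show ?thesis by (rule crun_appendI)
      qed
      then have short: "\<forall>i\<in>I. crun (take s w @ drop t w) (x i) (act (inv g) (z i))" ..
      have len: "length (take s w @ drop t w) < length w" using st by simp
      have aa: "act h (act (inv g) (z i)) = act (h \<otimes> inv g) (z i)" if "h \<in> carrier G" "i \<in> I" for h i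
        using act_act[OF that(1) _ zc[OF that(2)], of "inv g"] g(1) by simp
      from less.hyps[OF len short] show ?thesis
      proof (elim disjE bexE exE conjE)
        fix h w' assume h: "h \<in> carrier G" "length w' \<le> card (states W) ^ card I"
          "\<forall>i\<in>I. crun w' (x i) (act h (act (inv g) (z i)))"
        then show ?thesis using aa[OF h(1)] g(1)
          by (intro disjI1 bexI[of _ "h \<otimes> inv g"] exI[of _ w']) auto
      next
        fix h u v s r c i j
        assume h: "h \<in> carrier G" "\<forall>i\<in>I. c i \<in> carrier G \<and> crun u (x i) (r i) \<and>
          crun v (r i) (act (c i) (r i)) \<and> crun s (act (c i) (r i)) (act h (act (inv g) (z i)))"
          "i \<in> I" "j \<in> I" "c i \<noteq> c j"
        then have "\<forall>i\<in>I. c i \<in> carrier G \<and> crun u (x i) (r i) \<and>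
          crun v (r i) (act (c i) (r i)) \<and> crun s (act (c i) (r i)) (act (h \<otimes> inv g) (z i))"
          using aa[OF h(1)] by simp
        with h(3-5) show ?thesis using h(1) g(1)
          by (intro disjI2 bexI[of _ "h \<otimes> inv g"] exI conjI) auto
      qed
    qed
  qed
qed

text \<open>If all loops can be cut, distances are those after a word of length at most
  \<open>card (states W) ^ card I\<close>, because cutting only translates the family. Otherwise a
  loop with two different factors separates the runs sharing the factor of \<open>i0\<close> from
  the remaining ones, and separation numbers add up.\<close>

lemma close_or_split:
  fixes x z :: "'i \<Rightarrow> 'q \<times> 'g"
  assumes "finite I" and run: "\<forall>i\<in>I. crun w (x i) (z i)"
  shows "(\<forall>i\<in>I. \<forall>j\<in>I. cdist (snd (z i)) (snd (z j)) \<le>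
      cdist (snd (x i)) (snd (x j)) + 2 * max_weight * card (states W) ^ card I) \<or>
    (\<exists>I1 I2. I1 \<union> I2 = I \<and> I1 \<inter> I2 = {} \<and> I1 \<noteq> {} \<and> I2 \<noteq> {} \<and>
      (\<forall>m1 m2. sep (z ` I1) m1 \<longrightarrow> sep (z ` I2) m2 \<longrightarrow> sep (x ` I) (m1 + m2)))"
proof -
  have zc: "z i \<in> confs" if "i \<in> I" for i using crun_conf2[OF bspec[OF run that]] .
  show ?thesis using cut_loops[of I w x z, OF assms]
  proof (elim disjE bexE exE conjE)
    fix g w' assume g: "g \<in> carrier G" "length w' \<le> card (states W) ^ card I"
      "\<forall>i\<in>I. crun w' (x i) (act g (z i))"
    have "cdist (snd (z i)) (snd (z j)) \<le>
      cdist (snd (x i)) (snd (x j)) + 2 * max_weight * card (states W) ^ card I"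
      if "i \<in> I" "j \<in> I" for i j
    proof -
      have "snd (z i) \<in> carrier G" "snd (z j) \<in> carrier G" using zc[OF that(1)] zc[OF that(2)] by auto
      then have "cdist (snd (z i)) (snd (z j)) = cdist (snd (act g (z i))) (snd (act g (z j)))"
        using g(1) by simp
      also have "\<dots> \<le> cdist (snd (x i)) (snd (x j)) + 2 * max_weight * length w'"
        by (rule crun_pair_cdist) (use g that in auto)
      also have "\<dots> \<le> cdist (snd (x i)) (snd (x j)) + 2 * max_weight * card (states W) ^ card I"
        using g(2) by simp
      finally show ?thesis .
    qed
    then show ?thesis by blast
  next
    fix g u v s r c i0 j0
    assume g: "g \<in> carrier G" and fam: "\<forall>i\<in>I. c i \<in> carrier G \<and> crun u (x i) (r i) \<and>
      crun v (r i) (act (c i) (r i)) \<and> crun s (act (c i) (r i)) (act g (z i))"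
      and ij: "i0 \<in> I" "j0 \<in> I" "c i0 \<noteq> c j0"
    \<comment> \<open>The configuration after one round of the loop. The suffix \<open>s\<close>
      leads from it to the end, and the translated loop is still available there.\<close>
    define y where "y i = act (c i) (r i)" for i
    define I1 where "I1 = {i \<in> I. c i = c i0}"
    define I2 where "I2 = {i \<in> I. c i \<noteq> c i0}"
    have "sep (x ` I) (m1 + m2)" if m: "sep (z ` I1) m1" "sep (z ` I2) m2" for m1 m2
    proof -
      have lift: "sep (y ` J) m" if "sep (z ` J) m" "J \<subseteq> I" for J m
      proof -
        have "act g ` z ` J \<subseteq> post s (y ` J)"
          using fam that(2) unfolding post_def y_def by blast
        with sep_act[OF that(1) g] show ?thesis by (rule sep_post)
      qed
      have reach: "y ` J \<subseteq> post (u @ v) (x ` I)" if "J \<subseteq> I" for J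
        using fam that unfolding post_def y_def crun_append by blast
      have loop: "crun v (y i) (act (c i) (y i))" if "i \<in> I" for i
        unfolding y_def using fam that crun_act by blast
      have sub: "I1 \<subseteq> I" "I2 \<subseteq> I" unfolding I1_def I2_def by auto
      show ?thesis
      proof (rule sep.split[OF lift[OF m(1) sub(1)] lift[OF m(2) sub(2)] reach[OF sub(1)] reach[OF sub(2)]])
        show "\<forall>d\<in>y ` I1. \<exists>g\<in>c ` I1. crun v d (act g d)" using loop sub(1) by blast
        show "\<forall>d\<in>y ` I2. \<exists>g\<in>c ` I2. crun v d (act g d)" using loop sub(2) by blast
        show "c ` I1 \<subseteq> carrier G" "c ` I2 \<subseteq> carrier G" using fam sub by blast+
        show "c ` I1 \<inter> c ` I2 = {}" unfolding I1_def I2_def by auto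
      qed
    qed
    moreover have "I1 \<union> I2 = I" "I1 \<inter> I2 = {}" "i0 \<in> I1" "j0 \<in> I2"
      using ij unfolding I1_def I2_def by auto
    ultimately show ?thesis by blast
  qed
qed

text \<open>The family is stopped at the first position where its diameter exceeds
  \<open>N1\<close>. There the first alternative of \<open>close_or_split\<close> fails, so the
  family splits, while the diameter exceeds \<open>N1\<close> by one letter at most; the induction
  hypothesis then applies to both parts.\<close>

lemma far_family_sep:
  "0 < m \<Longrightarrow> \<exists>N. \<forall>(I :: ('q \<times> 'g) set) x z w. finite I \<longrightarrow> card I = m \<longrightarrow>
    (\<forall>i\<in>I. \<forall>j\<in>I. cdist (snd (x i)) (snd (x j)) \<le> D) \<longrightarrow>
    (\<forall>i\<in>I. crun w (x i) (z i)) \<longrightarrow>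
    (\<forall>i\<in>I. \<forall>j\<in>I. i \<noteq> j \<longrightarrow> N < cdist (snd (z i)) (snd (z j))) \<longrightarrow> sep (x ` I) m"
proof (induction m arbitrary: D rule: less_induct)
  case (less m)
  \<comment> \<open>The bound in the first alternative of \<open>close_or_split\<close> for
    \<open>m\<close> runs starting within \<open>D\<close>.\<close>
  define N1 where "N1 = D + 2 * max_weight * card (states W) ^ m"
  define D' where "D' = N1 + 2 * max_weight"
  have "\<forall>m'. \<exists>N. 0 < m' \<longrightarrow> m' < m \<longrightarrow> (\<forall>(I :: ('q \<times> 'g) set) x z w. finite I \<longrightarrow> card I = m' \<longrightarrow>
    (\<forall>i\<in>I. \<forall>j\<in>I. cdist (snd (x i)) (snd (x j)) \<le> D') \<longrightarrow>
    (\<forall>i\<in>I. crun w (x i) (z i)) \<longrightarrow>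
    (\<forall>i\<in>I. \<forall>j\<in>I. i \<noteq> j \<longrightarrow> N < cdist (snd (z i)) (snd (z j))) \<longrightarrow> sep (x ` I) m')"
    using less.IH[of _ D'] by blast
  from choice[OF this] obtain Nf where Nf: "\<And>m' (I :: ('q \<times> 'g) set) x z w.
    0 < m' \<Longrightarrow> m' < m \<Longrightarrow> finite I \<Longrightarrow> card I = m' \<Longrightarrow>
    (\<forall>i\<in>I. \<forall>j\<in>I. cdist (snd (x i)) (snd (x j)) \<le> D') \<Longrightarrow>
    (\<forall>i\<in>I. crun w (x i) (z i)) \<Longrightarrow>
    (\<forall>i\<in>I. \<forall>j\<in>I. i \<noteq> j \<longrightarrow> Nf m' < cdist (snd (z i)) (snd (z j))) \<Longrightarrow> sep (x ` I) m'"
    by metis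
  \<comment> \<open>The summand \<open>N1\<close> forces the diameter above \<open>N1\<close> by the
    end of the word; the sum dominates the thresholds of all smaller families.\<close>
  define N where "N = N1 + (\<Sum>m'<m. Nf m')"
  show ?case
  proof (intro exI[of _ N] allI impI)
    fix I :: "('q \<times> 'g) set" and x z w
    assume I: "finite I" "card I = m" and D: "\<forall>i\<in>I. \<forall>j\<in>I. cdist (snd (x i)) (snd (x j)) \<le> D"
      and run: "\<forall>i\<in>I. crun w (x i) (z i)"
      and far: "\<forall>i\<in>I. \<forall>j\<in>I. i \<noteq> j \<longrightarrow> N < cdist (snd (z i)) (snd (z j))"
    show "sep (x ` I) m"
    proof (cases "m = 1")
      case True
      with I obtain i where "I = {i}" using card_1_singletonE by blast
      with True run crun_conf1 show ?thesis using sep.single[of "x i" "x ` I"] by auto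
    next
      case False
      with less.prems have "2 \<le> card I" using I by simp
      then obtain a b where ab: "a \<in> I" "b \<in> I" "a \<noteq> b"
        by (metis card_le_Suc0_iff_eq I(1) not_less_eq_eq numeral_2_eq_2)
      have "\<exists>\<tau>. \<tau> 0 = x i \<and> \<tau> (length w) = z i \<and>
        (\<forall>s t. s \<le> t \<longrightarrow> t \<le> length w \<longrightarrow> crun (take (t - s) (drop s w)) (\<tau> s) (\<tau> t))" if "i \<in> I" for i
        using run that crun_trace[of w "x i" "z i"] by metis
      then obtain \<tau> where \<tau>: "\<And>i. i \<in> I \<Longrightarrow> \<tau> i 0 = x i" "\<And>i. i \<in> I \<Longrightarrow> \<tau> i (length w) = z i"
        "\<And>i s t. i \<in> I \<Longrightarrow> s \<le> t \<Longrightarrow> t \<le> length w \<Longrightarrow> crun (take (t - s) (drop s w)) (\<tau> i s) (\<tau> i t)"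
        by metis
      define P where "P t \<longleftrightarrow> (\<exists>i\<in>I. \<exists>j\<in>I. N1 < cdist (snd (\<tau> i t)) (snd (\<tau> j t)))" for t
      have Plen: "P (length w)"
        unfolding P_def using far[rule_format, OF ab] ab \<tau>(2)[OF ab(1)] \<tau>(2)[OF ab(2)]
        by (intro bexI[of _ a] bexI[of _ b]) (simp_all add: N_def)
      define t where "t = (LEAST t. P t)"
      have Pt: "P t" unfolding t_def using Plen by (rule LeastI)
      have t_le: "t \<le> length w" unfolding t_def using Plen by (rule Least_le)
      have "cdist (snd (\<tau> i 0)) (snd (\<tau> j 0)) \<le> N1" if "i \<in> I" "j \<in> I" for i j
        using D[rule_format, OF that] \<tau>(1) that by (simp add: N1_def)
      then have "\<not> P 0" unfolding P_def by (meson not_less)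
      with Pt obtain t' where t': "t = Suc t'" by (cases t) auto
      have "\<not> P t'" using not_less_Least[of t' P] t' t_def by auto
      have close: "cdist (snd (\<tau> i t)) (snd (\<tau> j t)) \<le> D'" if "i \<in> I" "j \<in> I" for i j
      proof -
        have "cdist (snd (\<tau> i t)) (snd (\<tau> j t)) \<le> cdist (snd (\<tau> i t')) (snd (\<tau> j t')) +
          2 * max_weight * length (take (t - t') (drop t' w))"
          by (rule crun_pair_cdist; rule \<tau>(3)) (use that t' t_le in auto)
        also have "\<dots> \<le> N1 + 2 * max_weight * 1"
        proof (intro add_mono mult_left_mono)
          show "cdist (snd (\<tau> i t')) (snd (\<tau> j t')) \<le> N1"
            using \<open>\<not> P t'\<close> that unfolding P_def by (meson not_less)
        qed (use t' in auto)
        finally show ?thesis by (simp add: D'_def)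
      qed
      have pre: "crun (take t w) (x i) (\<tau> i t)" and suf: "crun (drop t w) (\<tau> i t) (z i)" if "i \<in> I" for i
        using \<tau>(3)[OF that, of 0 t] \<tau>(3)[OF that, of t "length w"] \<tau>(1,2)[OF that] t_le by simp_all
      have "\<not> (\<forall>i\<in>I. \<forall>j\<in>I. cdist (snd (\<tau> i t)) (snd (\<tau> j t)) \<le>
        cdist (snd (x i)) (snd (x j)) + 2 * max_weight * card (states W) ^ card I)"
      proof
        assume *: "\<forall>i\<in>I. \<forall>j\<in>I. cdist (snd (\<tau> i t)) (snd (\<tau> j t)) \<le>
          cdist (snd (x i)) (snd (x j)) + 2 * max_weight * card (states W) ^ card I"
        have "cdist (snd (\<tau> i t)) (snd (\<tau> j t)) \<le> N1" if "i \<in> I" "j \<in> I" for i j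
          using *[rule_format, OF that] D[rule_format, OF that] I(2) by (simp add: N1_def)
        with Pt show False unfolding P_def by (meson not_less)
      qed
      moreover have "\<forall>i\<in>I. crun (take t w) (x i) (\<tau> i t)" using pre ..
      ultimately obtain I1 I2 where I12:
        "I1 \<union> I2 = I" "I1 \<inter> I2 = {}" "I1 \<noteq> {}" "I2 \<noteq> {}"
        "\<And>m1 m2. sep ((\<lambda>i. \<tau> i t) ` I1) m1 \<Longrightarrow> sep ((\<lambda>i. \<tau> i t) ` I2) m2 \<Longrightarrow> sep (x ` I) (m1 + m2)"
        using close_or_split[OF I(1), of "take t w" x "\<lambda>i. \<tau> i t"] by blast
      have fin: "finite I1" "finite I2" using I12(1) I(1) by auto
      have cards: "card I1 + card I2 = m" using card_Un_disjoint[OF fin I12(2)] I12(1) I(2) by simp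
      have pos: "0 < card I1" "0 < card I2" using fin I12(3,4) by (simp_all add: card_gt_0_iff)
      have "sep ((\<lambda>i. \<tau> i t) ` J) (card J)" if J: "J \<subseteq> I" "0 < card J" "card J < m" for J
      proof (rule Nf[OF J(2,3)])
        show "finite J" using J(1) I(1) finite_subset by blast
        show "\<forall>i\<in>J. \<forall>j\<in>J. cdist (snd (\<tau> i t)) (snd (\<tau> j t)) \<le> D'" using close J(1) by blast
        show "\<forall>i\<in>J. crun (drop t w) (\<tau> i t) (z i)" using suf J(1) by blast
        have "Nf (card J) \<le> N"
          unfolding N_def using member_le_sum[of "card J" "{..<m}" Nf] J(3) by simp
        then show "\<forall>i\<in>J. \<forall>j\<in>J. i \<noteq> j \<longrightarrow> Nf (card J) < cdist (snd (z i)) (snd (z j))"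
          using far J(1) by (meson le_less_trans subsetD)
      qed simp
      from I12(5)[OF this this] cards pos I12(1) show ?thesis by auto
    qed
  qed
qed

text \<open>A largest set of reachable configurations with pairwise distance above \<open>N\<close>
  has at most \<open>k\<close> elements, since \<open>k + 1\<close> of them would give
  \<open>sep S (Suc k)\<close>. By maximality the balls of radius \<open>N\<close> around it cover
  everything reachable.\<close>

lemma card_post_bound:
  "\<exists>M. \<forall>S w. \<not> sep S (Suc k) \<longrightarrow> diam_le D S \<longrightarrow> finite (post w S) \<and> card (post w S) \<le> M"
proof -
  obtain N where N: "\<And>(I :: ('q \<times> 'g) set) x z w. finite I \<Longrightarrow> card I = Suc k \<Longrightarrow>
    (\<forall>i\<in>I. \<forall>j\<in>I. cdist (snd (x i)) (snd (x j)) \<le> D) \<Longrightarrow>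
    (\<forall>i\<in>I. crun w (x i) (z i)) \<Longrightarrow>
    (\<forall>i\<in>I. \<forall>j\<in>I. i \<noteq> j \<longrightarrow> N < cdist (snd (z i)) (snd (z j))) \<Longrightarrow> sep (x ` I) (Suc k)"
    using far_family_sep[of "Suc k" D] by blast
  define B where "B x = {y \<in> carrier G. cdist x y \<le> N}" for x
  have finB: "finite (B x)" if "x \<in> carrier G" for x
    unfolding B_def by (rule finite_cball[OF that])
  \<comment> \<open>Balls of equal radius are translates of each other, so the bound is uniform in
    the centre.\<close>
  have cardB: "card (B x) \<le> card (B \<one>)" if x: "x \<in> carrier G" for x
  proof -
    have "B x \<subseteq> (\<lambda>y. x \<otimes> y) ` B \<one>"
    proof
      fix y assume y: "y \<in> B x"
      then have "inv x \<otimes> y \<in> B \<one>"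
        unfolding B_def using x cdist_mult_right[of x "inv x \<otimes> y"] by simp
      moreover have "y = x \<otimes> (inv x \<otimes> y)" using x y unfolding B_def by simp
      ultimately show "y \<in> (\<lambda>y. x \<otimes> y) ` B \<one>" by blast
    qed
    then show ?thesis using finB[OF one_closed] by (rule surj_card_le[rotated])
  qed
  show ?thesis
  proof (intro exI[of _ "k * (card (states W) * card (B \<one>))"] allI impI)
    fix S w assume sep: "\<not> sep S (Suc k)" and diam: "diam_le D S"
    define far where "far F \<longleftrightarrow> finite F \<and> F \<subseteq> post w S \<and>
      (\<forall>i\<in>F. \<forall>j\<in>F. i \<noteq> j \<longrightarrow> N < cdist (snd i) (snd j))" for F
    have far_le: "card F \<le> k" if "far F" for F
    proof (rule ccontr)
      assume "\<not> card F \<le> k"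
      then obtain F' where F': "F' \<subseteq> F" "card F' = Suc k" "finite F'"
        using obtain_subset_with_card_n[of "Suc k" F] by (metis not_less_eq_eq)
      have "\<forall>c\<in>F'. \<exists>d\<in>S. crun w d c" using F'(1) that unfolding far_def post_def by blast
      then obtain x where x: "\<And>c. c \<in> F' \<Longrightarrow> x c \<in> S" "\<And>c. c \<in> F' \<Longrightarrow> crun w (x c) c" by metis
      have "\<forall>i\<in>F'. \<forall>j\<in>F'. i \<noteq> j \<longrightarrow> N < cdist (snd i) (snd j)"
        using F'(1) that unfolding far_def by (meson subsetD)
      moreover have "\<forall>i\<in>F'. \<forall>j\<in>F'. cdist (snd (x i)) (snd (x j)) \<le> D"
        using x(1) diam unfolding diam_le_def by blast
      ultimately have "sep (x ` F') (Suc k)"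
        using x(2) by (intro N[OF F'(3,2), of x w "\<lambda>c. c"]) blast+
      then have "sep S (Suc k)" by (rule sep_mono) (use x in auto)
      with sep show False ..
    qed
    have "far {}" by (simp add: far_def)
    moreover have "\<forall>F. far F \<longrightarrow> card F < Suc k" using far_le by (simp add: less_Suc_eq_le)
    ultimately have "\<exists>F. far F \<and> (\<forall>F'. far F' \<longrightarrow> card F' \<le> card F)"
      by (rule ex_has_greatest_nat)
    then obtain F where F: "far F" "\<And>F'. far F' \<Longrightarrow> card F' \<le> card F" by auto
    have Fc: "snd f \<in> carrier G" if "f \<in> F" for f
    proof -
      have "f \<in> confs" using F(1) that post_confs unfolding far_def by blast
      then show ?thesis by auto
    qed
    have cover: "post w S \<subseteq> (\<Union>f\<in>F. states W \<times> B (snd f))"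
    proof
      fix c assume c: "c \<in> post w S"
      then have cc: "c \<in> confs" using post_confs by blast
      have "\<exists>f\<in>F. cdist (snd f) (snd c) \<le> N"
      proof (rule ccontr)
        assume "\<not> (\<exists>f\<in>F. cdist (snd f) (snd c) \<le> N)"
        then have *: "N < cdist (snd f) (snd c)" if "f \<in> F" for f using that by auto
        then have "c \<notin> F" by (metis cdist_refl not_less_zero)
        have "N < cdist (snd c) (snd f)" if "f \<in> F" for f
          using *[OF that] cdist_commute[OF Fc[OF that], of "snd c"] cc by auto
        moreover have "finite F" "F \<subseteq> post w S"
          and "\<And>i j. i \<in> F \<Longrightarrow> j \<in> F \<Longrightarrow> i \<noteq> j \<Longrightarrow> N < cdist (snd i) (snd j)"
          using F(1) unfolding far_def by auto
        ultimately have "far (insert c F)"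
          unfolding far_def using * c by simp
        from F(2)[OF this] \<open>c \<notin> F\<close> F(1) show False unfolding far_def by simp
      qed
      with cc show "c \<in> (\<Union>f\<in>F. states W \<times> B (snd f))" unfolding B_def by force
    qed
    have finF: "finite F" using F(1) by (simp add: far_def)
    have fin: "finite (\<Union>f\<in>F. states W \<times> B (snd f))"
      using finF finB[OF Fc] finite_states by simp
    have "card (post w S) \<le> card (\<Union>f\<in>F. states W \<times> B (snd f))"
      by (rule card_mono[OF fin cover])
    also have "\<dots> \<le> (\<Sum>f\<in>F. card (states W \<times> B (snd f)))" by (rule card_UN_le[OF finF])
    also have "\<dots> \<le> (\<Sum>f\<in>F. card (states W) * card (B \<one>))"
      using cardB[OF Fc] by (intro sum_mono) (simp add: card_cartesian_product)
    also have "\<dots> \<le> k * (card (states W) * card (B \<one>))" using far_le[OF F(1)] by simp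
    finally show "finite (post w S) \<and> card (post w S) \<le> k * (card (states W) * card (B \<one>))"
      using finite_subset[OF cover fin] by blast
  qed
qed

text \<open>The family is \<open>post w S\<close> itself, each element with a chosen origin in
  \<open>S\<close>; \<open>card_post_bound\<close> bounds its size independently of
  \<open>w\<close>. After a split, \<open>h1\<close> is the largest separation number of the first
  part, and what remains of \<open>h\<close> bounds the second. Both are positive because both parts
  are nonempty.\<close>

lemma diam_or_split:
  "\<exists>N. \<forall>S w. \<not> sep S (Suc h) \<longrightarrow> diam_le D S \<longrightarrow> diam_le N (post w S) \<or>
    (\<exists>S1 S2 h1 h2. post w S = S1 \<union> S2 \<and> h1 + h2 = h \<and> 0 < h1 \<and> 0 < h2 \<and>
      \<not> sep S1 (Suc h1) \<and> \<not> sep S2 (Suc h2))"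
proof -
  obtain M where M: "\<And>S w. \<not> sep S (Suc h) \<Longrightarrow> diam_le D S \<Longrightarrow> finite (post w S)"
    "\<And>S w. \<not> sep S (Suc h) \<Longrightarrow> diam_le D S \<Longrightarrow> card (post w S) \<le> M"
    using card_post_bound[of h D] by blast
  show ?thesis
  \<comment> \<open>The \<open>Suc\<close> makes the base positive, so that the power is monotone in
    the exponent.\<close>
  proof (intro exI[of _ "D + 2 * max_weight * Suc (card (states W)) ^ M"] allI impI)
    fix S w assume sep: "\<not> sep S (Suc h)" and diam: "diam_le D S"
    define I where "I = post w S"
    have "\<forall>c\<in>I. \<exists>d\<in>S. crun w d c" unfolding I_def post_def by blast
    then obtain x where x: "\<And>c. c \<in> I \<Longrightarrow> x c \<in> S" "\<And>c. c \<in> I \<Longrightarrow> crun w (x c) c" by metis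
    have fin: "finite I" and card: "card I \<le> M" using M[OF sep diam] unfolding I_def by auto
    have "card (states W) ^ card I \<le> Suc (card (states W)) ^ card I" by (rule power_mono) auto
    also have "\<dots> \<le> Suc (card (states W)) ^ M" by (rule power_increasing[OF card]) simp
    finally have pow: "card (states W) ^ card I \<le> Suc (card (states W)) ^ M" .
    have "\<forall>c\<in>I. crun w (x c) c" using x(2) ..
    from close_or_split[of I w x "\<lambda>c. c", OF fin this] show "diam_le (D + 2 * max_weight * Suc (card (states W)) ^ M) (post w S) \<or>
      (\<exists>S1 S2 h1 h2. post w S = S1 \<union> S2 \<and> h1 + h2 = h \<and> 0 < h1 \<and> 0 < h2 \<and>
      \<not> sep S1 (Suc h1) \<and> \<not> sep S2 (Suc h2))"
    proof (elim disjE exE conjE)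
      assume *: "\<forall>i\<in>I. \<forall>j\<in>I. cdist (snd i) (snd j) \<le>
        cdist (snd (x i)) (snd (x j)) + 2 * max_weight * card (states W) ^ card I"
      have "diam_le (D + 2 * max_weight * Suc (card (states W)) ^ M) I"
        unfolding diam_le_def
      proof (intro ballI)
        fix i j assume ij: "i \<in> I" "j \<in> I"
        have "cdist (snd i) (snd j) \<le> cdist (snd (x i)) (snd (x j)) + 2 * max_weight * card (states W) ^ card I"
          using * ij by blast
        also have "\<dots> \<le> D + 2 * max_weight * Suc (card (states W)) ^ M"
          using diam x(1)[OF ij(1)] x(1)[OF ij(2)] pow unfolding diam_le_def
          by (intro add_mono mult_left_mono) auto
        finally show "cdist (snd i) (snd j) \<le> D + 2 * max_weight * Suc (card (states W)) ^ M" .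
      qed
      then show ?thesis unfolding I_def ..
    next
      fix I1 I2 assume I12: "I1 \<union> I2 = I" "I1 \<inter> I2 = {}" "I1 \<noteq> {}" "I2 \<noteq> {}"
        "\<forall>m1 m2. sep ((\<lambda>c. c) ` I1) m1 \<longrightarrow> sep ((\<lambda>c. c) ` I2) m2 \<longrightarrow> sep (x ` I) (m1 + m2)"
      have add: "sep S (m1 + m2)" if "sep I1 m1" "sep I2 m2" for m1 m2
      proof -
        have "x ` I \<subseteq> S" using x(1) by blast
        moreover have "sep (x ` I) (m1 + m2)" using I12(5) that by simp
        ultimately show ?thesis using sep_mono by blast
      qed
      have "I1 \<subseteq> confs" "I2 \<subseteq> confs" using I12(1) post_confs[of w S] unfolding I_def by (metis Un_subset_iff)+
      then have one: "sep I1 1" "sep I2 1" using I12(3,4) sep.single by blast+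
      have bound: "m1 + m2 \<le> h" if "sep I1 m1" "sep I2 m2" for m1 m2
        using sep_le[OF add[OF that], of "Suc h"] sep by (meson not_less_eq_eq zero_less_Suc)
      define h1 where "h1 = (GREATEST m. sep I1 m)"
      have b1: "\<forall>m. sep I1 m \<longrightarrow> m \<le> h" using bound[OF _ one(2)] by fastforce
      have h1: "sep I1 h1" unfolding h1_def 
        by (rule GreatestI_nat[of "sep I1" 1 h]) (use b1 one(1) in blast)+
      have "m \<le> h1" if "sep I1 m" for m
        unfolding h1_def by (rule Greatest_le_nat[of "sep I1" m h]) (use b1 that in blast)+
      then have n1: "\<not> sep I1 (Suc h1)" by (meson Suc_n_not_le_n)
      have pos: "0 < h1" "h1 + 1 \<le> h" using sep_pos[OF h1] bound[OF h1 one(2)] by auto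
      have n2: "\<not> sep I2 (Suc (h - h1))"
        using bound[OF h1, of "Suc (h - h1)"] pos by auto
      have "post w S = I1 \<union> I2" using I12(1) unfolding I_def by simp
      moreover have "h1 + (h - h1) = h" "0 < h - h1" using pos by auto
      ultimately show ?thesis using pos(1) n1 n2 by blast
    qed
  qed
qed

section \<open>Systems of blocks closed under reading a letter\<close>

lemma diam_le_post: "diam_le D S \<Longrightarrow> diam_le (D + 2 * max_weight * length w) (post w S)"
  unfolding diam_le_def
proof (intro ballI)
  fix c' d' assume diam: "\<forall>c\<in>S. \<forall>d\<in>S. cdist (snd c) (snd d) \<le> D" and "c' \<in> post w S" "d' \<in> post w S"
  then obtain c d where "c \<in> S" "crun w c c'" "d \<in> S" "crun w d d'" unfolding post_def by blast
  with crun_pair_cdist[of w c c' d d'] diam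
  show "cdist (snd c') (snd d') \<le> D + 2 * max_weight * length w"
    by (meson add_le_mono1 le_trans)
qed

text \<open>A pair \<open>(h, T)\<close> is a set \<open>T\<close> served by \<open>h\<close> heads.
  Its successor on a letter must again belong to the system, possibly after one division of set and
  heads. Closure under translation will allow passing to representatives.\<close>

definition block_closed :: "(nat \<times> ('q \<times> 'g) set) set \<Rightarrow> nat \<Rightarrow> nat \<Rightarrow> bool" where
  "block_closed \<B> h E \<longleftrightarrow> (\<forall>h' T. (h', T) \<in> \<B> \<longrightarrow> h' \<le> h \<and> (h' = 0 \<longrightarrow> T = {}) \<and> T \<subseteq> confs \<and> diam_le E T \<and>
     (\<forall>g\<in>carrier G. (h', act g ` T) \<in> \<B>) \<and>
     (\<forall>a. (h', post [a] T) \<in> \<B> \<or> (\<exists>h1 h2 T1 T2. (h1, T1) \<in> \<B> \<and> (h2, T2) \<in> \<B> \<and>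
        h1 + h2 = h' \<and> post [a] T = T1 \<union> T2)))"

text \<open>
  Every split lowers the number of heads, so the diameter has to be re-estimated only finitely often.
\<close>

lemma block_system:
  "\<exists>E \<B>. block_closed \<B> h E \<and>
    (\<forall>S. S \<subseteq> confs \<longrightarrow> \<not> sep S (Suc h) \<longrightarrow> diam_le D S \<longrightarrow> (h, S) \<in> \<B>)"
proof (induction h arbitrary: D rule: less_induct)
  case (less h)
  obtain N where N: "\<And>S w. \<not> sep S (Suc h) \<Longrightarrow> diam_le D S \<Longrightarrow> diam_le N (post w S) \<or>
    (\<exists>S1 S2 h1 h2. post w S = S1 \<union> S2 \<and> h1 + h2 = h \<and> 0 < h1 \<and> 0 < h2 \<and>
      \<not> sep S1 (Suc h1) \<and> \<not> sep S2 (Suc h2))"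
    using diam_or_split[of h D] by blast
  \<comment> \<open>The maximum takes care of the empty word, where \<open>post w S\<close> is
    \<open>S\<close> itself.\<close>
  define N' where "N' = max N D"
  \<comment> \<open>Diameter one letter beyond a set of diameter \<open>N'\<close>: when the set
    splits, both parts satisfy this bound, and the systems for fewer heads start from it.\<close>
  define D' where "D' = N' + 2 * max_weight"
  have "\<forall>h'. \<exists>E. \<exists>\<B>. h' < h \<longrightarrow> block_closed \<B> h' E \<and>
    (\<forall>S. S \<subseteq> confs \<longrightarrow> \<not> sep S (Suc h') \<longrightarrow> diam_le D' S \<longrightarrow> (h', S) \<in> \<B>)"
    using less.IH[of _ D'] by blast
  then obtain E' \<B>' where F: "\<And>h'. h' < h \<Longrightarrow> block_closed (\<B>' h') h' (E' h')"
    "\<And>h' S. h' < h \<Longrightarrow> S \<subseteq> confs \<Longrightarrow> \<not> sep S (Suc h') \<Longrightarrow> diam_le D' S \<Longrightarrow> (h', S) \<in> \<B>' h'"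
    by metis
  define E where "E = N' + (\<Sum>h'<h. E' h')"
  \<comment> \<open>Each set keeps its origin \<open>S\<close> of diameter \<open>D\<close>. The
    estimate for a longer word starts from \<open>S\<close> again, so nothing accumulates along the
    word.\<close>
  define \<B>0 where "\<B>0 = {(h', T). h' = h \<and> (\<exists>S w. S \<subseteq> confs \<and> \<not> sep S (Suc h) \<and> diam_le D S \<and>
    T = post w S \<and> diam_le N' T)}"
  define \<B> where "\<B> = \<B>0 \<union> (\<Union>h'<h. \<B>' h')"
  have closed: "h' \<le> h \<and> (h' = 0 \<longrightarrow> T = {}) \<and> T \<subseteq> confs \<and> diam_le E T \<and> (\<forall>g\<in>carrier G. (h', act g ` T) \<in> \<B>) \<and>
     (\<forall>a. (h', post [a] T) \<in> \<B> \<or> (\<exists>h1 h2 T1 T2. (h1, T1) \<in> \<B> \<and> (h2, T2) \<in> \<B> \<and>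
        h1 + h2 = h' \<and> post [a] T = T1 \<union> T2))" if hT: "(h', T) \<in> \<B>" for h' T
  proof -
    from hT consider "(h', T) \<in> \<B>0" | h0 where "h0 < h" "(h', T) \<in> \<B>' h0"
      unfolding \<B>_def by auto
    then show ?thesis
    proof cases
      case 1
      then obtain S w where S: "h' = h" "S \<subseteq> confs" "\<not> sep S (Suc h)" "diam_le D S"
        "T = post w S" "diam_le N' T" unfolding \<B>0_def by blast
      show ?thesis
      proof (intro conjI ballI allI)
        show "h' \<le> h" "T \<subseteq> confs" "diam_le E T"
          using S post_confs unfolding E_def by (auto intro: diam_le_mono)
      next
        \<comment> \<open>Any configuration in \<open>S\<close> would give
          \<open>sep S 1\<close>.\<close>
        show "h' = 0 \<longrightarrow> T = {}"
          using S(1,2,3) sep.single unfolding S(5) post_def by fastforce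
      next
        fix g assume g: "g \<in> carrier G"
        have "act g ` S \<subseteq> confs \<and> \<not> sep (act g ` S) (Suc h) \<and> diam_le D (act g ` S) \<and>
          act g ` T = post w (act g ` S) \<and> diam_le N' (act g ` T)"
          using S g post_confs by (simp add: sep_act_iff diam_le_act post_act act_image_confs)
        then show "(h', act g ` T) \<in> \<B>" unfolding \<B>_def \<B>0_def S(1) by blast
      next
        fix a
        have eq: "post [a] T = post (w @ [a]) S" unfolding S(5) post_append ..
        from N[OF S(3,4), of "w @ [a]"]
        show "(h', post [a] T) \<in> \<B> \<or> (\<exists>h1 h2 T1 T2. (h1, T1) \<in> \<B> \<and> (h2, T2) \<in> \<B> \<and>
          h1 + h2 = h' \<and> post [a] T = T1 \<union> T2)"
        proof (elim disjE exE conjE)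
          assume "diam_le N (post (w @ [a]) S)"
          then have "diam_le N' (post [a] T)" unfolding eq N'_def by (rule diam_le_mono) simp
          with S(1-4) eq have "(h', post [a] T) \<in> \<B>0" unfolding \<B>0_def by blast
          then show ?thesis unfolding \<B>_def by blast
        next
          fix S1 S2 h1 h2 assume split: "post (w @ [a]) S = S1 \<union> S2" "h1 + h2 = h" "0 < h1" "0 < h2"
            "\<not> sep S1 (Suc h1)" "\<not> sep S2 (Suc h2)"
          have D': "diam_le D' (post [a] T)"
            using diam_le_post[OF S(6), of "[a]"] unfolding D'_def by simp
          have lower: "(h'', T') \<in> \<B>" if "T' \<subseteq> post [a] T" "h'' < h" "\<not> sep T' (Suc h'')" for h'' T'
          proof -
            have "T' \<subseteq> confs" "diam_le D' T'" using that(1) post_confs diam_le_subset[OF D'] by auto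
            from F(2)[OF that(2) this(1) that(3) this(2)] show ?thesis unfolding \<B>_def using that(2) by blast
          qed
          have "(h1, S1) \<in> \<B>" by (rule lower) (use split eq in auto)
          moreover have "(h2, S2) \<in> \<B>" by (rule lower) (use split eq in auto)
          ultimately show ?thesis using split(1,2) unfolding eq S(1) by blast
        qed
      qed
    next
      case 2
      have sub: "\<B>' h0 \<subseteq> \<B>" unfolding \<B>_def using 2(1) by blast
      have "E' h0 \<le> E" unfolding E_def using member_le_sum[of h0 "{..<h}" E'] 2(1) by simp
      note bc = F(1)[OF 2(1), unfolded block_closed_def, rule_format, OF 2(2)]
      show ?thesis
      proof (intro conjI ballI allI)
        show "h' \<le> h" "T \<subseteq> confs" using bc 2(1) by simp_all
        show "h' = 0 \<longrightarrow> T = {}" using bc by blast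
        show "diam_le E T" using bc diam_le_mono \<open>E' h0 \<le> E\<close> by blast
        show "(h', act g ` T) \<in> \<B>" if "g \<in> carrier G" for g using bc that sub by blast
        show "(h', post [a] T) \<in> \<B> \<or> (\<exists>h1 h2 T1 T2. (h1, T1) \<in> \<B> \<and> (h2, T2) \<in> \<B> \<and>
          h1 + h2 = h' \<and> post [a] T = T1 \<union> T2)" for a
        proof -
          from bc have "(h', post [a] T) \<in> \<B>' h0 \<or> (\<exists>h1 h2 T1 T2. (h1, T1) \<in> \<B>' h0 \<and>
            (h2, T2) \<in> \<B>' h0 \<and> h1 + h2 = h' \<and> post [a] T = T1 \<union> T2)" by blast
          then show ?thesis
          proof (elim disjE exE conjE)
            fix h1 h2 T1 T2 assume "(h1, T1) \<in> \<B>' h0" "(h2, T2) \<in> \<B>' h0" "h1 + h2 = h'"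
              "post [a] T = T1 \<union> T2"
            with sub show ?thesis by (intro disjI2 exI[of _ h1] exI[of _ h2] exI[of _ T1] exI[of _ T2]) auto
          qed (use sub in blast)
        qed
      qed
    qed
  qed
  have "(h, S) \<in> \<B>" if S: "S \<subseteq> confs" "\<not> sep S (Suc h)" "diam_le D S" for S
  proof -
    have "S = post [] S" "diam_le N' S"
      using post_Nil[OF S(1)] diam_le_mono[OF S(3), of N'] unfolding N'_def by simp_all
    with S have "(h, S) \<in> \<B>0" unfolding \<B>0_def by blast
    then show ?thesis unfolding \<B>_def by blast
  qed
  moreover have "block_closed \<B> h E" unfolding block_closed_def using closed by simp
  ultimately show ?case by blast
qed

text \<open>A nonempty block is translated so that one of its values becomes \<open>\<one>\<close>.
  Bounded diameter then confines it to a fixed ball, which leaves finitely many representatives. The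
  elements \<open>x\<close> record the translations and become the outputs of the edges.\<close>

lemma finite_block_system:
  assumes "\<not> sep (t_init W) (Suc k)"
  shows "\<exists>\<F>. finite \<F> \<and> (k, t_init W) \<in> \<F> \<and> (\<forall>(h, T)\<in>\<F>. finite T \<and> T \<subseteq> confs \<and> (h = 0 \<longrightarrow> T = {}) \<and>
    (\<forall>a. \<exists>xs. (\<forall>(x, h', T')\<in>set xs. x \<in> carrier G \<and> (h', T') \<in> \<F>) \<and>
      sum_list (map (fst \<circ> snd) xs) = h \<and> post [a] T = (\<Union>(x, h', T')\<in>set xs. act x ` T')))"
proof -
  obtain D where D: "diam_le D (t_init W)" using diam_le_finite[OF finite_t_init] by blast
  obtain E \<B> where closed: "block_closed \<B> k E"
    and init_block: "\<And>S. S \<subseteq> confs \<Longrightarrow> \<not> sep S (Suc k) \<Longrightarrow> diam_le D S \<Longrightarrow> (k, S) \<in> \<B>"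
    using block_system[of k D] by blast
  note \<B> = closed[unfolded block_closed_def, rule_format]
  \<comment> \<open>The initial set is kept untranslated, hence the second summand.\<close>
  define E' where "E' = E + Max (insert 0 ((\<lambda>c. cdist \<one> (snd c)) ` t_init W))"
  define B where "B = {y \<in> carrier G. cdist \<one> y \<le> E'}"
  define \<F> where "\<F> = {(h, T) \<in> \<B>. T \<subseteq> states W \<times> B}"
  have finB: "finite (states W \<times> B)"
    unfolding B_def by (intro finite_cartesian_product finite_states finite_cball) simp
  have "\<F> \<subseteq> {..k} \<times> Pow (states W \<times> B)" unfolding \<F>_def using \<B> by fastforce
  then have fin: "finite \<F>" by (rule finite_subset) (use finB in simp)
  have "t_init W \<subseteq> states W \<times> B"
  proof
    fix c assume c: "c \<in> t_init W"
    then have "cdist \<one> (snd c) \<le> Max (insert 0 ((\<lambda>c. cdist \<one> (snd c)) ` t_init W))"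
      using finite_t_init by (intro Max_ge) auto
    then have "cdist \<one> (snd c) \<le> E'" unfolding E'_def by simp
    with c t_init_confs show "c \<in> states W \<times> B" unfolding B_def by auto
  qed
  then have init: "(k, t_init W) \<in> \<F>"
    unfolding \<F>_def using init_block[OF t_init_confs assms D] by blast
  have norm: "\<exists>x T'. x \<in> carrier G \<and> (h, T') \<in> \<F> \<and> T = act x ` T'" if hT: "(h, T) \<in> \<B>" for h T
  proof (cases "T = {}")
    case True
    with hT show ?thesis unfolding \<F>_def by (intro exI[of _ \<one>] exI[of _ "{}"]) auto
  next
    case False
    then obtain c where c: "c \<in> T" by blast
    have T: "T \<subseteq> confs" "diam_le E T" using \<B>[OF hT] by auto
    define x where "x = snd c"
    have x: "x \<in> carrier G" using c T(1) unfolding x_def by auto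
    have "act (inv x) ` T \<subseteq> states W \<times> B"
    proof
      fix e assume "e \<in> act (inv x) ` T"
      then obtain d where d: "d \<in> T" "e = act (inv x) d" by blast
      have dc: "snd d \<in> carrier G" "fst d \<in> states W" using T(1) d(1) by auto
      have "cdist \<one> (inv x \<otimes> snd d) = cdist x (snd d)"
        using cdist_mult_right[of x "inv x \<otimes> snd d"] x dc by simp
      also have "\<dots> \<le> E'" using T(2) c d(1) unfolding diam_le_def x_def E'_def by (simp add: trans_le_add1)
      finally show "e \<in> states W \<times> B" using d dc x unfolding B_def by (auto simp: act_def)
    qed
    then have "(h, act (inv x) ` T) \<in> \<F>" unfolding \<F>_def using \<B>[OF hT] x by simp
    moreover have "T = act x ` act (inv x) ` T" using act_image_inv(1)[OF x T(1)] by simp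
    ultimately show ?thesis using x by blast
  qed
  have step: "finite T \<and> T \<subseteq> confs \<and> (h = 0 \<longrightarrow> T = {}) \<and>
    (\<forall>a. \<exists>xs. (\<forall>(x, h', T')\<in>set xs. x \<in> carrier G \<and> (h', T') \<in> \<F>) \<and>
      sum_list (map (fst \<circ> snd) xs) = h \<and> post [a] T = (\<Union>(x, h', T')\<in>set xs. act x ` T'))"
    if hT: "(h, T) \<in> \<F>" for h T
  proof (intro conjI allI)
    have hTB: "(h, T) \<in> \<B>" using hT unfolding \<F>_def by blast
    show "finite T" using hT finite_subset[OF _ finB] unfolding \<F>_def by blast
    show "T \<subseteq> confs" using \<B>[OF hTB] by blast
    show "h = 0 \<longrightarrow> T = {}" using \<B>[OF hTB] by blast
    fix a
    have "(h, post [a] T) \<in> \<B> \<or>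
      (\<exists>h1 h2 T1 T2. (h1, T1) \<in> \<B> \<and> (h2, T2) \<in> \<B> \<and> h1 + h2 = h \<and> post [a] T = T1 \<union> T2)"
      using \<B>[OF hTB] by blast
    then show "\<exists>xs. (\<forall>(x, h', T')\<in>set xs. x \<in> carrier G \<and> (h', T') \<in> \<F>) \<and>
      sum_list (map (fst \<circ> snd) xs) = h \<and> post [a] T = (\<Union>(x, h', T')\<in>set xs. act x ` T')"
    proof (elim disjE exE conjE)
      assume "(h, post [a] T) \<in> \<B>"
      then obtain x T' where "x \<in> carrier G" "(h, T') \<in> \<F>" "post [a] T = act x ` T'"
        using norm by blast
      then show ?thesis by (intro exI[of _ "[(x, h, T')]"]) simp
    next
      fix h1 h2 T1 T2 assume s: "(h1, T1) \<in> \<B>" "(h2, T2) \<in> \<B>" "h1 + h2 = h" "post [a] T = T1 \<union> T2"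
      obtain x1 T1' where "x1 \<in> carrier G" "(h1, T1') \<in> \<F>" "T1 = act x1 ` T1'" using norm[OF s(1)] by blast
      moreover obtain x2 T2' where "x2 \<in> carrier G" "(h2, T2') \<in> \<F>" "T2 = act x2 ` T2'"
        using norm[OF s(2)] by blast
      ultimately show ?thesis using s
        by (intro exI[of _ "[(x1, h1, T1'), (x2, h2, T2')]"]) simp
    qed
  qed
  have "case p of (h, T) \<Rightarrow> finite T \<and> T \<subseteq> confs \<and> (h = 0 \<longrightarrow> T = {}) \<and>
    (\<forall>a. \<exists>xs. (\<forall>(x, h', T')\<in>set xs. x \<in> carrier G \<and> (h', T') \<in> \<F>) \<and>
      sum_list (map (fst \<circ> snd) xs) = h \<and> post [a] T = (\<Union>(x, h', T')\<in>set xs. act x ` T'))"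
    if "p \<in> \<F>" for p
  proof (cases p)
    case (Pair h T)
    show ?thesis unfolding Pair prod.case by (rule step) (use that Pair in simp)
  qed
  with fin init show ?thesis by (intro exI[of _ \<F>] conjI ballI)
qed

end

section \<open>Lipschitz property of sequential automata\<close>

context group_automaton
begin

lemma accepts_cdist:
  assumes "accepts c w z"
  shows "cdist (snd c) z \<le> max_weight * (length w + 1)"
proof -
  obtain d \<phi> where d: "crun w c d" "(fst d, \<phi>) \<in> t_final W" "z = snd d \<otimes> \<phi>"
    using assms unfolding accepts_def by blast
  have c: "snd c \<in> carrier G" "snd d \<in> carrier G" "\<phi> \<in> carrier G"
    using crun_conf1[OF d(1)] crun_conf2[OF d(1)] d(2) t_final_confs by auto
  have "cdist (snd c) z \<le> cdist (snd c) (snd d) + cdist (snd d) (snd d \<otimes> \<phi>)"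
    unfolding d(3) by (intro cdist_triangle) (use c in auto)
  also have "\<dots> \<le> max_weight * length w + max_weight"
    using crun_cdist[OF d(1)] max_weight_final[OF d(2)] c by (simp add: cdist_mult_right add_mono)
  finally show ?thesis by simp
qed

lemma crun_deterministic:
  assumes "sequential W" and "crun w c d" and "crun w c d'"
  shows "d = d'"
  using assms(2,3)
proof (induction w arbitrary: c)
  case (Cons a w)
  then obtain \<alpha> q \<beta> r where "(fst c, a, \<alpha>, q) \<in> transitions W" "crun w (q, snd c \<otimes> \<alpha>) d"
    "(fst c, a, \<beta>, r) \<in> transitions W" "crun w (r, snd c \<otimes> \<beta>) d'" by auto
  moreover from this have "\<alpha> = \<beta> \<and> q = r" using assms(1) unfolding sequential_def by blast
  ultimately show ?case using Cons.IH by blast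
qed simp

text \<open>After the longest common prefix both runs are in one configuration \<open>d\<close>.
  Only the remaining suffixes, of total length \<open>word_dist w w'\<close>, and the two final
  weights contribute.\<close>

lemma sequential_cdist:
  assumes "sequential W" and "(w, z) \<in> computed_relation G W" and "(w', z') \<in> computed_relation G W"
  shows "cdist z z' \<le> 2 * max_weight * (word_dist w w' + 1)"
proof -
  obtain c where init: "t_init W = {c}"
    using assms(1) unfolding sequential_def by (meson card_1_singletonE)
  define p where "p = longest_common_prefix w w'"
  obtain u u' where u: "w = p @ u" "w' = p @ u'"
    unfolding p_def using longest_common_prefix_prefix1 longest_common_prefix_prefix2 by (metis prefixE)
  have len: "word_dist w w' = length u + length u'"
    unfolding word_dist_def p_def[symmetric] using u by simp
  have "accepts c w z" "accepts c w' z'" using assms(2,3) init unfolding computed_relation_iff by auto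
  then obtain d d' where d: "crun p c d" "accepts d u z" "crun p c d'" "accepts d' u' z'"
    unfolding u accepts_append_iff by blast
  then have "d = d'" using crun_deterministic[OF assms(1)] by blast
  with d have acc: "accepts d u z" "accepts d u' z'" by simp_all
  have c: "snd d \<in> carrier G" "z \<in> carrier G" "z' \<in> carrier G"
    using crun_conf2[OF d(1)] accepts_closed acc by auto
  have "cdist z z' \<le> cdist z (snd d) + cdist (snd d) z'" by (intro cdist_triangle c)
  also have "\<dots> \<le> max_weight * (length u + 1) + max_weight * (length u' + 1)"
    using accepts_cdist[OF acc(1)] accepts_cdist[OF acc(2)] cdist_commute[OF c(2,1)] by simp
  also have "\<dots> \<le> 2 * max_weight * (word_dist w w' + 1)"
    unfolding len by (simp add: algebra_simps)
  finally show ?thesis .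
qed

end

section \<open>Disjoint unions of automata\<close>

lemma path_in_component:
  assumes "disjoint_family_on (\<lambda>i. states (V i)) {..<k}"
    and "transitions W = (\<Union>i<k. transitions (V i))"
    and wa: "\<And>i. i < k \<Longrightarrow> weighted_automaton A M (V i)"
    and "i < k" and "p \<in> states (V i)" and "path W p ts q"
  shows "path (V i) p ts q"
  using assms(5,6)
proof (induction ts arbitrary: p)
  case Nil
  then show ?case by simp
next
  case (Cons t ts)
  obtain p' a \<alpha> r where t: "t = (p', a, \<alpha>, r)" by (cases t)
  with Cons.prems have tr: "p' = p" "(p, a, \<alpha>, r) \<in> transitions W" "path W r ts q" by auto
  then obtain j where j: "j < k" "(p, a, \<alpha>, r) \<in> transitions (V j)" using assms(2) by auto
  with wa[OF j(1)] have "p \<in> states (V j)" "r \<in> states (V j)" unfolding weighted_automaton_def by auto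
  with Cons.prems(1) j(1) assms(1,4) have "j = i" unfolding disjoint_family_on_def by fastforce
  with j \<open>r \<in> states (V j)\<close> tr Cons.IH[of r] t show ?case by auto
qed

text \<open>Disjointness of the state sets keeps a run in the component where it starts and forces
  the final weight to come from there as well.\<close>

lemma computed_relation_component:
  assumes "disjoint_family_on (\<lambda>i. states (V i)) {..<k}"
    and "t_init W = (\<Union>i<k. t_init (V i))"
    and "t_final W = (\<Union>i<k. t_final (V i))"
    and "transitions W = (\<Union>i<k. transitions (V i))"
    and wa: "\<And>i. i < k \<Longrightarrow> weighted_automaton A M (V i)"
    and "(w, z) \<in> computed_relation M W"
  shows "\<exists>i<k. (w, z) \<in> computed_relation M (V i)"
proof -
  obtain \<alpha> \<beta> \<gamma> p q where r: "z = \<alpha> \<otimes>\<^bsub>M\<^esub> \<beta> \<otimes>\<^bsub>M\<^esub> \<gamma>" "(p, \<alpha>) \<in> t_init W" "run M W p w \<beta> q"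
    "(q, \<gamma>) \<in> t_final W" using assms(6) unfolding computed_relation_def by auto
  then obtain ts where ts: "path W p ts q" "path_word ts = w" "path_output M ts = \<beta>"
    unfolding run_def by blast
  obtain i where i: "i < k" "(p, \<alpha>) \<in> t_init (V i)" using r(2) assms(2) by auto
  have p: "p \<in> states (V i)" using wa[OF i(1)] i(2) unfolding weighted_automaton_def by auto
  have path: "path (V i) p ts q" by (rule path_in_component[OF assms(1,4) wa i(1) p ts(1)])
  have "q \<in> states (V i)" using path p wa[OF i(1)]
  proof (induction ts arbitrary: p)
    case (Cons t ts)
    then show ?case unfolding weighted_automaton_def by (cases t) auto
  qed simp
  moreover obtain j where j: "j < k" "(q, \<gamma>) \<in> t_final (V j)" using r(4) assms(3) by auto
  moreover have "q \<in> states (V j)" using wa[OF j(1)] j(2) unfolding weighted_automaton_def by auto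
  ultimately have "j = i" using i(1) assms(1) unfolding disjoint_family_on_def by fastforce
  with j(2) i r(1) path ts(2,3) show ?thesis
    unfolding computed_relation_def run_def by blast
qed

lemma (in generated_group) k_sequential_imp_lipschitz:
  assumes "k_sequential A G k W"
  shows "lipschitz_property G \<Gamma> k (computed_relation G W)"
proof -
  obtain V where seq: "\<forall>i<k. weighted_automaton A G (V i) \<and> sequential (V i)" and union:
    "disjoint_family_on (\<lambda>i. states (V i)) {..<k}" "t_init W = (\<Union>i<k. t_init (V i))"
    "t_final W = (\<Union>i<k. t_final (V i))" "transitions W = (\<Union>i<k. transitions (V i))"
    using assms unfolding k_sequential_def by (elim exE conjE)
  have V: "weighted_automaton A G (V i)" "sequential (V i)" if "i < k" for i
    using seq that by simp_all
  have "\<forall>i. \<exists>L. i < k \<longrightarrow> (\<forall>w z w' z'. (w, z) \<in> computed_relation G (V i) \<longrightarrow>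
    (w', z') \<in> computed_relation G (V i) \<longrightarrow> cdist z z' \<le> L * (word_dist w w' + 1))"
  proof (intro allI)
    fix i
    show "\<exists>L. i < k \<longrightarrow> (\<forall>w z w' z'. (w, z) \<in> computed_relation G (V i) \<longrightarrow>
      (w', z') \<in> computed_relation G (V i) \<longrightarrow> cdist z z' \<le> L * (word_dist w w' + 1))"
    proof (cases "i < k")
      case True
      interpret V: group_automaton G \<Gamma> A "V i" by unfold_locales (rule V(1)[OF True])
      show ?thesis using V.sequential_cdist[OF V(2)[OF True]] by blast
    qed simp
  qed
  from choice[OF this] obtain L where L: "\<And>i w z w' z'. i < k \<Longrightarrow> (w, z) \<in> computed_relation G (V i) \<Longrightarrow>
    (w', z') \<in> computed_relation G (V i) \<Longrightarrow> cdist z z' \<le> L i * (word_dist w w' + 1)" by blast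
  show ?thesis
    unfolding lipschitz_property_def
  proof (rule exI[of _ "\<Sum>i<k. L i"], intro allI impI)
    fix w \<alpha>
    assume "\<forall>i\<le>k. (w i, \<alpha> i) \<in> computed_relation G W"
    then have "\<forall>i\<in>{..k}. \<exists>m<k. (w i, \<alpha> i) \<in> computed_relation G (V m)"
      using computed_relation_component[OF union V(1)] by blast
    then obtain f where f: "\<And>i. i \<le> k \<Longrightarrow> f i < k" "\<And>i. i \<le> k \<Longrightarrow> (w i, \<alpha> i) \<in> computed_relation G (V (f i))"
      by (metis atMost_iff)
    have "f ` {..k} \<subseteq> {..<k}" using f(1) by auto
    then have "card (f ` {..k}) \<le> k" using card_mono[of "{..<k}"] by fastforce
    then have "\<not> inj_on f {..k}" by (intro pigeonhole) simp
    then obtain i j where ij: "i < j" "j \<le> k" "f i = f j"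
      unfolding inj_on_def by (metis atMost_iff linorder_neqE_nat)
    have "cdist (\<alpha> i) (\<alpha> j) \<le> L (f i) * (word_dist (w i) (w j) + 1)"
      using L[of "f i" "w i" "\<alpha> i" "w j" "\<alpha> j"] f[of i] f[of j] ij by simp
    also have "\<dots> \<le> (\<Sum>i<k. L i) * (word_dist (w i) (w j) + 1)"
      using member_le_sum[of "f i" "{..<k}" L] f(1)[of i] ij by (intro mult_right_mono) simp_all
    finally show "\<exists>i j. i < j \<and> j \<le> k \<and> cdist (\<alpha> i) (\<alpha> j) \<le> (\<Sum>i<k. L i) * (word_dist (w i) (w j) + 1)"
      using ij by blast
  qed
qed

section \<open>Block automata\<close>

text \<open>
  A block \<open>b\<close> stands for the finite set \<open>T b\<close> of configurations, up to left translation, and serves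
  \<open>hds b\<close> heads. The edge \<open>(b, a, i, x, b')\<close> sends heads \<open>i, i + 1, \<dots>\<close> of \<open>b\<close> to the heads of
  \<open>b'\<close>, with output \<open>x\<close>. The \<open>i\<close>-th sequential component follows head \<open>i\<close> of the root.
\<close>

locale block_automaton = group_automaton G \<Gamma> A W
  for G :: "('g, 'b) monoid_scheme" (structure) and \<Gamma> and A :: "'a set" and W :: "('q, 'a, 'g) automaton" +
  fixes Bl :: "'c set" and root :: 'c and hds :: "'c \<Rightarrow> nat" and T :: "'c \<Rightarrow> ('q \<times> 'g) set"
    and Ed :: "('c \<times> 'a \<times> nat \<times> 'g \<times> 'c) set" and st :: "nat \<Rightarrow> 'c \<Rightarrow> nat \<Rightarrow> 's"
  assumes fin_Bl: "finite Bl" and fin_Ed: "finite Ed"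
    and root: "root \<in> Bl" "T root = t_init W"
    and T: "b \<in> Bl \<Longrightarrow> T b \<subseteq> confs" "b \<in> Bl \<Longrightarrow> finite (T b)" "b \<in> Bl \<Longrightarrow> hds b = 0 \<Longrightarrow> T b = {}"
    and Ed: "(b, a, i, x, b') \<in> Ed \<Longrightarrow> b \<in> Bl \<and> a \<in> A \<and> i + hds b' \<le> hds b \<and> x \<in> carrier G \<and> b' \<in> Bl"
    and Ed_disjoint: "(b, a, i, x, b') \<in> Ed \<Longrightarrow> (b, a, j, y, b'') \<in> Ed \<Longrightarrow> p < hds b' \<Longrightarrow> p' < hds b'' \<Longrightarrow>
      i + p = j + p' \<Longrightarrow> x = y \<and> b' = b'' \<and> p = p'"
    and Ed_sound: "(b, a, i, x, b') \<in> Ed \<Longrightarrow> act x ` T b' \<subseteq> post [a] (T b)"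
    and Ed_complete: "b \<in> Bl \<Longrightarrow> c \<in> post [a] (T b) \<Longrightarrow> \<exists>i x b'. (b, a, i, x, b') \<in> Ed \<and> c \<in> act x ` T b'"
    and st_inj: "st i b p = st i' b' p' \<Longrightarrow> i = i' \<and> b = b' \<and> p = p'"
begin

text \<open>The state \<open>st i b p\<close> is head \<open>p\<close> of block \<open>b\<close> in
  copy \<open>i\<close>. The copies differ only in the label \<open>i\<close> and in the head of the
  root at which they start. The final weight \<open>\<delta> \<otimes> \<phi>\<close> supplies the
  offset \<open>\<delta>\<close> of the configuration within its block, which the transitions have
  not yet output.\<close>

definition component :: "nat \<Rightarrow> ('s, 'a, 'g) automaton" where
  "component i = \<lparr>states = {st i b p | b p. b \<in> Bl \<and> p < hds b},
     t_init = {(st i root i, \<one>)},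
     t_final = {(st i b p, \<delta> \<otimes> \<phi>) | b p q \<delta> \<phi>.
       b \<in> Bl \<and> p < hds b \<and> (q, \<delta>) \<in> T b \<and> (q, \<phi>) \<in> t_final W},
     transitions = {(st i b (j + p), a, x, st i b' p) | b a j x b' p. (b, a, j, x, b') \<in> Ed \<and> p < hds b'}\<rparr>"

definition automaton :: "('s, 'a, 'g) automaton" where
  "automaton = \<lparr>states = (\<Union>i<hds root. states (component i)), t_init = (\<Union>i<hds root. t_init (component i)),
     t_final = (\<Union>i<hds root. t_final (component i)), transitions = (\<Union>i<hds root. transitions (component i))\<rparr>"

lemma component_final:
  "(s, z) \<in> t_final (component i) \<longleftrightarrow>
    (\<exists>b p q \<delta> \<phi>. b \<in> Bl \<and> p < hds b \<and> (q, \<delta>) \<in> T b \<and> (q, \<phi>) \<in> t_final W \<and> s = st i b p \<and> z = \<delta> \<otimes> \<phi>)"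
  unfolding component_def by simp blast

lemma component_transition:
  "(s, a, x, s') \<in> transitions (component i) \<longleftrightarrow>
    (\<exists>b j b' p. (b, a, j, x, b') \<in> Ed \<and> p < hds b' \<and> s = st i b (j + p) \<and> s' = st i b' p)"
  unfolding component_def by simp blast

lemma component_state: "s \<in> states (component i) \<longleftrightarrow> (\<exists>b\<in>Bl. \<exists>p<hds b. s = st i b p)"
  unfolding component_def by auto

lemma component_wa:
  assumes "i < hds root"
  shows "weighted_automaton A G (component i)"
  unfolding weighted_automaton_def
proof (intro conjI)
  have "states (component i) = (\<Union>b\<in>Bl. st i b ` {..<hds b})"
    unfolding component_def by auto
  then show "finite (states (component i))" using fin_Bl by simp
  show "finite (t_init (component i))" by (simp add: component_def)
  have "t_final (component i) \<subseteq> (\<lambda>(b, p, (q, \<delta>), (q', \<phi>)). (st i b p, \<delta> \<otimes> \<phi>)) `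
    (SIGMA b:Bl. {..<hds b} \<times> T b \<times> t_final W)"
    unfolding component_def by force
  then show "finite (t_final (component i))"
    by (rule finite_surj[rotated]) (use fin_Bl T(2) finite_t_final in auto)
  have "transitions (component i) \<subseteq> (\<lambda>((b, a, j, x, b'), p). (st i b (j + p), a, x, st i b' p)) `
    (SIGMA e:Ed. {..<hds (snd (snd (snd (snd e))))})"
    unfolding component_def by force
  then show "finite (transitions (component i))"
    by (rule finite_surj[rotated]) (use fin_Ed in auto)
  show "t_init (component i) \<subseteq> states (component i) \<times> carrier G"
    using root(1) assms unfolding component_def by auto
  show "t_final (component i) \<subseteq> states (component i) \<times> carrier G"
  proof (rule subrelI)
    fix s z assume "(s, z) \<in> t_final (component i)"
    then obtain b p q \<delta> \<phi> where b: "b \<in> Bl" "p < hds b" "(q, \<delta>) \<in> T b" "(q, \<phi>) \<in> t_final W"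
      "s = st i b p" "z = \<delta> \<otimes> \<phi>" unfolding component_final by blast
    then have "\<delta> \<in> carrier G" "\<phi> \<in> carrier G" using T(1) t_final_confs by auto
    with b show "(s, z) \<in> states (component i) \<times> carrier G" by (auto simp: component_state)
  qed
  show "transitions (component i) \<subseteq> states (component i) \<times> A \<times> carrier G \<times> states (component i)"
  proof (rule subrelI)
    fix s t assume st: "(s, t) \<in> transitions (component i)"
    obtain a x s' where t: "t = (a, x, s')" by (cases t)
    with st obtain b j b' p where e: "(b, a, j, x, b') \<in> Ed" "p < hds b'" "s = st i b (j + p)" "s' = st i b' p"
      unfolding t component_transition by blast
    moreover have "j + p < hds b" using Ed[OF e(1)] e(2) by simp
    ultimately have "s \<in> states (component i) \<and> a \<in> A \<and> x \<in> carrier G \<and> s' \<in> states (component i)"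
      using Ed[OF e(1)] unfolding component_state by blast
    then show "(s, t) \<in> states (component i) \<times> A \<times> carrier G \<times> states (component i)"
      using t by simp
  qed
qed

text \<open>By \<open>Ed_disjoint\<close> the edges of a block on one letter serve disjoint
  intervals of heads, so each head has at most one successor.\<close>

lemma component_sequential: "sequential (component i)"
  unfolding sequential_def
proof (intro conjI allI impI)
  show "card (t_init (component i)) = 1" by (simp add: component_def)
  fix s a x s' y s''
  assume "(s, a, x, s') \<in> transitions (component i) \<and> (s, a, y, s'') \<in> transitions (component i)"
  then obtain b j b' p b2 j2 b2' p2 where "(b, a, j, x, b') \<in> Ed" "p < hds b'" "s = st i b (j + p)"
    "s' = st i b' p" "(b2, a, j2, y, b2') \<in> Ed" "p2 < hds b2'" "s = st i b2 (j2 + p2)" "s'' = st i b2' p2"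
    unfolding component_transition by blast
  moreover from this have "b = b2" "j + p = j2 + p2" using st_inj by metis+
  ultimately show "x = y" "s' = s''" using Ed_disjoint by blast+
qed

lemma k_sequential_automaton: "k_sequential A G (hds root) automaton"
  unfolding k_sequential_def
proof (intro exI[of _ component] conjI allI impI)
  show "disjoint_family_on (\<lambda>i. states (component i)) {..<hds root}"
    unfolding disjoint_family_on_def using st_inj by (auto simp: component_state)
qed (simp_all add: component_wa component_sequential automaton_def)

lemma automaton_wa: "weighted_automaton A G automaton"
proof -
  have "finite (states (component i)) \<and> finite (t_init (component i)) \<and> finite (t_final (component i)) \<and>
    finite (transitions (component i)) \<and>
    t_init (component i) \<subseteq> states automaton \<times> carrier G \<and> t_final (component i) \<subseteq> states automaton \<times> carrier G \<and>
    transitions (component i) \<subseteq> states automaton \<times> A \<times> carrier G \<times> states automaton" if "i < hds root" for i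
  proof -
    have "states (component i) \<subseteq> states automaton" using that unfolding automaton_def by auto
    with component_wa[OF that] show ?thesis unfolding weighted_automaton_def by blast
  qed
  then show ?thesis
    unfolding weighted_automaton_def
    by (simp add: automaton_def UN_subset_iff)
qed

sublocale V: group_automaton G \<Gamma> A automaton
  by unfold_locales (rule automaton_wa)

lemma automaton_transition:
  "(s, a, x, s') \<in> transitions automaton \<longleftrightarrow>
    (\<exists>i<hds root. \<exists>b j b' p. (b, a, j, x, b') \<in> Ed \<and> p < hds b' \<and> s = st i b (j + p) \<and> s' = st i b' p)"
  by (simp add: automaton_def component_transition Bex_def)

lemma automaton_state: "s \<in> states automaton \<longleftrightarrow> (\<exists>i<hds root. \<exists>b\<in>Bl. \<exists>p<hds b. s = st i b p)"
  by (simp add: automaton_def component_state Bex_def)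

lemma automaton_final:
  "(s, z) \<in> t_final automaton \<longleftrightarrow> (\<exists>i<hds root. \<exists>b p q \<delta> \<phi>. b \<in> Bl \<and> p < hds b \<and> (q, \<delta>) \<in> T b \<and>
     (q, \<phi>) \<in> t_final W \<and> s = st i b p \<and> z = \<delta> \<otimes> \<phi>)"
  by (simp add: automaton_def component_final Bex_def)

lemma automaton_init: "c \<in> t_init automaton \<longleftrightarrow> (\<exists>i<hds root. c = (st i root i, \<one>))"
  by (auto simp: automaton_def component_def)

text \<open>Whichever head is followed, the current block, translated by the output so far, contains
  only reachable configurations, by \<open>Ed_sound\<close> at each letter.\<close>

lemma run_sound:
  assumes "V.crun w (st i b p, \<eta>) d" and "b \<in> Bl"
  shows "\<exists>b' p'. b' \<in> Bl \<and> fst d = st i b' p' \<and> act (snd d) ` T b' \<subseteq> post w (act \<eta> ` T b)"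
  using assms
proof (induction w arbitrary: b p \<eta>)
  case Nil
  then have "act \<eta> ` T b \<subseteq> confs" using T(1) by (intro act_image_confs) auto
  with Nil show ?case by (intro exI[of _ b] exI[of _ p]) (auto simp: post_Nil)
next
  case (Cons a w)
  then obtain x s where x: "(st i b p, a, x, s) \<in> transitions automaton" "V.crun w (s, \<eta> \<otimes> x) d"
    "\<eta> \<in> carrier G" by auto
  then obtain b1 j b' p0 where "(b1, a, j, x, b') \<in> Ed" "p0 < hds b'" "st i b p = st i b1 (j + p0)"
    "s = st i b' p0" unfolding automaton_transition using st_inj by metis
  then have e: "(b, a, j, x, b') \<in> Ed" "p0 < hds b'" "s = st i b' p0" using st_inj by metis+
  have b': "b' \<in> Bl" "x \<in> carrier G" using Ed[OF e(1)] by auto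
  from x(2) e(3) have "V.crun w (st i b' p0, \<eta> \<otimes> x) d" by simp
  from Cons.IH[OF this b'(1)] obtain b'' p'' where IH: "b'' \<in> Bl" "fst d = st i b'' p''"
    "act (snd d) ` T b'' \<subseteq> post w (act (\<eta> \<otimes> x) ` T b')" by blast
  have "act (\<eta> \<otimes> x) ` T b' = act \<eta> ` act x ` T b'"
    using act_act[OF x(3) b'(2)] T(1)[OF b'(1)] by (force simp: image_image)
  also have "\<dots> \<subseteq> act \<eta> ` post [a] (T b)" using Ed_sound[OF e(1)] by blast
  also have "\<dots> = post [a] (act \<eta> ` T b)" using post_act[OF x(3) T(1)[OF Cons.prems(2)]] by simp
  finally have "post w (act (\<eta> \<otimes> x) ` T b') \<subseteq> post w (post [a] (act \<eta> ` T b))" by (rule post_mono)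
  with IH show ?case using post_append[of "[a]" w] by auto
qed

text \<open>The head is found from the end of the word backwards: a head \<open>p\<close> of
  \<open>b'\<close> covering the rest becomes head \<open>j + p\<close> of \<open>b\<close>. The
  statement covers all copies \<open>i\<close> at once, so that the copy starting at the resulting
  head of the root can be taken.\<close>

lemma run_complete:
  assumes "c \<in> post w (act \<eta> ` T b)" and "b \<in> Bl" and "\<eta> \<in> carrier G"
  shows "\<exists>p<hds b. \<exists>b'\<in>Bl. \<exists>p'<hds b'. \<exists>\<eta>'\<in>carrier G. c \<in> act \<eta>' ` T b' \<and>
    (\<forall>i<hds root. V.crun w (st i b p, \<eta>) (st i b' p', \<eta>'))"
  using assms
proof (induction w arbitrary: b \<eta>)
  case Nil
  have "act \<eta> ` T b \<subseteq> confs" using Nil T(1) by (intro act_image_confs) auto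
  with Nil have c: "c \<in> act \<eta> ` T b" by (simp add: post_Nil)
  \<comment> \<open>A block without heads is empty, but this one contains a translate of
    \<open>c\<close>; head 0 can be followed.\<close>
  then have "0 < hds b" using T(3) Nil.prems(2) by auto
  moreover have "\<forall>i<hds root. V.crun [] (st i b 0, \<eta>) (st i b 0, \<eta>)"
    using Nil.prems \<open>0 < hds b\<close> by (auto simp: automaton_state)
  ultimately show ?case using c Nil.prems by blast
next
  case (Cons a w)
  have "c \<in> post w (post [a] (act \<eta> ` T b))" using Cons.prems(1) post_append[of "[a]" w] by simp
  then have "c \<in> post w (act \<eta> ` post [a] (T b))" using post_act Cons.prems T(1) by simp
  then obtain d where d: "d \<in> post [a] (T b)" "crun w (act \<eta> d) c" unfolding post_def by blast
  from Ed_complete[OF Cons.prems(2) d(1)] obtain j x b' where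
    e: "(b, a, j, x, b') \<in> Ed" "d \<in> act x ` T b'" by blast
  have b': "b' \<in> Bl" "x \<in> carrier G" "j + hds b' \<le> hds b" using Ed[OF e(1)] by auto
  have "act \<eta> d \<in> act (\<eta> \<otimes> x) ` T b'"
    using e(2) act_act[OF Cons.prems(3) b'(2)] T(1)[OF b'(1)] by (auto simp del: mem_Times_iff)
  with d(2) have "c \<in> post w (act (\<eta> \<otimes> x) ` T b')" unfolding post_def by blast
  from Cons.IH[OF this b'(1)] b'(2) Cons.prems(3) obtain p b'' p' \<eta>' where IH: "p < hds b'" "b'' \<in> Bl"
    "p' < hds b''" "\<eta>' \<in> carrier G" "c \<in> act \<eta>' ` T b''"
    "\<forall>i<hds root. V.crun w (st i b' p, \<eta> \<otimes> x) (st i b'' p', \<eta>')" by auto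
  have "V.crun (a # w) (st i b (j + p), \<eta>) (st i b'' p', \<eta>')" if i: "i < hds root" for i
  proof -
    have "(st i b (j + p), a, x, st i b' p) \<in> transitions automaton"
      unfolding automaton_transition using i e(1) IH(1) by blast
    moreover have "st i b (j + p) \<in> states automaton"
      unfolding automaton_state using i Cons.prems(2) b'(3) IH(1) by (metis add_less_mono1 add.commute less_le_trans)
    ultimately show ?thesis using IH(6) i Cons.prems(3) by auto
  qed
  moreover have "j + p < hds b" using b'(3) IH(1) by simp
  ultimately show ?case using IH by blast
qed

lemma computed_relation_automaton: "computed_relation G automaton = computed_relation G W"
proof -
  have one: "act \<one> ` t_init W = t_init W" using t_init_confs by (force simp del: mem_Times_iff)
  have "(w, z) \<in> computed_relation G automaton \<longleftrightarrow> (w, z) \<in> computed_relation G W" for w z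
  proof
    assume "(w, z) \<in> computed_relation G automaton"
    then obtain i d \<phi>' where d: "i < hds root" "V.crun w (st i root i, \<one>) d" "(fst d, \<phi>') \<in> t_final automaton"
      "z = snd d \<otimes> \<phi>'"
      unfolding V.computed_relation_iff V.accepts_def by (auto simp: automaton_init)
    from run_sound[OF d(2) root(1)] one root(2) obtain b p where b: "b \<in> Bl" "fst d = st i b p"
      "act (snd d) ` T b \<subseteq> post w (t_init W)" by auto
    obtain i' b' p' q \<delta> \<phi> where f: "b' \<in> Bl" "(q, \<delta>) \<in> T b'" "(q, \<phi>) \<in> t_final W" "fst d = st i' b' p'"
      "\<phi>' = \<delta> \<otimes> \<phi>" using d(3) unfolding automaton_final by blast
    have "b' = b" using f(4) b(2) st_inj by metis
    with f(2) b(3) have "act (snd d) (q, \<delta>) \<in> post w (t_init W)" by blast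
    then obtain c where c: "c \<in> t_init W" "crun w c (act (snd d) (q, \<delta>))" unfolding post_def by blast
    have "snd d \<in> carrier G" "\<delta> \<in> carrier G" "\<phi> \<in> carrier G"
      using V.crun_conf2[OF d(2)] T(1)[OF f(1)] f(2,3) t_final_confs by auto
    then have "z = snd (act (snd d) (q, \<delta>)) \<otimes> \<phi>" using d(4) f(5) by (simp add: m_assoc)
    with c f(3) have "accepts c w z"
      unfolding accepts_def by (intro exI[of _ "act (snd d) (q, \<delta>)"] exI[of _ \<phi>]) simp
    with c(1) show "(w, z) \<in> computed_relation G W" unfolding computed_relation_iff by blast
  next
    assume "(w, z) \<in> computed_relation G W"
    then obtain c d \<phi> where c: "c \<in> t_init W" "crun w c d" "(fst d, \<phi>) \<in> t_final W" "z = snd d \<otimes> \<phi>"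
      unfolding computed_relation_iff accepts_def by blast
    then have "d \<in> post w (act \<one> ` T root)" unfolding root(2) one post_def by blast
    from run_complete[OF this root(1)] obtain p b p' \<eta> where r: "p < hds root" "b \<in> Bl" "p' < hds b"
      "\<eta> \<in> carrier G" "d \<in> act \<eta> ` T b" "\<forall>i<hds root. V.crun w (st i root p, \<one>) (st i b p', \<eta>)"
      by auto
    from r(5) obtain q \<delta> where q: "(q, \<delta>) \<in> T b" "d = act \<eta> (q, \<delta>)" by auto
    have "(st p b p', \<delta> \<otimes> \<phi>) \<in> t_final automaton"
    proof -
      have "(q, \<phi>) \<in> t_final W" using c(3) q(2) by simp
      then show ?thesis unfolding automaton_final using r(1-3) q(1) by blast
    qed
    moreover have "z = \<eta> \<otimes> (\<delta> \<otimes> \<phi>)"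
    proof -
      have "\<delta> \<in> carrier G" "\<phi> \<in> carrier G" using q(1) T(1)[OF r(2)] c(3) t_final_confs by auto
      then show ?thesis using c(4) q(2) r(4) by (simp add: m_assoc)
    qed
    ultimately have "V.accepts (st p root p, \<one>) w z"
      unfolding V.accepts_def using r(1,6) by (intro exI[of _ "(st p b p', \<eta>)"]) auto
    then show "(w, z) \<in> computed_relation G automaton"
      unfolding V.computed_relation_iff using r(1)
      by (intro bexI[of _ "(st p root p, \<one>)"]) (auto simp: automaton_init intro: exI[of _ p])
  qed
  then show ?thesis by auto
qed

end

section \<open>Renaming states\<close>

definition map_states :: "('q \<Rightarrow> 's) \<Rightarrow> ('q, 'a, 'm) automaton \<Rightarrow> ('s, 'a, 'm) automaton" where
  "map_states \<nu> W = \<lparr>states = \<nu> ` states W, t_init = (\<lambda>(p, \<alpha>). (\<nu> p, \<alpha>)) ` t_init W,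
     t_final = (\<lambda>(p, \<alpha>). (\<nu> p, \<alpha>)) ` t_final W,
     transitions = (\<lambda>(p, a, \<alpha>, q). (\<nu> p, a, \<alpha>, \<nu> q)) ` transitions W\<rparr>"

text \<open>A code describes a copy of \<open>W\<close> with numbers as states. Branching twinning
  and the computed relation have to be carried over to this copy, on which the search
  operates.\<close>

locale renamed_automaton = group_automaton G \<Gamma> A W
  for G :: "('g, 'b) monoid_scheme" (structure) and \<Gamma> and A :: "'a set" and W :: "('q, 'a, 'g) automaton" +
  fixes \<nu> :: "'q \<Rightarrow> 's"
  assumes inj: "inj_on \<nu> (states W)"
begin

lemma map_states_wa: "weighted_automaton A G (map_states \<nu> W)"
  using wa unfolding weighted_automaton_def map_states_def by (auto simp: subset_iff)

sublocale V: group_automaton G \<Gamma> A "map_states \<nu> W"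
  by unfold_locales (rule map_states_wa)

definition rename :: "'q \<times> 'g \<Rightarrow> 's \<times> 'g" where
  "rename c = (\<nu> (fst c), snd c)"

lemma confs_rename: "V.confs = rename ` confs"
  by (force simp: map_states_def rename_def)

lemma rename_inj: "inj_on rename confs"
  using inj by (auto simp: rename_def inj_on_def)

lemma crun_rename:
  assumes "c \<in> confs"
  shows "V.crun w (rename c) d \<longleftrightarrow> (\<exists>c'. d = rename c' \<and> crun w c c')"
  using assms
proof (induction w arbitrary: c)
  case Nil
  then have "rename c \<in> V.confs" unfolding confs_rename by blast
  with Nil show ?case by auto
next
  case (Cons a w)
  have "rename c \<in> V.confs" using Cons.prems unfolding confs_rename by blast
  have trans: "(fst (rename c), a, \<alpha>, s) \<in> transitions (map_states \<nu> W) \<longleftrightarrow>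
    (\<exists>q\<in>states W. s = \<nu> q \<and> (fst c, a, \<alpha>, q) \<in> transitions W)" for \<alpha> s
  proof
    assume "(fst (rename c), a, \<alpha>, s) \<in> transitions (map_states \<nu> W)"
    then obtain p q where pq: "(p, a, \<alpha>, q) \<in> transitions W" "\<nu> p = \<nu> (fst c)" "s = \<nu> q"
      by (auto simp: map_states_def rename_def)
    moreover have "p \<in> states W" "q \<in> states W" using pq(1) transitions_subset by auto
    moreover have "fst c \<in> states W" using Cons.prems by auto
    ultimately show "\<exists>q\<in>states W. s = \<nu> q \<and> (fst c, a, \<alpha>, q) \<in> transitions W"
      using inj by (metis inj_onD)
  next
    assume "\<exists>q\<in>states W. s = \<nu> q \<and> (fst c, a, \<alpha>, q) \<in> transitions W"
    then show "(fst (rename c), a, \<alpha>, s) \<in> transitions (map_states \<nu> W)"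
      by (force simp: map_states_def rename_def)
  qed
  have IH: "V.crun w (\<nu> q, snd c \<otimes> \<alpha>) d \<longleftrightarrow> (\<exists>c'. d = rename c' \<and> crun w (q, snd c \<otimes> \<alpha>) c')"
    if "(fst c, a, \<alpha>, q) \<in> transitions W" for \<alpha> q
  proof -
    have "(q, snd c \<otimes> \<alpha>) \<in> confs" using that transitions_subset Cons.prems by auto
    from Cons.IH[OF this] show ?thesis by (simp add: rename_def)
  qed
  have st: "q \<in> states W" if "(p, a, \<alpha>, q) \<in> transitions W" for p \<alpha> q
    using that transitions_subset by auto
  have snd: "snd (rename c) = snd c" by (simp add: rename_def)
  show ?case
    unfolding V.crun.simps crun.simps trans snd
    using \<open>rename c \<in> V.confs\<close> Cons.prems IH st by blast
qed

lemma t_init_rename: "t_init (map_states \<nu> W) = rename ` t_init W"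
  by (simp add: map_states_def rename_def[abs_def] split_def)

lemma accepts_rename:
  assumes "c \<in> confs"
  shows "V.accepts (rename c) w z \<longleftrightarrow> accepts c w z"
proof -
  have fin: "(\<nu> (fst d), \<phi>) \<in> t_final (map_states \<nu> W) \<longleftrightarrow> (fst d, \<phi>) \<in> t_final W" if "d \<in> confs" for d \<phi>
  proof
    assume "(\<nu> (fst d), \<phi>) \<in> t_final (map_states \<nu> W)"
    then obtain p where p: "(p, \<phi>) \<in> t_final W" "\<nu> p = \<nu> (fst d)" by (auto simp: map_states_def)
    moreover have "p \<in> states W" "fst d \<in> states W" using p(1) that t_final_confs by auto
    ultimately show "(fst d, \<phi>) \<in> t_final W" using inj by (metis inj_onD)
  qed (force simp: map_states_def)
  show ?thesis
  proof
    assume "V.accepts (rename c) w z"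
    then obtain d \<phi> where "crun w c d" "(\<nu> (fst d), \<phi>) \<in> t_final (map_states \<nu> W)" "z = snd d \<otimes> \<phi>"
      unfolding V.accepts_def crun_rename[OF assms] by (auto simp: rename_def)
    with fin crun_conf2 show "accepts c w z" unfolding accepts_def by blast
  next
    assume "accepts c w z"
    then obtain d \<phi> where d: "crun w c d" "(fst d, \<phi>) \<in> t_final W" "z = snd d \<otimes> \<phi>"
      unfolding accepts_def by blast
    then have "(fst (rename d), \<phi>) \<in> t_final (map_states \<nu> W)" "z = snd (rename d) \<otimes> \<phi>"
      using fin[OF crun_conf2[OF d(1)]] by (simp_all add: rename_def)
    with d(1) show "V.accepts (rename c) w z"
      unfolding V.accepts_def crun_rename[OF assms] by blast
  qed
qed

lemma computed_relation_rename: "computed_relation G (map_states \<nu> W) = computed_relation G W"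
proof -
  have "(w, z) \<in> computed_relation G (map_states \<nu> W) \<longleftrightarrow> (w, z) \<in> computed_relation G W" for w z
    unfolding V.computed_relation_iff computed_relation_iff t_init_rename
    using accepts_rename t_init_confs by blast
  then show ?thesis by auto
qed

text \<open>A violating tower of the copy is pulled back along the inverse of \<open>rename\<close>;
  its words and loop factors stay the same.\<close>

lemma branching_twinning_rename:
  assumes "branching_twinning_property G k W"
  shows "branching_twinning_property G k (map_states \<nu> W)"
  unfolding V.branching_twinning_property_iff
proof safe
  fix y u v c
  assume tw: "V.tower k {..k} y u v c" and init: "\<forall>j\<le>k. y 0 j \<in> t_init (map_states \<nu> W)"
    and s: "\<forall>j\<le>k. \<forall>j'\<le>k. j \<noteq> j' \<longrightarrow> V.separated k u v c j j'"
  define x where "x i j = inv_into confs rename (y i j)" for i j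
  have x: "x i j \<in> confs" "y i j = rename (x i j)" if "i \<le> k" "j \<le> k" for i j
  proof -
    have "y i j \<in> rename ` confs" using V.tower_confs[OF tw that(1)] that(2) unfolding confs_rename by simp
    then show "x i j \<in> confs" "y i j = rename (x i j)"
      unfolding x_def by (simp_all only: inv_into_into f_inv_into_f)
  qed
  have run: "crun w (x i j) d" if r: "V.crun w (y i j) (rename d)" "d \<in> confs" and ij: "i \<le> k" "j \<le> k" for w i j d
  proof -
    obtain c' where "rename d = rename c'" "crun w (x i j) c'"
      using r(1) unfolding x(2)[OF ij] crun_rename[OF x(1)[OF ij]] by blast
    moreover from this have "d = c'" using rename_inj r(2) crun_conf2 by (metis inj_onD)
    ultimately show ?thesis by simp
  qed
  have "tower k {..k} x u v c"
    unfolding tower_def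
  proof (intro conjI ballI allI impI)
    fix i j assume i: "i < k" and "j \<in> {..k}"
    then have j: "j \<le> k" by simp
    from tw i j have t: "c i j \<in> carrier G" "V.crun (u i j) (y i j) (y (Suc i) j)"
      "V.crun (v i j) (y (Suc i) j) (V.act (c i j) (y (Suc i) j))" unfolding V.tower_def by auto
    show "c i j \<in> carrier G" by (rule t(1))
    show "crun (u i j) (x i j) (x (Suc i) j)"
      using t(2) x[of "Suc i" j] i j by (intro run) simp_all
    have "V.act (c i j) (y (Suc i) j) = rename (act (c i j) (x (Suc i) j))"
      using x(2)[of "Suc i" j] i j by (simp add: rename_def act_def V.act_def)
    then show "crun (v i j) (x (Suc i) j) (act (c i j) (x (Suc i) j))"
      using t(3) i j x(1)[of "Suc i" j] act_confs[OF t(1)] by (intro run) simp_all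
  qed (use x in auto)
  moreover have "x 0 j \<in> t_init W" if j: "j \<le> k" for j
  proof -
    have "rename (x 0 j) \<in> rename ` t_init W"
      using init[unfolded t_init_rename, rule_format, OF j] x(2)[OF le0 j] by (rule back_subst)
    then obtain d where d: "d \<in> t_init W" "rename (x 0 j) = rename d" by blast
    moreover have "d \<in> confs" using d(1) t_init_confs by blast
    ultimately have "x 0 j = d" using rename_inj x(1)[of 0 j] j by (metis inj_onD le0)
    with d show ?thesis by simp
  qed
  moreover have "separated k u v c j j'" if "j \<le> k" "j' \<le> k" "j \<noteq> j'" for j j'
    using s that unfolding V.separated_def separated_def by blast
  ultimately have "\<exists>y u v c. tower k {..k} y u v c \<and> (\<forall>j\<le>k. y 0 j \<in> t_init W) \<and>
          (\<forall>j\<le>k. \<forall>j'\<le>k. j \<noteq> j' \<longrightarrow> separated k u v c j j')"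
    by - (rule exI[of _ x], rule exI[of _ u], rule exI[of _ v], rule exI[of _ c], simp)
  with assms show False unfolding branching_twinning_property_iff by (rule notE)
qed

end

section \<open>Group words\<close>

text \<open>The letters \<open>2 * i\<close> and \<open>2 * i + 1\<close> denote inverse elements,
  so inverting a word exchanges them and reverses the order.\<close>

definition inverse_word :: "nat list \<Rightarrow> nat list" where
  "inverse_word u = rev (map (\<lambda>x. if even x then Suc x else x - 1) u)"

text \<open>Equality of two elements is triviality of their quotient, a single question to the
  oracle.\<close>

definition word_eq :: "('g, 'b) monoid_scheme \<Rightarrow> 'g list \<Rightarrow> nat list \<Rightarrow> nat list \<Rightarrow> bool" where
  "word_eq G gs u v \<longleftrightarrow> word_problem G gs (code (u @ inverse_word v)) = 1"

locale group_presentation = group G for G (structure) +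
  fixes gs :: "'a list"
  assumes gs: "set gs \<subseteq> carrier G"
begin

abbreviation "ev \<equiv> group_eval G gs"

lemma group_letter_closed: "x < 2 * length gs \<Longrightarrow> group_letter G gs x \<in> carrier G"
  unfolding group_letter_def using gs by (auto simp: subset_iff)

lemma ev_simps [simp]: "ev [] = \<one>" "ev (x # u) = group_letter G gs x \<otimes> ev u"
  by (simp_all add: group_eval_def)

lemma ev_closed: "u \<in> group_words gs \<Longrightarrow> ev u \<in> carrier G"
  unfolding group_words_def by (induction u) (auto simp: group_letter_closed)

lemma group_words_append [simp]: "u @ v \<in> group_words gs \<longleftrightarrow> u \<in> group_words gs \<and> v \<in> group_words gs"
  by (auto simp: group_words_def)

lemma group_words_Nil [simp]: "[] \<in> group_words gs"
  by (simp add: group_words_def)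

lemma ev_append:
  "u \<in> group_words gs \<Longrightarrow> v \<in> group_words gs \<Longrightarrow> ev (u @ v) = ev u \<otimes> ev v"
proof (induction u)
  case (Cons x u)
  then have "group_letter G gs x \<in> carrier G" "u \<in> group_words gs"
    using group_letter_closed by (auto simp: group_words_def)
  with Cons show ?case by (simp add: m_assoc ev_closed)
qed (simp add: ev_closed)

lemma inverse_word_closed: "u \<in> group_words gs \<Longrightarrow> inverse_word u \<in> group_words gs"
proof -
  have "Suc x < 2 * n" if "x < 2 * n" "even x" for x n :: nat
    using that by presburger
  then show "u \<in> group_words gs \<Longrightarrow> inverse_word u \<in> group_words gs"
    by (auto simp: group_words_def inverse_word_def subset_iff less_imp_diff_less)
qed

lemma ev_inverse_word: "u \<in> group_words gs \<Longrightarrow> ev (inverse_word u) = inv (ev u)"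
proof (induction u)
  case (Cons x u)
  then have x: "x < 2 * length gs" and u: "u \<in> group_words gs" by (auto simp: group_words_def)
  define y where "y = (if even x then Suc x else x - 1)"
  have l: "group_letter G gs x \<in> carrier G" using group_letter_closed[OF x] .
  have yw: "[y] \<in> group_words gs"
    using inverse_word_closed[of "[x]"] x by (simp add: inverse_word_def group_words_def y_def)
  have gd: "gs ! (x div 2) \<in> carrier G" using x gs by (auto simp: subset_iff)
  have "group_letter G gs y = inv (group_letter G gs x)"
  proof (cases "even x")
    case False
    then have "(x - Suc 0) div 2 = x div 2" "even (x - Suc 0)" by presburger+
    with False gd show ?thesis by (simp add: group_letter_def y_def)
  qed (simp add: group_letter_def y_def)
  moreover have "inverse_word (x # u) = inverse_word u @ [y]"
    by (simp add: inverse_word_def y_def)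
  ultimately show ?case
    using Cons.IH[OF u] ev_append[OF inverse_word_closed[OF u] yw] l ev_closed[OF u]
    by (simp add: inv_mult_group)
qed (simp add: inverse_word_def)

lemma word_eq_iff:
  assumes "u \<in> group_words gs" and "v \<in> group_words gs"
  shows "word_eq G gs u v \<longleftrightarrow> ev u = ev v"
proof -
  have "list_decode (code (u @ inverse_word v)) = u @ inverse_word v"
    by (simp add: code_list_def code_nat_def map_idI)
  moreover have "ev (u @ inverse_word v) = ev u \<otimes> inv (ev v)"
    using assms by (simp add: ev_append inverse_word_closed ev_inverse_word)
  moreover have "ev u \<otimes> inv (ev v) = \<one> \<longleftrightarrow> ev u = ev v"
    using ev_closed[OF assms(1)] ev_closed[OF assms(2)]
    by (metis inv_equality inv_inv inv_closed r_inv)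
  ultimately show ?thesis
    using assms by (simp add: word_eq_def word_problem_def inverse_word_closed)
qed

lemma ev_surj:
  assumes "generate G (set gs) = carrier G" and "x \<in> carrier G"
  shows "\<exists>u\<in>group_words gs. ev u = x"
proof -
  have "x \<in> generate G (set gs)" using assms by simp
  then show ?thesis
  proof induction
    case one
    show ?case by (rule bexI[of _ "[]"]) auto
  next
    case (incl h)
    then obtain i where i: "i < length gs" "gs ! i = h" by (auto simp: in_set_conv_nth)
    moreover have "h \<in> carrier G" using incl gs by blast
    ultimately show ?case
      by (intro bexI[of _ "[2 * i]"]) (auto simp: group_letter_def group_words_def)
  next
    case (inv h)
    then obtain i where i: "i < length gs" "gs ! i = h" by (auto simp: in_set_conv_nth)
    moreover have "h \<in> carrier G" using inv gs by blast
    ultimately show ?case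
      by (intro bexI[of _ "[2 * i + 1]"]) (auto simp: group_letter_def group_words_def)
  next
    case (eng h1 h2)
    then obtain u v where "u \<in> group_words gs" "v \<in> group_words gs" "ev u = h1" "ev v = h2" by blast
    then show ?case by (intro bexI[of _ "u @ v"]) (simp_all add: ev_append)
  qed
qed

end

lemma computable_inverse_word:
  "computable orc f \<Longrightarrow> computable orc (\<lambda>e. inverse_word (f e))"
  unfolding inverse_word_def One_nat_def by (intro computable_intros)

lemma computable_word_eq:
  assumes "computable (word_problem G gs) f" and "computable (word_problem G gs) g"
  shows "computable (word_problem G gs) (\<lambda>e. word_eq G gs (f e) (g e))"
proof -
  have "computable (word_problem G gs) (\<lambda>n. word_problem G gs n)"
    by (rule computableI[OF recursive_in.oracle_call]) (simp add: code_nat_def)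
  from computable_comp[OF this, of "\<lambda>e. code (f e @ inverse_word (g e))"]
  have "computable (word_problem G gs) (\<lambda>e. word_problem G gs (code (f e @ inverse_word (g e))))"
    by (simp add: computable_code computable_append computable_inverse_word assms)
  then show ?thesis unfolding word_eq_def by (rule computable_eq[OF _ computable_const])
qed

section \<open>Certificates\<close>

type_synonym aut_code =
  "nat list \<times> (nat \<times> nat list) list \<times> (nat \<times> nat list) list \<times> (nat \<times> nat \<times> nat list \<times> nat) list"

text \<open>A number of heads and a list of configurations with words as values. A
  \<open>certificate\<close> then gives the root, the blocks and the edges of a block
  automaton.\<close>

type_synonym block = "nat \<times> (nat \<times> nat list) list"

type_synonym certificate = "block \<times> block list \<times> (block \<times> nat \<times> nat \<times> nat list \<times> block) list"

definition coded_automaton ::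
    "('g, 'b) monoid_scheme \<Rightarrow> 'a list \<Rightarrow> 'g list \<Rightarrow> aut_code \<Rightarrow> (nat, 'a, 'g) automaton" where
  "coded_automaton G al gs = (\<lambda>(Qs, Is, Fs, Ts). \<lparr>states = set Qs,
     t_init = (\<lambda>(p, x). (p, group_eval G gs x)) ` set Is,
     t_final = (\<lambda>(p, x). (p, group_eval G gs x)) ` set Fs,
     transitions = (\<lambda>(p, a, x, q). (p, al ! a, group_eval G gs x, q)) ` set Ts\<rparr>)"

definition valid_code :: "'a list \<Rightarrow> 'g list \<Rightarrow> aut_code \<Rightarrow> bool" where
  "valid_code al gs = (\<lambda>(Qs, Is, Fs, Ts). (\<forall>(p, x)\<in>set Is. x \<in> group_words gs) \<and>
     (\<forall>(p, x)\<in>set Fs. x \<in> group_words gs) \<and>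
     (\<forall>(p, a, x, q)\<in>set Ts. a < length al \<and> x \<in> group_words gs))"

lemma coded_automaton_mem:
  "states (coded_automaton G al gs (Qs, Is, Fs, Ts)) = set Qs"
  "(p, \<alpha>) \<in> t_init (coded_automaton G al gs (Qs, Is, Fs, Ts)) \<longleftrightarrow>
     (\<exists>x. (p, x) \<in> set Is \<and> \<alpha> = group_eval G gs x)"
  "(p, \<alpha>) \<in> t_final (coded_automaton G al gs (Qs, Is, Fs, Ts)) \<longleftrightarrow>
     (\<exists>x. (p, x) \<in> set Fs \<and> \<alpha> = group_eval G gs x)"
  "(p, b, \<alpha>, q) \<in> transitions (coded_automaton G al gs (Qs, Is, Fs, Ts)) \<longleftrightarrow>
     (\<exists>a x. (p, a, x, q) \<in> set Ts \<and> b = al ! a \<and> \<alpha> = group_eval G gs x)"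
  by (auto simp: coded_automaton_def intro: rev_image_eqI)

lemma code_word: "code (x :: nat list) = list_encode x"
  by (simp add: code_list_def code_nat_def map_idI)

text \<open>The generic coding agrees literally with the one fixed in \<open>automaton_code\<close>,
  so input and output numbers are codes of values of type \<open>aut_code\<close>.\<close>

lemma code_aut_code:
  "code ((Qs, Is, Fs, Ts) :: aut_code) = prod_encode (list_encode Qs,
     prod_encode (list_encode (map (\<lambda>(p, x). prod_encode (p, list_encode x)) Is),
     prod_encode (list_encode (map (\<lambda>(p, x). prod_encode (p, list_encode x)) Fs),
       list_encode (map (\<lambda>(p, a, x, q).
         prod_encode (p, prod_encode (a, prod_encode (list_encode x, q)))) Ts))))"
proof -
  have "code Js = list_encode (map (\<lambda>(p, x). prod_encode (p, list_encode x)) Js)"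
    for Js :: "(nat \<times> nat list) list"
    unfolding code_list_def[of Js]
    by (rule arg_cong[of _ _ list_encode], rule map_cong) (auto simp: code_Pair code_word code_nat_def)
  moreover have "code Ts = list_encode (map (\<lambda>(p, a, x, q).
         prod_encode (p, prod_encode (a, prod_encode (list_encode x, q)))) Ts)"
    unfolding code_list_def[of Ts]
    by (rule arg_cong[of _ _ list_encode], rule map_cong) (auto simp: code_Pair code_word code_nat_def)
  ultimately show ?thesis by (simp add: code_Pair code_word)
qed

lemma automaton_code_iff:
  "automaton_code G al gs n W \<longleftrightarrow> (\<exists>\<nu> c. n = code c \<and> valid_code al gs c \<and> inj_on \<nu> (states W) \<and>
     coded_automaton G al gs c = map_states \<nu> W)"
proof
  assume "automaton_code G al gs n W"
  then obtain \<nu> Qs Is Fs Ts where "n = code ((Qs, Is, Fs, Ts) :: aut_code)"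
    "valid_code al gs (Qs, Is, Fs, Ts)" "inj_on \<nu> (states W)"
    "coded_automaton G al gs (Qs, Is, Fs, Ts) = map_states \<nu> W"
    unfolding automaton_code_def code_aut_code valid_code_def coded_automaton_def map_states_def
    by (elim exE conjE) simp
  then show "\<exists>\<nu> c. n = code c \<and> valid_code al gs c \<and> inj_on \<nu> (states W) \<and>
     coded_automaton G al gs c = map_states \<nu> W" by blast
next
  assume "\<exists>\<nu> c. n = code c \<and> valid_code al gs c \<and> inj_on \<nu> (states W) \<and>
     coded_automaton G al gs c = map_states \<nu> W"
  then obtain \<nu> Qs Is Fs Ts where "n = code ((Qs, Is, Fs, Ts) :: aut_code)"
    "valid_code al gs (Qs, Is, Fs, Ts)" "inj_on \<nu> (states W)"
    "coded_automaton G al gs (Qs, Is, Fs, Ts) = map_states \<nu> W" by (metis prod_cases4)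
  then show "automaton_code G al gs n W"
    unfolding automaton_code_def code_aut_code valid_code_def coded_automaton_def map_states_def
    by - (rule exI[of _ \<nu>], rule exI[of _ Qs], rule exI[of _ Is], rule exI[of _ Fs], rule exI[of _ Ts], simp)
qed

text \<open>Membership in \<open>group_words gs\<close> as a bounded check.\<close>

definition is_word :: "'g list \<Rightarrow> nat list \<Rightarrow> bool" where
  "is_word gs u \<longleftrightarrow> (\<forall>x\<in>set u. x < 2 * length gs)"

lemma is_word_iff: "is_word gs u \<longleftrightarrow> u \<in> group_words gs"
  by (auto simp: is_word_def group_words_def)

text \<open>The assumptions of \<open>block_automaton\<close> as checks on words. In the last clause
  two edges of a block on one letter either coincide, or one of them serves no head, or they serve
  disjoint intervals. The comparison \<open>y = x\<close> is literal: it merely tolerates repeated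
  entries of \<open>es\<close>.\<close>

definition certifies ::
    "('g, 'b) monoid_scheme \<Rightarrow> 'g list \<Rightarrow> nat \<Rightarrow> nat \<Rightarrow> aut_code \<Rightarrow> certificate \<Rightarrow> bool" where
  "certifies G gs n k = (\<lambda>(Qs, Is, Fs, Ts) (rt, bs, es).
     fst rt = k \<and> rt \<in> set bs \<and>
     (\<forall>c\<in>set Is. \<exists>d\<in>set (snd rt). fst c = fst d \<and> word_eq G gs (snd c) (snd d)) \<and>
     (\<forall>d\<in>set (snd rt). \<exists>c\<in>set Is. fst c = fst d \<and> word_eq G gs (snd c) (snd d)) \<and>
     (\<forall>b\<in>set bs. (fst b = 0 \<longrightarrow> snd b = []) \<and>
        (\<forall>d\<in>set (snd b). fst d \<in> set Qs \<and> is_word gs (snd d)) \<and>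
        (\<forall>d\<in>set (snd b). \<forall>(p, a, y, q)\<in>set Ts. p = fst d \<longrightarrow>
           (\<exists>(b1, a1, i, x, b')\<in>set es. b1 = b \<and> a1 = a \<and>
              (\<exists>d'\<in>set (snd b'). fst d' = q \<and> word_eq G gs (x @ snd d') (snd d @ y))))) \<and>
     (\<forall>(b, a, i, x, b')\<in>set es. b \<in> set bs \<and> b' \<in> set bs \<and> a < n \<and> i + fst b' \<le> fst b \<and> is_word gs x \<and>
        (\<forall>d'\<in>set (snd b'). \<exists>d\<in>set (snd b). \<exists>(p, a1, y, q)\<in>set Ts.
           p = fst d \<and> a1 = a \<and> q = fst d' \<and> word_eq G gs (x @ snd d') (snd d @ y)) \<and>
        (\<forall>(b1, a1, j, y, b1')\<in>set es. b1 = b \<and> a1 = a \<longrightarrow>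
           j = i \<and> y = x \<and> b1' = b' \<or> fst b' = 0 \<or> fst b1' = 0 \<or> i + fst b' \<le> j \<or> j + fst b1' \<le> i)))"

text \<open>Lists the fields of \<open>block_automaton.automaton\<close> with states numbered by
  \<open>code (i, b, p)\<close>. A product of weights is a concatenation of words, so no oracle is
  consulted here.\<close>

definition sequential_code :: "nat \<Rightarrow> aut_code \<Rightarrow> certificate \<Rightarrow> aut_code" where
  "sequential_code k = (\<lambda>(Qs, Is, Fs, Ts) (rt, bs, es).
     (concat (map (\<lambda>i. concat (map (\<lambda>b. map (\<lambda>p. code (i, b, p)) [0..<fst b]) bs)) [0..<k]),
      map (\<lambda>i. (code (i, rt, i), [])) [0..<k],
      concat (map (\<lambda>i. concat (map (\<lambda>b. concat (map (\<lambda>p. concat (map (\<lambda>d. concat (map (\<lambda>f.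
        if fst d = fst f then [(code (i, b, p), snd d @ snd f)] else []) Fs)) (snd b)))
        [0..<fst b])) bs)) [0..<k]),
      concat (map (\<lambda>i. concat (map (\<lambda>(b, a, j, x, b').
        map (\<lambda>p. (code (i, b, j + p), a, x, code (i, b', p))) [0..<fst b']) es)) [0..<k])))"

lemma computable_mem:
  assumes "computable orc f" and "computable orc xs"
  shows "computable orc (\<lambda>e. f e \<in> set (xs e))"
proof -
  have "computable orc (\<lambda>e. \<exists>y\<in>set (xs e). f e = y)"
    by (intro computable_Bex computable_eq assms computable_comp[OF assms(1)] computable_fst
        computable_snd computable_id)
  then show ?thesis by simp
qed

lemma computable_is_word: "computable orc f \<Longrightarrow> computable orc (\<lambda>e. is_word gs (f e))"
  unfolding is_word_def by (intro computable_intros)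

text \<open>All quantifiers range over given lists, and group elements are compared through
  \<open>word_eq\<close> alone.\<close>

lemma computable_certifies:
  "computable (word_problem G gs) (\<lambda>p. certifies G gs n k (fst p) (snd p))"
  unfolding certifies_def split_def
  by (rule computable_intros computable_mem computable_is_word computable_word_eq)+

lemma computable_sequential_code: "computable orc (\<lambda>p. sequential_code k (fst p) (snd p))"
  unfolding sequential_code_def split_def
  by (rule computable_intros)+

lemma (in group_automaton) post_letter:
  assumes "S \<subseteq> confs"
  shows "post [a] S = {(q', \<delta> \<otimes> \<alpha>) | q \<delta> \<alpha> q'. (q, \<delta>) \<in> S \<and> (q, a, \<alpha>, q') \<in> transitions W}"
proof -
  have "crun [a] (q, \<delta>) c' \<longleftrightarrow> (\<exists>\<alpha> q'. (q, a, \<alpha>, q') \<in> transitions W \<and> c' = (q', \<delta> \<otimes> \<alpha>))"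
    if "(q, \<delta>) \<in> S" for q \<delta> c'
    using that assms transitions_subset by fastforce
  then show ?thesis unfolding post_def by fast
qed

section \<open>From certificates to sequential automata\<close>

locale effective_group = generated_group G \<Gamma> for G (structure) and \<Gamma> +
  fixes gs and al :: "'c list"
  assumes set_gs: "set gs = \<Gamma>" and distinct_al: "distinct al"
begin

sublocale group_presentation G gs
  by unfold_locales (simp add: set_gs gens_carrier)

definition elements :: "(nat \<times> nat list) list \<Rightarrow> (nat \<times> 'a) set" where
  "elements xs = (\<lambda>(q, x). (q, ev x)) ` set xs"

definition edges :: "(block \<times> nat \<times> nat \<times> nat list \<times> block) list \<Rightarrow> (block \<times> 'c \<times> nat \<times> 'a \<times> block) set" where
  "edges es = (\<lambda>(b, a, i, x, b'). (b, al ! a, i, ev x, b')) ` set es"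

lemma elementsI: "d \<in> set xs \<Longrightarrow> (fst d, ev (snd d)) \<in> elements xs"
  unfolding elements_def by (force simp: split_def)

lemma elementsE:
  assumes "(q, \<delta>) \<in> elements xs"
  obtains d where "d \<in> set xs" and "fst d = q" and "ev (snd d) = \<delta>"
  using assms unfolding elements_def by auto

lemma certifies_block_automaton:
  assumes valid: "valid_code al gs (Qs, Is, Fs, Ts)"
    and wa: "weighted_automaton (set al) G (coded_automaton G al gs (Qs, Is, Fs, Ts))"
    and cert: "certifies G gs (length al) k (Qs, Is, Fs, Ts) (rt, bs, es)"
  shows "block_automaton G \<Gamma> (set al) (coded_automaton G al gs (Qs, Is, Fs, Ts)) (set bs) rt fst
    (\<lambda>b. elements (snd b)) (edges es) (\<lambda>i b p. code (i, b, p))"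
proof -
  define W where "W = coded_automaton G al gs (Qs, Is, Fs, Ts)"
  interpret group_automaton G \<Gamma> "set al" W
    by unfold_locales (use wa W_def in simp)
  note cert' = cert[unfolded certifies_def prod.case]
  have rt: "rt \<in> set bs" using cert' by (elim conjE)
  have init: "\<forall>c\<in>set Is. \<exists>d\<in>set (snd rt). fst c = fst d \<and> word_eq G gs (snd c) (snd d)"
    "\<forall>d\<in>set (snd rt). \<exists>c\<in>set Is. fst c = fst d \<and> word_eq G gs (snd c) (snd d)"
    using cert' by simp_all
  have block_cert: "\<forall>b\<in>set bs. (fst b = 0 \<longrightarrow> snd b = []) \<and>
        (\<forall>d\<in>set (snd b). fst d \<in> set Qs \<and> is_word gs (snd d)) \<and>
        (\<forall>d\<in>set (snd b). \<forall>(p, a, y, q)\<in>set Ts. p = fst d \<longrightarrow>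
           (\<exists>(b1, a1, i, x, b')\<in>set es. b1 = b \<and> a1 = a \<and>
              (\<exists>d'\<in>set (snd b'). fst d' = q \<and> word_eq G gs (x @ snd d') (snd d @ y))))"
    using cert' by (elim conjE)
  have edge_cert: "\<forall>(b, a, i, x, b')\<in>set es. b \<in> set bs \<and> b' \<in> set bs \<and> a < length al \<and> i + fst b' \<le> fst b \<and> is_word gs x \<and>
        (\<forall>d'\<in>set (snd b'). \<exists>d\<in>set (snd b). \<exists>(p, a1, y, q)\<in>set Ts.
           p = fst d \<and> a1 = a \<and> q = fst d' \<and> word_eq G gs (x @ snd d') (snd d @ y)) \<and>
        (\<forall>(b1, a1, j, y, b1')\<in>set es. b1 = b \<and> a1 = a \<longrightarrow>
           j = i \<and> y = x \<and> b1' = b' \<or> fst b' = 0 \<or> fst b1' = 0 \<or> i + fst b' \<le> j \<or> j + fst b1' \<le> i)"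
    using cert' by (elim conjE)
  have blocks: "fst b = 0 \<Longrightarrow> snd b = []" "\<And>d. d \<in> set (snd b) \<Longrightarrow> fst d \<in> set Qs \<and> snd d \<in> group_words gs"
    if "b \<in> set bs" for b
    using bspec[OF block_cert that] unfolding is_word_iff by blast+
  have compl: "\<exists>(b1, a1, i, x, b')\<in>set es. b1 = b \<and> a1 = a \<and>
      (\<exists>d'\<in>set (snd b'). fst d' = q \<and> word_eq G gs (x @ snd d') (snd d @ y))"
    if b: "b \<in> set bs" "d \<in> set (snd b)" and t: "(p, a, y, q) \<in> set Ts" "p = fst d" for b d p a y q
    using bspec[OF bspec[OF conjunct2[OF conjunct2[OF bspec[OF block_cert b(1)]]] b(2)] t(1), unfolded prod.case] t(2)
    by blast
  have edge: "b \<in> set bs \<and> b' \<in> set bs \<and> a < length al \<and> i + fst b' \<le> fst b \<and> x \<in> group_words gs"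
    if "(b, a, i, x, b') \<in> set es" for b a i x b'
    using bspec[OF edge_cert that, unfolded prod.case] unfolding is_word_iff by simp
  have sound: "\<exists>d\<in>set (snd b). \<exists>(p, a1, y, q)\<in>set Ts.
      p = fst d \<and> a1 = a \<and> q = fst d' \<and> word_eq G gs (x @ snd d') (snd d @ y)"
    if e: "(b, a, i, x, b') \<in> set es" and d': "d' \<in> set (snd b')" for b a i x b' d'
  proof -
    from bspec[OF edge_cert e, unfolded prod.case] have "\<forall>d'\<in>set (snd b'). \<exists>d\<in>set (snd b). \<exists>(p, a1, y, q)\<in>set Ts.
      p = fst d \<and> a1 = a \<and> q = fst d' \<and> word_eq G gs (x @ snd d') (snd d @ y)" by (elim conjE)
    from bspec[OF this d'] show ?thesis .
  qed
  have disj: "j = i \<and> y = x \<and> b1' = b' \<or> fst b' = 0 \<or> fst b1' = 0 \<or> i + fst b' \<le> j \<or> j + fst b1' \<le> i"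
    if e: "(b, a, i, x, b') \<in> set es" and e1: "(b, a, j, y, b1') \<in> set es" for b a i x b' j y b1'
  proof -
    from bspec[OF edge_cert e, unfolded prod.case] have "\<forall>(b1, a1, j, y, b1')\<in>set es. b1 = b \<and> a1 = a \<longrightarrow>
      j = i \<and> y = x \<and> b1' = b' \<or> fst b' = 0 \<or> fst b1' = 0 \<or> i + fst b' \<le> j \<or> j + fst b1' \<le> i" by (elim conjE)
    from bspec[OF this e1, unfolded prod.case] show ?thesis by simp
  qed
  have words: "x \<in> group_words gs" if "(p, x) \<in> set Is" for p x
    using valid that unfolding valid_code_def by auto
  have twords: "a < length al" "y \<in> group_words gs" if "(p, a, y, q) \<in> set Ts" for p a y q
    using valid that unfolding valid_code_def by auto
  have trans: "(q, al ! a, ev y, q') \<in> transitions W" if "(q, a, y, q') \<in> set Ts" for q a y q'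
    using that unfolding W_def coded_automaton_mem by blast
  have elc: "elements (snd b) \<subseteq> confs" if "b \<in> set bs" for b
    using blocks(2)[OF that] ev_closed unfolding elements_def W_def coded_automaton_mem by auto
  have eqD: "ev x \<otimes> ev z = ev y \<otimes> ev v"
    if "word_eq G gs (x @ z) (y @ v)" "x \<in> group_words gs" "z \<in> group_words gs"
      "y \<in> group_words gs" "v \<in> group_words gs" for x y z v
    using that word_eq_iff[of "x @ z" "y @ v"] by (simp add: ev_append)
  have "block_automaton G \<Gamma> (set al) W (set bs) rt fst
    (\<lambda>b. elements (snd b)) (edges es) (\<lambda>i b p. code (i, b, p))"
  proof unfold_locales
    show "finite (set bs)" "finite (edges es)" by (simp_all add: edges_def)
    show "rt \<in> set bs" by (rule rt)
    show "elements (snd rt) = t_init W"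
    proof (intro equalityI subrelI)
      fix q \<delta> assume "(q, \<delta>) \<in> elements (snd rt)"
      then obtain d where d: "d \<in> set (snd rt)" "fst d = q" "ev (snd d) = \<delta>" by (rule elementsE)
      then obtain c where c: "c \<in> set Is" "fst c = fst d" "word_eq G gs (snd c) (snd d)" using init(2) by blast
      have "snd c \<in> group_words gs" using words[of "fst c" "snd c"] c(1) by simp
      then have "ev (snd c) = \<delta>"
        using word_eq_iff[of "snd c" "snd d"] blocks(2)[OF rt d(1)] c(3) d(3) by simp
      moreover have "(q, snd c) \<in> set Is" using c(1,2) d(2) by (metis prod.collapse)
      ultimately show "(q, \<delta>) \<in> t_init W" unfolding W_def coded_automaton_mem by blast
    next
      fix q \<delta> assume "(q, \<delta>) \<in> t_init W"
      then obtain x where x: "(q, x) \<in> set Is" "ev x = \<delta>" unfolding W_def coded_automaton_mem by blast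
      from bspec[OF init(1) x(1)] obtain d where d: "d \<in> set (snd rt)" "q = fst d" "word_eq G gs x (snd d)"
        by auto
      then have "ev (snd d) = \<delta>"
        using word_eq_iff[of x "snd d"] words[OF x(1)] blocks(2)[OF rt d(1)] x(2) by simp
      with elementsI[OF d(1)] d(2) show "(q, \<delta>) \<in> elements (snd rt)" by simp
    qed
  next
    fix b assume b: "b \<in> set bs"
    show "elements (snd b) \<subseteq> confs" by (rule elc[OF b])
    show "finite (elements (snd b))" unfolding elements_def by simp
    show "elements (snd b) = {}" if "fst b = 0" using blocks(1)[OF b that] by (simp add: elements_def)
  next
    fix b a i x b' assume "(b, a, i, x, b') \<in> edges es"
    then obtain a0 x0 where e: "(b, a0, i, x0, b') \<in> set es" "a = al ! a0" "x = ev x0"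
      unfolding edges_def by auto
    with edge[OF e(1)] ev_closed show "b \<in> set bs \<and> a \<in> set al \<and> i + fst b' \<le> fst b \<and> x \<in> carrier G \<and> b' \<in> set bs"
      by simp
  next
    fix b a i x b' j y b'' p p'
    assume "(b, a, i, x, b') \<in> edges es" "(b, a, j, y, b'') \<in> edges es" and p: "p < fst b'" "p' < fst b''" "i + p = j + p'"
    then obtain a0 x0 a1 x1 where e: "(b, a0, i, x0, b') \<in> set es" "a = al ! a0" "x = ev x0"
      "(b, a1, j, x1, b'') \<in> set es" "a = al ! a1" "y = ev x1"
      unfolding edges_def by auto
    \<comment> \<open>Certificates compare positions of letters, the locale compares letters;
      distinctness of \<open>al\<close> identifies the two.\<close>
    have "a0 = a1" using e(2,5) edge[OF e(1)] edge[OF e(4)] distinct_al by (simp add: nth_eq_iff_index_eq)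
    with disj[OF e(1), of j x1 b''] e(3,4,6) p show "x = y \<and> b' = b'' \<and> p = p'" by auto
  next
    fix b a i x b' assume "(b, a, i, x, b') \<in> edges es"
    then obtain a0 x0 where e: "(b, a0, i, x0, b') \<in> set es" "a = al ! a0" "x = ev x0"
      unfolding edges_def by auto
    have b: "b \<in> set bs" "b' \<in> set bs" "x0 \<in> group_words gs" using edge[OF e(1)] by auto
    show "act x ` elements (snd b') \<subseteq> post [a] (elements (snd b))"
    proof (intro subsetI, elim imageE)
      fix e c assume c: "e = act x c" "c \<in> elements (snd b')"
      obtain q \<delta> where q\<delta>: "c = (q, \<delta>)" by (cases c)
      with c have "(q, \<delta>) \<in> elements (snd b')" by simp
      then obtain d' where d': "d' \<in> set (snd b')" "fst d' = q" "ev (snd d') = \<delta>" by (rule elementsE)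
      obtain d y where d: "d \<in> set (snd b)" "(fst d, a0, y, fst d') \<in> set Ts"
        "word_eq G gs (x0 @ snd d') (snd d @ y)" using sound[OF e(1) d'(1)] by blast
      have "ev x0 \<otimes> \<delta> = ev (snd d) \<otimes> ev y"
        using eqD[OF d(3)] b blocks(2)[OF b(1) d(1)] blocks(2)[OF b(2) d'(1)] twords(2)[OF d(2)] d'(3) by simp
      then have "act x (q, \<delta>) = (fst d', ev (snd d) \<otimes> ev y)" using d'(2) e(3) by (simp add: act_def)
      then show "e \<in> post [a] (elements (snd b))"
        unfolding c(1) q\<delta> post_letter[OF elc[OF b(1)]] using elementsI[OF d(1)] trans[OF d(2)] e(2) by blast
    qed
  next
    fix b c a assume b: "b \<in> set bs" and c: "c \<in> post [a] (elements (snd b))"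
    then obtain q \<delta> \<alpha> q' where q: "(q, \<delta>) \<in> elements (snd b)" "(q, a, \<alpha>, q') \<in> transitions W" "c = (q', \<delta> \<otimes> \<alpha>)"
      unfolding post_letter[OF elc[OF b]] by blast
    obtain d where d: "d \<in> set (snd b)" "fst d = q" "ev (snd d) = \<delta>" using q(1) by (rule elementsE)
    obtain a0 y where t: "(q, a0, y, q') \<in> set Ts" "a = al ! a0" "\<alpha> = ev y"
      using q(2) unfolding W_def coded_automaton_mem by blast
    obtain i x b' d' where e: "(b, a0, i, x, b') \<in> set es" "d' \<in> set (snd b')" "fst d' = q'"
      "word_eq G gs (x @ snd d') (snd d @ y)"
      using compl[OF b d(1) t(1)] d(2) by blast
    have b': "b' \<in> set bs" "x \<in> group_words gs" using edge[OF e(1)] by auto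
    have "ev x \<otimes> ev (snd d') = \<delta> \<otimes> \<alpha>"
      using eqD[OF e(4)] b' blocks(2)[OF b d(1)] blocks(2)[OF b'(1) e(2)] twords(2)[OF t(1)] d(3) t(3) by simp
    then have "c = act (ev x) (fst d', ev (snd d'))" using q(3) e(3) by (simp add: act_def)
    moreover have "(b, a, i, ev x, b') \<in> edges es" using e(1) t(2) unfolding edges_def by force
    ultimately show "\<exists>i x b'. (b, a, i, x, b') \<in> edges es \<and> c \<in> act x ` elements (snd b')"
      using elementsI[OF e(2)] by blast
  next
    fix i i' p p' :: nat and b b' :: block
    assume "code (i, b, p) = code (i', b', p')"
    then show "i = i' \<and> b = b' \<and> p = p'" by simp
  qed
  then show ?thesis unfolding W_def .
qed

end

lemma set_sequential_code:
  assumes "sequential_code k (Qs, Is, Fs, Ts) (rt, bs, es) = (Qs', Is', Fs', Ts')"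
  shows "set Qs' = {code (i, b, p) | i b p. i < k \<and> b \<in> set bs \<and> p < fst b}"
    and "set Is' = {(code (i, rt, i), []) | i. i < k}"
    and "set Fs' = {(code (i, b, p), snd d @ snd f) | i b p d f. i < k \<and> b \<in> set bs \<and> p < fst b \<and>
      d \<in> set (snd b) \<and> f \<in> set Fs \<and> fst d = fst f}"
    and "set Ts' = {(code (i, b, j + p), a, x, code (i, b', p)) | i b a j x b' p.
      i < k \<and> (b, a, j, x, b') \<in> set es \<and> p < fst b'}"
proof -
  have if_set: "set (if c then [x] else []) = {y. c \<and> y = x}" for c and x :: "nat \<times> nat list" by simp
  note out = assms[unfolded sequential_code_def prod.case prod.inject]
  show "set Qs' = {code (i, b, p) | i b p. i < k \<and> b \<in> set bs \<and> p < fst b}"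
    unfolding out[THEN conjunct1, symmetric] set_concat set_map set_upt by force
  show "set Is' = {(code (i, rt, i), []) | i. i < k}"
    unfolding out[THEN conjunct2, THEN conjunct1, symmetric] set_concat set_map set_upt by force
  show "set Fs' = {(code (i, b, p), snd d @ snd f) | i b p d f. i < k \<and> b \<in> set bs \<and> p < fst b \<and>
      d \<in> set (snd b) \<and> f \<in> set Fs \<and> fst d = fst f}"
    unfolding out[THEN conjunct2, THEN conjunct2, THEN conjunct1, symmetric] set_concat set_map set_upt
      image_image if_set by (simp add: set_eq_iff Bex_def del: split_paired_Ex) blast
  show "set Ts' = {(code (i, b, j + p), a, x, code (i, b', p)) | i b a j x b' p.
      i < k \<and> (b, a, j, x, b') \<in> set es \<and> p < fst b'}"
    unfolding out[THEN conjunct2, THEN conjunct2, THEN conjunct2, symmetric] set_concat set_map set_upt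
      image_image split_def by force
qed

context effective_group
begin

lemma word_choice: "\<exists>wd. \<forall>g\<in>carrier G. wd g \<in> group_words gs \<and> ev (wd g) = g"
proof (rule bchoice, rule ballI)
  fix g assume "g \<in> carrier G"
  from ev_surj[OF _ this] show "\<exists>u. u \<in> group_words gs \<and> ev u = g"
    using generate_gens set_gs by auto
qed

lemma valid_sequential_code:
  assumes valid: "valid_code al gs (Qs, Is, Fs, Ts)"
    and cert: "certifies G gs (length al) k (Qs, Is, Fs, Ts) (rt, bs, es)"
  shows "valid_code al gs (sequential_code k (Qs, Is, Fs, Ts) (rt, bs, es))"
proof -
  note cert' = cert[unfolded certifies_def prod.case]
  have 1: "snd d \<in> group_words gs" if "b \<in> set bs" "d \<in> set (snd b)" for b d
    using cert' that unfolding is_word_iff by blast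
  have 2: "snd f \<in> group_words gs" if "f \<in> set Fs" for f
    using valid that unfolding valid_code_def by auto
  have 3: "a < length al \<and> x \<in> group_words gs" if "(b, a, i, x, b') \<in> set es" for b a i x b'
  proof -
    have "\<forall>(b, a, i, x, b')\<in>set es. a < length al \<and> is_word gs x" using cert' by auto
    from bspec[OF this that] show ?thesis by (simp add: is_word_iff)
  qed
  show ?thesis
    unfolding valid_code_def sequential_code_def prod.case
    using 1 2 3 by (auto split: if_splits dest: 3)
qed

text \<open>The lists of \<open>sequential_code\<close> evaluate field by field to the block
  automaton given by the certificate, so the two automata are equal and its properties are
  inherited.\<close>

lemma coded_sequential_code:
  assumes valid: "valid_code al gs (Qs, Is, Fs, Ts)"
    and wa: "weighted_automaton (set al) G (coded_automaton G al gs (Qs, Is, Fs, Ts))"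
    and cert: "certifies G gs (length al) k (Qs, Is, Fs, Ts) (rt, bs, es)"
  defines "W' \<equiv> coded_automaton G al gs (sequential_code k (Qs, Is, Fs, Ts) (rt, bs, es))"
  shows "weighted_automaton (set al) G W' \<and> k_sequential (set al) G k W' \<and>
    computed_relation G W' = computed_relation G (coded_automaton G al gs (Qs, Is, Fs, Ts))"
proof -
  define W where "W = coded_automaton G al gs (Qs, Is, Fs, Ts)"
  interpret B: block_automaton G \<Gamma> "set al" W "set bs" rt fst "\<lambda>b. elements (snd b)" "edges es"
    "\<lambda>i b p. code (i, b, p)"
    unfolding W_def by (rule certifies_block_automaton[OF valid wa cert])
  note cert' = cert[unfolded certifies_def prod.case]
  have k: "fst rt = k" using cert' by simp
  have words: "snd d \<in> group_words gs" if "b \<in> set bs" "d \<in> set (snd b)" for b d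
    using cert' that unfolding is_word_iff by blast
  have fwords: "x \<in> group_words gs" if "(q, x) \<in> set Fs" for q x
    using valid that unfolding valid_code_def by auto
  obtain Qs' Is' Fs' Ts' where out: "sequential_code k (Qs, Is, Fs, Ts) (rt, bs, es) = (Qs', Is', Fs', Ts')"
    by (metis prod_cases4)
  note sets = set_sequential_code[OF out]
  have W': "W' = coded_automaton G al gs (Qs', Is', Fs', Ts')" unfolding W'_def out ..
  have states: "states W' = states B.automaton"
  proof (rule Set.set_eqI)
    show "s \<in> states W' \<longleftrightarrow> s \<in> states B.automaton" for s
      unfolding W' coded_automaton_mem sets B.automaton_state k by blast
  qed
  have init: "t_init W' = t_init B.automaton"
  proof (rule Set.set_eqI)
    fix c :: "nat \<times> 'a"
    have "(s, z) \<in> t_init W' \<longleftrightarrow> (s, z) \<in> t_init B.automaton" for s z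
      unfolding W' coded_automaton_mem sets B.automaton_init k by auto
    then show "c \<in> t_init W' \<longleftrightarrow> c \<in> t_init B.automaton" by (cases c) simp
  qed
  have final: "t_final W' = t_final B.automaton"
  proof (intro equalityI subrelI)
    fix s z assume "(s, z) \<in> t_final W'"
    then obtain i b p d f where *: "i < k" "b \<in> set bs" "p < fst b" "d \<in> set (snd b)" "f \<in> set Fs"
      "fst d = fst f" "s = code (i, b, p)" "z = ev (snd d @ snd f)"
      unfolding W' coded_automaton_mem sets by blast
    have "z = ev (snd d) \<otimes> ev (snd f)"
      using words[OF *(2,4)] fwords[of "fst f" "snd f"] *(5,8) by (simp add: ev_append)
    moreover have "(fst d, ev (snd f)) \<in> t_final W"
      unfolding W_def coded_automaton_mem using *(5,6) by (metis prod.collapse)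
    ultimately show "(s, z) \<in> t_final B.automaton"
      unfolding B.automaton_final k using elementsI[OF *(4)] *(1-3,7) by blast
  next
    fix s z assume "(s, z) \<in> t_final B.automaton"
    then obtain i b p q \<delta> \<phi> where *: "i < k" "b \<in> set bs" "p < fst b" "(q, \<delta>) \<in> elements (snd b)"
      "(q, \<phi>) \<in> t_final W" "s = code (i, b, p)" "z = \<delta> \<otimes> \<phi>"
      unfolding B.automaton_final k by blast
    obtain d where d: "d \<in> set (snd b)" "fst d = q" "ev (snd d) = \<delta>" using *(4) by (rule elementsE)
    obtain x where x: "(q, x) \<in> set Fs" "\<phi> = ev x"
      using *(5) unfolding W_def coded_automaton_mem by blast
    have z: "z = ev (snd d @ x)"
      using words[OF *(2) d(1)] fwords[OF x(1)] *(7) d(3) x(2) by (simp add: ev_append)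
    have "(code (i, b, p), snd d @ snd (q, x)) \<in> set Fs'"
      unfolding sets using *(1-3) d(1,2) x(1) by force
    then show "(s, z) \<in> t_final W'"
      unfolding W' coded_automaton_mem z *(6) by auto
  qed
  have trans: "transitions W' = transitions B.automaton"
  proof (intro equalityI subsetI)
    fix t assume t: "t \<in> transitions W'"
    obtain s c y s' where t': "t = (s, c, y, s')" by (cases t)
    from t[unfolded t' W' coded_automaton_mem sets] obtain i b a j x b' p where *: "i < k"
      "(b, a, j, x, b') \<in> set es" "p < fst b'"
      "t = (code (i, b, j + p), al ! a, ev x, code (i, b', p))"
      unfolding t' by blast
    have "(b, al ! a, j, ev x, b') \<in> edges es" unfolding edges_def using *(2) by force
    with * show "t \<in> transitions B.automaton"
      unfolding *(4) B.automaton_transition k by blast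
  next
    fix t assume t: "t \<in> transitions B.automaton"
    obtain s a x s' where t': "t = (s, a, x, s')" by (cases t)
    from t[unfolded t' B.automaton_transition k] obtain i b j b' p where *: "i < k"
      "(b, a, j, x, b') \<in> edges es" "p < fst b'" "s = code (i, b, j + p)" "s' = code (i, b', p)" by blast
    obtain a0 x0 where e: "(b, a0, j, x0, b') \<in> set es" "a = al ! a0" "x = ev x0"
      using *(2) unfolding edges_def by auto
    have "(code (i, b, j + p), a0, x0, code (i, b', p)) \<in> set Ts'"
      unfolding sets using *(1,3) e(1) by blast
    then show "t \<in> transitions W'"
      unfolding W' t' *(4,5) e(2,3) coded_automaton_mem by blast
  qed
  have "W' = B.automaton"
    using states init final trans by (intro automaton.equality) simp_all
  then show ?thesis
    using B.automaton_wa B.k_sequential_automaton B.computed_relation_automaton k unfolding W_def by simp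
qed

text \<open>The finite block system is written out in words: \<open>wd\<close> chooses a word for
  each group element and \<open>tl\<close> lists each set. The parts into which a successor set is
  divided receive consecutive intervals of heads.\<close>

lemma certificate_exists:
  assumes valid: "valid_code al gs (Qs, Is, Fs, Ts)"
    and wa: "weighted_automaton (set al) G (coded_automaton G al gs (Qs, Is, Fs, Ts))"
    and btp: "branching_twinning_property G k (coded_automaton G al gs (Qs, Is, Fs, Ts))"
  shows "\<exists>c. certifies G gs (length al) k (Qs, Is, Fs, Ts) c"
proof -
  define W where "W = coded_automaton G al gs (Qs, Is, Fs, Ts)"
  interpret group_automaton G \<Gamma> "set al" W
    by unfold_locales (use wa W_def in simp)
  have "\<not> sep (t_init W) (Suc k)"
    by (rule branching_twinning_not_sep) (use btp W_def in simp)
  from finite_block_system[OF this] obtain \<F> where \<F>: "finite \<F>" "(k, t_init W) \<in> \<F>" and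
    block: "\<forall>(h, T)\<in>\<F>. finite T \<and> T \<subseteq> confs \<and> (h = 0 \<longrightarrow> T = {}) \<and>
    (\<forall>a. \<exists>xs. (\<forall>(x, h', T')\<in>set xs. x \<in> carrier G \<and> (h', T') \<in> \<F>) \<and>
      sum_list (map (fst \<circ> snd) xs) = h \<and> post [a] T = (\<Union>(x, h', T')\<in>set xs. act x ` T'))"
    by (elim exE conjE)
  have fin: "finite (snd f)" and conf: "snd f \<subseteq> confs" and zero: "fst f = 0 \<Longrightarrow> snd f = {}"
    if "f \<in> \<F>" for f
    using bspec[OF block that] by (simp_all add: split_def)
  have "\<forall>p. \<exists>xs. fst p \<in> \<F> \<longrightarrow> (\<forall>x\<in>set xs. fst x \<in> carrier G \<and> snd x \<in> \<F>) \<and>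
      sum_list (map (fst \<circ> snd) xs) = fst (fst p) \<and>
      post [snd p] (snd (fst p)) = (\<Union>x\<in>set xs. act (fst x) ` snd (snd x))"
  proof (intro allI)
    fix p :: "(nat \<times> (nat \<times> 'a) set) \<times> 'c"
    show "\<exists>xs. fst p \<in> \<F> \<longrightarrow> (\<forall>x\<in>set xs. fst x \<in> carrier G \<and> snd x \<in> \<F>) \<and>
      sum_list (map (fst \<circ> snd) xs) = fst (fst p) \<and>
      post [snd p] (snd (fst p)) = (\<Union>x\<in>set xs. act (fst x) ` snd (snd x))"
    proof (cases "fst p \<in> \<F>")
      case True
      from bspec[OF block True] show ?thesis by (simp add: split_def)
    qed simp
  qed
  from choice[OF this] obtain X0 where X0: "\<And>p. fst p \<in> \<F> \<Longrightarrow>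
    (\<forall>x\<in>set (X0 p). fst x \<in> carrier G \<and> snd x \<in> \<F>) \<and>
      sum_list (map (fst \<circ> snd) (X0 p)) = fst (fst p) \<and>
      post [snd p] (snd (fst p)) = (\<Union>x\<in>set (X0 p). act (fst x) ` snd (snd x))"
    by blast
  define X where "X f a = X0 (f, a)" for f a
  have X: "\<And>x. x \<in> set (X f a) \<Longrightarrow> fst x \<in> carrier G \<and> snd x \<in> \<F>"
    "sum_list (map (fst \<circ> snd) (X f a)) = fst f"
    "post [a] (snd f) = (\<Union>x\<in>set (X f a). act (fst x) ` snd (snd x))" if "f \<in> \<F>" for f a
    using X0[of "(f, a)"] that unfolding X_def by simp_all
  obtain wd where wd: "\<And>g. g \<in> carrier G \<Longrightarrow> wd g \<in> group_words gs" "\<And>g. g \<in> carrier G \<Longrightarrow> ev (wd g) = g"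
    using word_choice by blast
  have "\<forall>f\<in>\<F>. \<exists>l. set l = (\<lambda>(q, \<delta>). (q, wd \<delta>)) ` snd f"
    by (intro ballI finite_list finite_imageI fin)
  from bchoice[OF this] obtain tl where tl: "\<And>f. f \<in> \<F> \<Longrightarrow> set (tl f) = (\<lambda>(q, \<delta>). (q, wd \<delta>)) ` snd f"
    by blast
  define bm where "bm f = (fst f, tl f)" for f
  have tlD: "(fst d, ev (snd d)) \<in> snd f \<and> snd d \<in> group_words gs \<and> fst d \<in> states W"
    if f: "f \<in> \<F>" and d: "d \<in> set (tl f)" for f d
  proof -
    obtain q \<delta> where q: "(q, \<delta>) \<in> snd f" "d = (q, wd \<delta>)" using d tl[OF f] by auto
    moreover have "\<delta> \<in> carrier G" "q \<in> states W" using q(1) conf[OF f] by auto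
    ultimately show ?thesis using wd by simp
  qed
  have tlI: "(q, wd \<delta>) \<in> set (tl f)" if "f \<in> \<F>" "(q, \<delta>) \<in> snd f" for f q \<delta>
    using tl[OF that(1)] that(2) by force
  \<comment> \<open>Two edges leaving one written block thus stem from one block of
    \<open>\<F>\<close>, which makes their intervals of heads comparable.\<close>
  have bm_inj: "f = f'" if f: "f \<in> \<F>" "f' \<in> \<F>" "bm f = bm f'" for f f'
  proof -
    have "(q, \<delta>) \<in> snd f'" if "f \<in> \<F>" "f' \<in> \<F>" "tl f = tl f'" "(q, \<delta>) \<in> snd f" for q \<delta> f f'
    proof -
      have "\<delta> \<in> carrier G" using conf[OF that(1)] that(4) by auto
      with tlD[OF that(2), of "(q, wd \<delta>)"] tlI[OF that(1,4)] that(3) wd(2) show ?thesis by simp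
    qed
    from this[OF f(1,2)] this[OF f(2,1)] f(3) show ?thesis by (auto simp: bm_def prod_eq_iff)
  qed
  have trans: "(q, al ! a, ev y, q') \<in> transitions W" if "(q, a, y, q') \<in> set Ts" for q a y q'
    using that unfolding W_def coded_automaton_mem by blast
  have twords: "a < length al" "y \<in> group_words gs" if "(p, a, y, q) \<in> set Ts" for p a y q
    using valid that unfolding valid_code_def by auto
  have iwords: "x \<in> group_words gs" if "(p, x) \<in> set Is" for p x
    using valid that unfolding valid_code_def by auto
  have weqI: "word_eq G gs (x @ z) (y @ v)"
    if "ev x \<otimes> ev z = ev y \<otimes> ev v" "x \<in> group_words gs" "z \<in> group_words gs"
      "y \<in> group_words gs" "v \<in> group_words gs" for x y z v
    using that word_eq_iff[of "x @ z" "y @ v"] by (simp add: ev_append)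
  \<comment> \<open>The number of heads taken by the parts before part \<open>m\<close>, hence its
    first head.\<close>
  define off where "off f a m = sum_list (map (fst \<circ> snd) (take m (X f (al ! a))))" for f a m
  define E where "E f a m = (bm f, a, off f a m, wd (fst (X f (al ! a) ! m)), bm (snd (X f (al ! a) ! m)))"
    for f and a m :: nat
  have off_step: "off f a m + fst (snd (X f (al ! a) ! m)) = off f a (Suc m)"
    if "m < length (X f (al ! a))" for f a m
    using that by (simp add: off_def take_Suc_conv_app_nth)
  have off_mono: "off f a m \<le> off f a m'" if "m \<le> m'" for f a m m'
  proof -
    have "take m' (X f (al ! a)) = take m (X f (al ! a)) @ take (m' - m) (drop m (X f (al ! a)))"
      using that by (metis take_add le_add_diff_inverse)
    then show ?thesis by (simp add: off_def)
  qed
  have off_le: "off f a m \<le> fst f" if "f \<in> \<F>" for f a m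
    using off_mono[of m "max m (length (X f (al ! a)))" f a] X(2)[OF that, of "al ! a"]
    by (simp add: off_def)
  define ES where "ES = (\<Union>f\<in>\<F>. \<Union>a<length al. E f a ` {..<length (X f (al ! a))})"
  have finite_ES: "finite ES" unfolding ES_def using \<F>(1) by simp
  obtain es where es: "set es = ES" using finite_list[OF finite_ES] by (elim exE)
  obtain bs where bs: "set bs = bm ` \<F>" using finite_list[OF finite_imageI[OF \<F>(1), of bm]] by (elim exE)
  define rt where "rt = bm (k, t_init W)"
  have nth: "X f (al ! a) ! m \<in> set (X f (al ! a))" if "m < length (X f (al ! a))" for f a m
    using that by simp
  have "certifies G gs (length al) k (Qs, Is, Fs, Ts) (rt, bs, es)"
    unfolding certifies_def prod.case
  proof (intro conjI)
    show "fst rt = k" by (simp add: rt_def bm_def)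
    show "rt \<in> set bs" using \<F>(2) bs rt_def by blast
    show "\<forall>c\<in>set Is. \<exists>d\<in>set (snd rt). fst c = fst d \<and> word_eq G gs (snd c) (snd d)"
    proof
      fix c assume c: "c \<in> set Is"
      then have i: "(fst c, ev (snd c)) \<in> t_init W" unfolding W_def coded_automaton_mem by (metis prod.collapse)
      have w: "snd c \<in> group_words gs" using iwords[of "fst c" "snd c"] c by simp
      have "(fst c, wd (ev (snd c))) \<in> set (snd rt)"
        using tlI[OF \<F>(2)] i by (simp add: rt_def bm_def)
      moreover have "word_eq G gs (snd c) (wd (ev (snd c)))"
        using word_eq_iff[OF w wd(1)[OF ev_closed[OF w]]] wd(2)[OF ev_closed[OF w]] by simp
      ultimately show "\<exists>d\<in>set (snd rt). fst c = fst d \<and> word_eq G gs (snd c) (snd d)"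
        by (intro bexI[of _ "(fst c, wd (ev (snd c)))"]) simp_all
    qed
    show "\<forall>d\<in>set (snd rt). \<exists>c\<in>set Is. fst c = fst d \<and> word_eq G gs (snd c) (snd d)"
    proof
      fix d assume "d \<in> set (snd rt)"
      then have d: "(fst d, ev (snd d)) \<in> t_init W" "snd d \<in> group_words gs"
        using tlD[OF \<F>(2), of d] by (simp_all add: rt_def bm_def)
      then obtain x where x: "(fst d, x) \<in> set Is" "ev x = ev (snd d)" unfolding W_def coded_automaton_mem by metis
      then have "word_eq G gs x (snd d)" using word_eq_iff[OF iwords[OF x(1)] d(2)] by simp
      with x(1) show "\<exists>c\<in>set Is. fst c = fst d \<and> word_eq G gs (snd c) (snd d)"
        by (intro bexI[of _ "(fst d, x)"]) simp_all
    qed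
    show "\<forall>b\<in>set bs. (fst b = 0 \<longrightarrow> snd b = []) \<and>
        (\<forall>d\<in>set (snd b). fst d \<in> set Qs \<and> is_word gs (snd d)) \<and>
        (\<forall>d\<in>set (snd b). \<forall>(p, a, y, q)\<in>set Ts. p = fst d \<longrightarrow>
           (\<exists>(b1, a1, i, x, b')\<in>set es. b1 = b \<and> a1 = a \<and>
              (\<exists>d'\<in>set (snd b'). fst d' = q \<and> word_eq G gs (x @ snd d') (snd d @ y))))"
    proof (intro ballI conjI impI)
      fix b assume "b \<in> set bs"
      then obtain f where f: "f \<in> \<F>" "b = bm f" using bs by blast
      show "snd b = []" if "fst b = 0"
      proof -
        have "snd f = {}" using zero[OF f(1)] that f(2) by (simp add: bm_def)
        then have "set (tl f) = {}" using tl[OF f(1)] by simp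
        then show ?thesis using f(2) by (simp add: bm_def)
      qed
      fix d assume "d \<in> set (snd b)"
      then have d: "d \<in> set (tl f)" using f(2) by (simp add: bm_def)
      show "fst d \<in> set Qs" using tlD[OF f(1) d] by (simp add: W_def coded_automaton_mem)
      show "is_word gs (snd d)" using tlD[OF f(1) d] by (simp add: is_word_iff)
      fix t assume t: "t \<in> set Ts"
      obtain p a y q where t': "t = (p, a, y, q)" by (cases t)
      have "\<exists>(b1, a1, i, x, b')\<in>set es. b1 = b \<and> a1 = a \<and>
              (\<exists>d'\<in>set (snd b'). fst d' = q \<and> word_eq G gs (x @ snd d') (snd d @ y))" if p: "p = fst d"
      proof -
        have T: "(fst d, a, y, q) \<in> set Ts" using t t' p by simp
        have "(q, ev (snd d) \<otimes> ev y) \<in> post [al ! a] (snd f)"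
          unfolding post_letter[OF conf[OF f(1)]] using tlD[OF f(1) d] trans[OF T] by blast
        then obtain x where x: "x \<in> set (X f (al ! a))" "(q, ev (snd d) \<otimes> ev y) \<in> act (fst x) ` snd (snd x)"
          unfolding X(3)[OF f(1)] by blast
        obtain m where m: "m < length (X f (al ! a))" "x = X f (al ! a) ! m"
          using x(1) by (metis in_set_conv_nth)
        have x': "fst x \<in> carrier G" "snd x \<in> \<F>" using X(1)[OF f(1) x(1)] by auto
        obtain \<delta> where \<delta>: "(q, \<delta>) \<in> snd (snd x)" "ev (snd d) \<otimes> ev y = fst x \<otimes> \<delta>"
          using x(2) by (auto simp: act_def)
        have \<delta>c: "\<delta> \<in> carrier G" using conf[OF x'(2)] \<delta>(1) by auto
        have "E f a m \<in> set es" unfolding es ES_def using f(1) twords(1)[OF T] m(1) by blast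
        moreover have "(q, wd \<delta>) \<in> set (snd (bm (snd x)))"
          using tlI[OF x'(2) \<delta>(1)] by (simp add: bm_def)
        moreover have "word_eq G gs (wd (fst x) @ wd \<delta>) (snd d @ y)"
          by (rule weqI) (use \<delta> \<delta>c x' wd tlD[OF f(1) d] twords(2)[OF T] in auto)
        ultimately show ?thesis
          unfolding E_def m(2)[symmetric] f(2)
          by (intro bexI[of _ "(bm f, a, off f a m, wd (fst x), bm (snd x))"]) (auto intro!: bexI[of _ "(q, wd \<delta>)"])
      qed
      then show "case t of (p, a, y, q) \<Rightarrow> p = fst d \<longrightarrow>
           (\<exists>(b1, a1, i, x, b')\<in>set es. b1 = b \<and> a1 = a \<and>
              (\<exists>d'\<in>set (snd b'). fst d' = q \<and> word_eq G gs (x @ snd d') (snd d @ y)))"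
        unfolding t' prod.case by blast
    qed
    show "\<forall>(b, a, i, x, b')\<in>set es. b \<in> set bs \<and> b' \<in> set bs \<and> a < length al \<and> i + fst b' \<le> fst b \<and> is_word gs x \<and>
        (\<forall>d'\<in>set (snd b'). \<exists>d\<in>set (snd b). \<exists>(p, a1, y, q)\<in>set Ts.
           p = fst d \<and> a1 = a \<and> q = fst d' \<and> word_eq G gs (x @ snd d') (snd d @ y)) \<and>
        (\<forall>(b1, a1, j, y, b1')\<in>set es. b1 = b \<and> a1 = a \<longrightarrow>
           j = i \<and> y = x \<and> b1' = b' \<or> fst b' = 0 \<or> fst b1' = 0 \<or> i + fst b' \<le> j \<or> j + fst b1' \<le> i)"
    proof
      fix e assume "e \<in> set es"
      then obtain f a m where e: "f \<in> \<F>" "a < length al" "m < length (X f (al ! a))" "e = E f a m"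
        unfolding es ES_def by blast
      define x where "x = X f (al ! a) ! m"
      have x: "x \<in> set (X f (al ! a))" unfolding x_def using nth[OF e(3)] .
      have x': "fst x \<in> carrier G" "snd x \<in> \<F>" using X(1)[OF e(1) x] by auto
      show "case e of (b, a, i, x, b') \<Rightarrow> b \<in> set bs \<and> b' \<in> set bs \<and> a < length al \<and> i + fst b' \<le> fst b \<and> is_word gs x \<and>
        (\<forall>d'\<in>set (snd b'). \<exists>d\<in>set (snd b). \<exists>(p, a1, y, q)\<in>set Ts.
           p = fst d \<and> a1 = a \<and> q = fst d' \<and> word_eq G gs (x @ snd d') (snd d @ y)) \<and>
        (\<forall>(b1, a1, j, y, b1')\<in>set es. b1 = b \<and> a1 = a \<longrightarrow>
           j = i \<and> y = x \<and> b1' = b' \<or> fst b' = 0 \<or> fst b1' = 0 \<or> i + fst b' \<le> j \<or> j + fst b1' \<le> i)"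
        unfolding e(4) E_def prod.case x_def[symmetric]
      proof (intro conjI ballI)
        show "bm f \<in> set bs" "bm (snd x) \<in> set bs" using bs e(1) x'(2) by auto
        show "a < length al" by (rule e(2))
        show "off f a m + fst (bm (snd x)) \<le> fst (bm f)"
          using off_step[OF e(3)] off_le[OF e(1), of a "Suc m"] by (simp add: bm_def x_def)
        show "is_word gs (wd (fst x))" using wd(1)[OF x'(1)] by (simp add: is_word_iff)
      next
        fix d' assume "d' \<in> set (snd (bm (snd x)))"
        then have d': "(fst d', ev (snd d')) \<in> snd (snd x)" "snd d' \<in> group_words gs"
          using tlD[OF x'(2), of d'] by (simp_all add: bm_def)
        have "act (fst x) (fst d', ev (snd d')) \<in> post [al ! a] (snd f)"
          unfolding X(3)[OF e(1)] using x d'(1) by blast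
        then obtain q \<delta> \<alpha> where q: "(q, \<delta>) \<in> snd f" "(q, al ! a, \<alpha>, fst d') \<in> transitions W"
          "fst x \<otimes> ev (snd d') = \<delta> \<otimes> \<alpha>"
          unfolding post_letter[OF conf[OF e(1)]] by (auto simp: act_def)
        obtain a1 y where t: "(q, a1, y, fst d') \<in> set Ts" "al ! a = al ! a1" "\<alpha> = ev y"
          using q(2) unfolding W_def coded_automaton_mem by blast
        have "a1 = a" using t(2) twords(1)[OF t(1)] e(2) distinct_al by (simp add: nth_eq_iff_index_eq)
        have \<delta>: "\<delta> \<in> carrier G" using conf[OF e(1)] q(1) by auto
        have "word_eq G gs (wd (fst x) @ snd d') (wd \<delta> @ y)"
          by (rule weqI) (use q(3) t(3) \<delta> x' wd d'(2) twords(2)[OF t(1)] in auto)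
        moreover have "(q, wd \<delta>) \<in> set (snd (bm f))" using tlI[OF e(1) q(1)] by (simp add: bm_def)
        ultimately show "\<exists>d\<in>set (snd (bm f)). \<exists>(p, a1, y, q)\<in>set Ts.
           p = fst d \<and> a1 = a \<and> q = fst d' \<and> word_eq G gs (wd (fst x) @ snd d') (snd d @ y)"
          using t(1) \<open>a1 = a\<close> by (intro bexI[of _ "(q, wd \<delta>)"] bexI[of _ "(q, a, y, fst d')"]) auto
      next
        fix e' assume "e' \<in> set es"
        then obtain f1 a1 m1 where e': "f1 \<in> \<F>" "a1 < length al" "m1 < length (X f1 (al ! a1))" "e' = E f1 a1 m1"
          unfolding es ES_def by blast
        show "case e' of (b1, a1, j, y, b1') \<Rightarrow> b1 = bm f \<and> a1 = a \<longrightarrow>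
           j = off f a m \<and> y = wd (fst x) \<and> b1' = bm (snd x) \<or> fst (bm (snd x)) = 0 \<or> fst b1' = 0 \<or>
           off f a m + fst (bm (snd x)) \<le> j \<or> j + fst b1' \<le> off f a m"
          unfolding e'(4) E_def prod.case
        proof
          assume "bm f1 = bm f \<and> a1 = a"
          then have eq: "f1 = f" "a1 = a" using bm_inj[OF e'(1) e(1)] by auto
          have step: "off f a m + fst (bm (snd x)) = off f a (Suc m)"
            "off f a m1 + fst (bm (snd (X f (al ! a) ! m1))) = off f a (Suc m1)"
            using off_step[OF e(3)] off_step[of m1 f a] e'(3) eq by (simp_all add: bm_def x_def)
          consider "m1 = m" | "Suc m \<le> m1" | "Suc m1 \<le> m" by linarith
          then show "off f1 a1 m1 = off f a m \<and> wd (fst (X f1 (al ! a1) ! m1)) = wd (fst x) \<and>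
             bm (snd (X f1 (al ! a1) ! m1)) = bm (snd x) \<or> fst (bm (snd x)) = 0 \<or>
             fst (bm (snd (X f1 (al ! a1) ! m1))) = 0 \<or> off f a m + fst (bm (snd x)) \<le> off f1 a1 m1 \<or>
             off f1 a1 m1 + fst (bm (snd (X f1 (al ! a1) ! m1))) \<le> off f a m"
          proof cases
            case 1
            then show ?thesis unfolding eq x_def by simp
          next
            case 2
            from off_mono[OF this, of f a] show ?thesis unfolding eq step by simp
          next
            case 3
            from off_mono[OF this, of f a] show ?thesis unfolding eq step by simp
          qed
        qed
      qed
    qed
  qed
  then show ?thesis by blast
qed

text \<open>Provides an input for the algorithm, from which the mere existence of the sequential
  automaton will be deduced.\<close>

lemma automaton_code_exists:
  fixes W :: "('q, 'c, 'a) automaton"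
  assumes "weighted_automaton (set al) G W"
  shows "\<exists>n. automaton_code G al gs n W"
proof -
  obtain \<nu> :: "'q \<Rightarrow> nat" where \<nu>: "inj_on \<nu> (states W)"
  proof -
    have "finite (states W)" using assms unfolding weighted_automaton_def by simp
    from finite_imp_inj_to_nat_seg[OF this] show ?thesis using that by (elim exE conjE)
  qed
  obtain wd where wd: "\<And>g. g \<in> carrier G \<Longrightarrow> wd g \<in> group_words gs" "\<And>g. g \<in> carrier G \<Longrightarrow> ev (wd g) = g"
    using word_choice by blast
  have "\<forall>a. \<exists>i. a \<in> set al \<longrightarrow> i < length al \<and> al ! i = a" by (metis in_set_conv_nth)
  then obtain ix where ix: "\<And>a. a \<in> set al \<Longrightarrow> ix a < length al \<and> al ! ix a = a" by metis
  have fin: "finite (states W)" "finite (t_init W)" "finite (t_final W)" "finite (transitions W)"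
    and sub: "t_init W \<subseteq> states W \<times> carrier G" "t_final W \<subseteq> states W \<times> carrier G"
      "transitions W \<subseteq> states W \<times> set al \<times> carrier G \<times> states W"
    using assms unfolding weighted_automaton_def by auto
  obtain Qs where Qs: "set Qs = \<nu> ` states W" using finite_list[OF finite_imageI[OF fin(1), of \<nu>]] by (elim exE)
  obtain Is where Is: "set Is = (\<lambda>(p, \<alpha>). (\<nu> p, wd \<alpha>)) ` t_init W"
    using finite_list[OF finite_imageI[OF fin(2), of "\<lambda>(p, \<alpha>). (\<nu> p, wd \<alpha>)"]] by (elim exE)
  obtain Fs where Fs: "set Fs = (\<lambda>(p, \<alpha>). (\<nu> p, wd \<alpha>)) ` t_final W"
    using finite_list[OF finite_imageI[OF fin(3), of "\<lambda>(p, \<alpha>). (\<nu> p, wd \<alpha>)"]] by (elim exE)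
  obtain Ts where Ts: "set Ts = (\<lambda>(p, a, \<alpha>, q). (\<nu> p, ix a, wd \<alpha>, \<nu> q)) ` transitions W"
    using finite_list[OF finite_imageI[OF fin(4), of "\<lambda>(p, a, \<alpha>, q). (\<nu> p, ix a, wd \<alpha>, \<nu> q)"]] by (elim exE)
  have "(\<lambda>(p, x). (p, ev x)) ` set Is = (\<lambda>(p, \<alpha>). (\<nu> p, \<alpha>)) ` t_init W"
    unfolding Is image_image by (rule image_cong) (use sub(1) wd in auto)
  moreover have "(\<lambda>(p, x). (p, ev x)) ` set Fs = (\<lambda>(p, \<alpha>). (\<nu> p, \<alpha>)) ` t_final W"
    unfolding Fs image_image by (rule image_cong) (use sub(2) wd in auto)
  moreover have "(\<lambda>(p, a, x, q). (p, al ! a, ev x, q)) ` set Ts =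
      (\<lambda>(p, a, \<alpha>, q). (\<nu> p, a, \<alpha>, \<nu> q)) ` transitions W"
    unfolding Ts image_image by (rule image_cong) (use sub(3) wd ix in auto)
  ultimately have "coded_automaton G al gs (Qs, Is, Fs, Ts) = map_states \<nu> W"
    unfolding coded_automaton_def map_states_def using Qs by simp
  moreover have "valid_code al gs (Qs, Is, Fs, Ts)"
    unfolding valid_code_def prod.case Is Fs Ts using sub wd ix by auto
  ultimately show ?thesis unfolding automaton_code_iff using \<nu> by blast
qed

lemma sequential_code_computable:
  "\<exists>f. recursive_in (word_problem G gs) f \<and>
     (\<forall>(W :: ('q, 'c, 'a) automaton) n. weighted_automaton (set al) G W \<and>
        branching_twinning_property G k W \<and> automaton_code G al gs n W \<longrightarrow>
        (\<exists>m (W' :: (nat, 'c, 'a) automaton). f n = Some m \<and> automaton_code G al gs m W' \<and>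
           weighted_automaton (set al) G W' \<and> k_sequential (set al) G k W' \<and>
           computed_relation G W' = computed_relation G W))"
proof -
  have "surj (code :: certificate \<Rightarrow> nat)"
    by (intro surj_code_prod surj_code_list surj_code_nat)
  from recursive_search[OF this computable_certifies[of G gs "length al" k] computable_sequential_code[of _ k]]
  obtain f where f: "recursive_in (word_problem G gs) f"
    "\<And>w. \<exists>c. certifies G gs (length al) k w c \<Longrightarrow>
      \<exists>c. certifies G gs (length al) k w c \<and> f (code w) = Some (code (sequential_code k w c))"
    by blast
  have "\<exists>m (W' :: (nat, 'c, 'a) automaton). f n = Some m \<and> automaton_code G al gs m W' \<and>
           weighted_automaton (set al) G W' \<and> k_sequential (set al) G k W' \<and>
           computed_relation G W' = computed_relation G W"
    if wa: "weighted_automaton (set al) G W" and btp: "branching_twinning_property G k W"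
      and code: "automaton_code G al gs n W" for W :: "('q, 'c, 'a) automaton" and n
  proof -
    obtain \<nu> w where w: "n = code w" "valid_code al gs w" "inj_on \<nu> (states W)"
      "coded_automaton G al gs w = map_states \<nu> W" using code unfolding automaton_code_iff by blast
    obtain Qs Is Fs Ts where w': "w = (Qs, Is, Fs, Ts)" by (cases w)
    interpret R: renamed_automaton G \<Gamma> "set al" W \<nu>
      by unfold_locales (rule wa, rule w(3))
    have wa': "weighted_automaton (set al) G (coded_automaton G al gs w)"
      unfolding w(4) by (rule R.map_states_wa)
    have "branching_twinning_property G k (coded_automaton G al gs w)"
      unfolding w(4) by (rule R.branching_twinning_rename[OF btp])
    from certificate_exists[OF w(2)[unfolded w'] wa'[unfolded w'] this[unfolded w']]
    obtain c where c: "certifies G gs (length al) k w c" "f (code w) = Some (code (sequential_code k w c))"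
      using f(2)[of w] unfolding w' by blast
    obtain rt bs es where c': "c = (rt, bs, es)" by (cases c)
    note W' = coded_sequential_code[OF w(2)[unfolded w'] wa'[unfolded w'] c(1)[unfolded w' c']]
    \<comment> \<open>The states of the output are numbers already, so the identity numbers
      them.\<close>
    have "coded_automaton G al gs (sequential_code k w c) =
      map_states id (coded_automaton G al gs (sequential_code k w c))"
      by (simp add: map_states_def)
    then have "automaton_code G al gs (code (sequential_code k w c)) (coded_automaton G al gs (sequential_code k w c))"
      unfolding automaton_code_iff
      using valid_sequential_code[OF w(2)[unfolded w'] c(1)[unfolded w' c']] unfolding w' c'
      by (intro exI[of _ id] exI[of _ "sequential_code k (Qs, Is, Fs, Ts) (rt, bs, es)"]) simp
    with W' c(2) R.computed_relation_rename show ?thesis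
      unfolding w(1) w(4)[symmetric] w' c' by blast
  qed
  with f(1) show ?thesis by blast
qed

end

theorem theorem2:
  fixes G :: "('g, 'b) monoid_scheme"
    and \<Gamma> :: "'g set"
    and A :: "'a set"
    and k :: nat
  assumes "group G"
    and "finite \<Gamma>" and "\<Gamma> \<subseteq> carrier G" and "generate G \<Gamma> = carrier G"
    and "infinitary G"
    and "finite A"
    and "k > 0"
  shows
    "(\<forall>W :: ('q, 'a, 'g) automaton. weighted_automaton A G W \<and> trimmed W \<longrightarrow>
        (lipschitz_property G \<Gamma> k (computed_relation G W) \<longleftrightarrow>
           branching_twinning_property G k W) \<and>
        (branching_twinning_property G k W \<longleftrightarrow>
           (\<exists>W' :: (nat, 'a, 'g) automaton.
              weighted_automaton A G W' \<and> k_sequential A G k W' \<and>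
              computed_relation G W' = computed_relation G W))) \<and>
     (\<forall>al gs. distinct al \<and> set al = A \<and> set gs = \<Gamma> \<longrightarrow>
        (\<exists>f. recursive_in (word_problem G gs) f \<and>
           (\<forall>(W :: ('q, 'a, 'g) automaton) n.
              weighted_automaton A G W \<and> trimmed W \<and>
              branching_twinning_property G k W \<and> automaton_code G al gs n W \<longrightarrow>
              (\<exists>m (W' :: (nat, 'a, 'g) automaton).
                 f n = Some m \<and> automaton_code G al gs m W' \<and>
                 weighted_automaton A G W' \<and> k_sequential A G k W' \<and>
                 computed_relation G W' = computed_relation G W))))"
proof -
  interpret generated_group G \<Gamma>
    using assms by (simp add: generated_group_def generated_group_axioms_def)
  have effective: "\<exists>f. recursive_in (word_problem G gs) f \<and>
     (\<forall>(W :: ('q, 'a, 'g) automaton) n. weighted_automaton A G W \<and>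
        branching_twinning_property G k W \<and> automaton_code G al gs n W \<longrightarrow>
        (\<exists>m (W' :: (nat, 'a, 'g) automaton). f n = Some m \<and> automaton_code G al gs m W' \<and>
           weighted_automaton A G W' \<and> k_sequential A G k W' \<and>
           computed_relation G W' = computed_relation G W))"
    if "distinct al" "set al = A" "set gs = \<Gamma>" for al :: "'a list" and gs
  proof -
    interpret effective_group G \<Gamma> gs al by unfold_locales (rule that(3), rule that(1))
    from sequential_code_computable[of k] show ?thesis unfolding that(2) .
  qed
  obtain al where al: "distinct al" "set al = A" using finite_distinct_list[OF assms(6)] by blast
  obtain gs where set_gens: "set gs = \<Gamma>" using finite_list[OF assms(2)] by blast
  have "(lipschitz_property G \<Gamma> k (computed_relation G W) \<longleftrightarrow> branching_twinning_property G k W) \<and>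
        (branching_twinning_property G k W \<longleftrightarrow>
           (\<exists>W' :: (nat, 'a, 'g) automaton.
              weighted_automaton A G W' \<and> k_sequential A G k W' \<and>
              computed_relation G W' = computed_relation G W))"
    if W: "weighted_automaton A G W" "trimmed W" for W :: "('q, 'a, 'g) automaton"
  proof -
    interpret group_automaton G \<Gamma> A W by unfold_locales (rule W(1))
    have "branching_twinning_property G k W" if "lipschitz_property G \<Gamma> k (computed_relation G W)"
      by (rule lipschitz_imp_branching_twinning[OF assms(5) W(2) that])
    moreover have "\<exists>W' :: (nat, 'a, 'g) automaton. weighted_automaton A G W' \<and> k_sequential A G k W' \<and>
      computed_relation G W' = computed_relation G W" if btp: "branching_twinning_property G k W"
    proof -
      interpret effective_group G \<Gamma> gs al by unfold_locales (rule set_gens, rule al(1))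
      \<comment> \<open>Existence is read off the effective part: the search is run on some code of
        \<open>W\<close>, and its output describes the required automaton on numbers.\<close>
      obtain n where "automaton_code G al gs n W" using automaton_code_exists[of W] W(1) al(2) by blast
      with effective[OF al set_gens] W(1) btp show ?thesis by blast
    qed
    moreover have "lipschitz_property G \<Gamma> k (computed_relation G W)"
      if "k_sequential A G k W'" "computed_relation G W' = computed_relation G W"
      for W' :: "(nat, 'a, 'g) automaton"
      using k_sequential_imp_lipschitz[OF that(1)] that(2) by simp
    ultimately show ?thesis by blast
  qed
  moreover have "\<exists>f. recursive_in (word_problem G gs) f \<and>
           (\<forall>(W :: ('q, 'a, 'g) automaton) n.
              weighted_automaton A G W \<and> trimmed W \<and>
              branching_twinning_property G k W \<and> automaton_code G al gs n W \<longrightarrow>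
              (\<exists>m (W' :: (nat, 'a, 'g) automaton).
                 f n = Some m \<and> automaton_code G al gs m W' \<and>
                 weighted_automaton A G W' \<and> k_sequential A G k W' \<and>
                 computed_relation G W' = computed_relation G W))"
    if "distinct al \<and> set al = A \<and> set gs = \<Gamma>" for al :: "'a list" and gs
    using effective[of al gs] that by blast
  ultimately show ?thesis by blast
qed

end
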